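(* Let $(X,\mathscr{B},\mu)$ be a probability space and $T,R,S:X\to X$ be measure preserving automorphisms. Suppose that $T$ has singular spectrum, $R$ and $S$ commute, and $S$ is weakly mixing. Let $\ell\in\mathbb{N}$ and let $p_1,\dots,p_\ell\in\mathbb{Q}[x]$ be pairwise essentially distinct integer polynomials, each having degree at least $2$. For any $f,h,g_1,\dots,g_\ell\in L^\infty(X,\mu)$ satisfying $\int_Xg_j\,d\mu=0$ for some $1\le j\le\ell$, $$\lim_{N\to\infty}\frac1N\sum_{n=1}^N T^nf\cdot R^nh\prod_{j=1}^{\ell}S^{p_j(n)}g_j=0,$$ with convergence taking place in $L^2(X,\mu)$.
   Context: $\mathbb{N}=\{1,2,\dots\}$. A polynomial $p\in\mathbb{Q}[x]$ is an integer polynomial if $p(x)\in\mathbb{Z}$ for every integer $x$. Integer polynomials $p$ and $q$ are essentially distinct if $p-q$ is not constant. A measure preserving automorphism $R$ of $(X,\mathscr{B},\mu)$ is an invertible bi-measurable map with $\mu(R^{-1}A)=\mu(A)=\mu(RA)$ for all $A\in\mathscr{B}$; it acts on functions by $Rf=f\circ R$. It is weakly mixing if $R\times R$ is ergodic on $(X\times X,\mathscr{B}\otimes\mathscr{B},\mu\times\mu)$. For $f\in L^2(X,\mu)$, the spectral measure $\mu_{f,R}$ is the positive measure on $[0,1]$ with $\widehat{\mu_{f,R}}(n)=\langle R^nf,f\rangle$ (Fourier coefficients). There is a measure $\mu_R$ representing the maximal spectral type of $R$, i.e. the maximal spectral type of the unitary operator $R$ on $L^2_0(X,\mu)=\{f\in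 L^2(X,\mu):\int f\,d\mu=0\}$, so $\mu_{f,R}\ll\mu_R$ for all $f\in L^2_0(X,\mu)$. $R$ has singular spectrum if $\mu_R\perp\mathcal{L}$, where $\mathcal{L}$ is Lebesgue measure on $[0,1]$. *)

theory Defs
  imports "HOL-Probability.Probability" "HOL-Computational_Algebra.Polynomial"
begin

definition mp_automorphism :: "'a measure \<Rightarrow> ('a \<Rightarrow> 'a) \<Rightarrow> bool" where
  "mp_automorphism M R \<longleftrightarrow>
     bij_betw R (space M) (space M) \<and>
     R \<in> measurable M M \<and>
     the_inv_into (space M) R \<in> measurable M M \<and>
     (\<forall>A\<in>sets M. emeasure M (R -` A \<inter> space M) = emeasure M A \<and>
                  emeasure M (R ` A) = emeasure M A)"

definition aut_pow :: "'a measure \<Rightarrow> ('a \<Rightarrow> 'a) \<Rightarrow> int \<Rightarrow> 'a \<Rightarrow> 'a" where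
  "aut_pow M R k =
     (if 0 \<le> k then R ^^ nat k else the_inv_into (space M) R ^^ nat (- k))"

text \<open>The function usually written \<open>R^k f\<close>, for integer \<open>k\<close>.\<close>

definition koopman :: "'a measure \<Rightarrow> ('a \<Rightarrow> 'a) \<Rightarrow> int \<Rightarrow> ('a \<Rightarrow> complex) \<Rightarrow> 'a \<Rightarrow> complex" where
  "koopman M R k f = f \<circ> aut_pow M R k"

definition ergodic :: "'a measure \<Rightarrow> ('a \<Rightarrow> 'a) \<Rightarrow> bool" where
  "ergodic M R \<longleftrightarrow>
     (\<forall>A\<in>sets M. R -` A \<inter> space M = A \<longrightarrow>
        emeasure M A = 0 \<or> emeasure M (space M - A) = 0)"

definition weakly_mixing :: "'a measure \<Rightarrow> ('a \<Rightarrow> 'a) \<Rightarrow> bool" where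
  "weakly_mixing M R \<longleftrightarrow> ergodic (M \<Otimes>\<^sub>M M) (map_prod R R)"

text \<open>Elements of the (complex) spaces \<open>L^2\<close> and \<open>L^\<infinity>\<close> are given by representatives.\<close>

definition in_L2 :: "'a measure \<Rightarrow> ('a \<Rightarrow> complex) \<Rightarrow> bool" where
  "in_L2 M f \<longleftrightarrow> f \<in> borel_measurable M \<and> integrable M (\<lambda>x. (norm (f x))\<^sup>2)"

definition in_L2_0 :: "'a measure \<Rightarrow> ('a \<Rightarrow> complex) \<Rightarrow> bool" where
  "in_L2_0 M f \<longleftrightarrow> in_L2 M f \<and> (LINT x|M. f x) = 0"

definition in_Linf :: "'a measure \<Rightarrow> ('a \<Rightarrow> complex) \<Rightarrow> bool" where
  "in_Linf M f \<longleftrightarrow> f \<in> borel_measurable M \<and> (\<exists>C. AE x in M. norm (f x) \<le> C)"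

definition L2_inner :: "'a measure \<Rightarrow> ('a \<Rightarrow> complex) \<Rightarrow> ('a \<Rightarrow> complex) \<Rightarrow> complex" where
  "L2_inner M f g = (LINT x|M. f x * cnj (g x))"

definition L2_norm :: "'a measure \<Rightarrow> ('a \<Rightarrow> complex) \<Rightarrow> real" where
  "L2_norm M f = sqrt (LINT x|M. (norm (f x))\<^sup>2)"

definition L2_tendsto :: "'a measure \<Rightarrow> (nat \<Rightarrow> 'a \<Rightarrow> complex) \<Rightarrow> ('a \<Rightarrow> complex) \<Rightarrow> bool" where
  "L2_tendsto M F f \<longleftrightarrow>
     (\<forall>N. in_L2 M (F N)) \<and> in_L2 M f \<and>
     (\<lambda>N. L2_norm M (\<lambda>x. F N x - f x)) \<longlonglongrightarrow> 0"

text \<open>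
  Spectral measures live on \<open>[0,1]\<close> with the endpoints identified (Fourier coefficients cannot
  tell an atom at 0 from an atom at 1). The representative \<open>[0,1)\<close> of this circle is used, so that
  a spectral measure is determined by its Fourier coefficients.
\<close>

definition finite_circle_measure :: "real measure \<Rightarrow> bool" where
  "finite_circle_measure \<nu> \<longleftrightarrow> finite_measure \<nu> \<and> sets \<nu> = sets (restrict_space borel {0..<1})"

definition circle_lebesgue :: "real measure" where
  "circle_lebesgue = restrict_space lborel {0..<1}"

definition fourier_coeff :: "real measure \<Rightarrow> int \<Rightarrow> complex" where
  "fourier_coeff \<nu> n = (LINT t|\<nu>. cis (- (2 * pi * of_int n * t)))"

definition is_spectral_measure :: "'a measure \<Rightarrow> ('a \<Rightarrow> 'a) \<Rightarrow> ('a \<Rightarrow> complex) \<Rightarrow> real measure \<Rightarrow> bool" where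
  "is_spectral_measure M R f \<nu> \<longleftrightarrow>
     finite_circle_measure \<nu> \<and> (\<forall>n::int. fourier_coeff \<nu> n = L2_inner M (koopman M R n f) f)"

text \<open>
  The maximal spectral type is the least type, with respect to absolute continuity, that dominates
  all spectral measures of functions in \<open>L^2_0\<close>; it is determined up to equivalence of measures.
  Note that \<open>absolutely_continuous \<sigma> \<nu>\<close> means \<open>\<nu> \<lless> \<sigma>\<close>.
\<close>

definition dominates_spectral_measures :: "'a measure \<Rightarrow> ('a \<Rightarrow> 'a) \<Rightarrow> real measure \<Rightarrow> bool" where
  "dominates_spectral_measures M R \<sigma> \<longleftrightarrow>
     (\<forall>f \<nu>. in_L2_0 M f \<longrightarrow> is_spectral_measure M R f \<nu> \<longrightarrow> absolutely_continuous \<sigma> \<nu>)"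

definition is_maximal_spectral_type :: "'a measure \<Rightarrow> ('a \<Rightarrow> 'a) \<Rightarrow> real measure \<Rightarrow> bool" where
  "is_maximal_spectral_type M R \<sigma> \<longleftrightarrow>
     finite_circle_measure \<sigma> \<and> dominates_spectral_measures M R \<sigma> \<and>
     (\<forall>\<tau>. finite_circle_measure \<tau> \<longrightarrow> dominates_spectral_measures M R \<tau> \<longrightarrow>
           absolutely_continuous \<tau> \<sigma>)"

definition mutually_singular :: "'b measure \<Rightarrow> 'b measure \<Rightarrow> bool" where
  "mutually_singular \<mu> \<nu> \<longleftrightarrow>
     (\<exists>A\<in>sets \<mu> \<inter> sets \<nu>. emeasure \<mu> A = 0 \<and> emeasure \<nu> (space \<nu> - A) = 0)"

definition singular_spectrum :: "'a measure \<Rightarrow> ('a \<Rightarrow> 'a) \<Rightarrow> bool" where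
  "singular_spectrum M R \<longleftrightarrow>
     (\<exists>\<sigma>. is_maximal_spectral_type M R \<sigma> \<and> mutually_singular \<sigma> circle_lebesgue)"

definition integer_poly :: "rat poly \<Rightarrow> bool" where
  "integer_poly p \<longleftrightarrow> (\<forall>x::int. poly p (of_int x) \<in> \<int>)"

definition essentially_distinct :: "rat poly \<Rightarrow> rat poly \<Rightarrow> bool" where
  "essentially_distinct p q \<longleftrightarrow> \<not> (\<exists>c. p - q = [:c:])"

text \<open>The value of an integer polynomial, as an \<open>int\<close>; the floor is only a conversion of type.\<close>

definition ipoly_value :: "rat poly \<Rightarrow> int \<Rightarrow> int" where
  "ipoly_value p x = \<lfloor>poly p (of_int x)\<rfloor>"

end

theory Submission
  imports Defs
begin

text \<open>
  \<^bold>\<open>The singular spectrum of \<open>T\<close>.\<close>  Write \<open>v n = R^n h \<cdot> (\<Prod>j. S^(p j n) (g j))\<close>.  Suppose that the correlations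
  \<open>\<langle>v (n + k), v n\<rangle>\<close> tend to \<open>0\<close> in mean for every \<open>k \<noteq> 0\<close>.  The spectral measure of a function \<open>f\<close> with
  integral zero is singular, so some trigonometric polynomial with coefficients \<open>c k\<close> is close to 1
  for this measure and close to 0 for Lebesgue measure, both in \<open>L^2\<close>
  (\<open>singular_trig_poly\<close>).  In other words \<open>f\<close> is close to \<open>\<Sum>k. c k T^k f\<close> while \<open>\<Sum>k. |c k|^2\<close> is small
  (\<open>singular_spectrum_approximation\<close>).  After this replacement and a shift of the summation index the
  average of \<open>T^n f \<cdot> v n\<close> becomes that of \<open>T^n f \<cdot> w n\<close> with \<open>w n = \<Sum>k. c k v (n - k)\<close>.  Since
  \<open>v\<close> is asymptotically uncorrelated, the mean of \<open>\<parallel>w n\<parallel>^2\<close> is at most about \<open>\<Sum>k. |c k|^2\<close> times a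
  bound for \<open>\<parallel>v n\<parallel>^2\<close>, and the Cauchy--Schwarz inequality finishes the argument
  (\<open>singular_orthogonality_L1\<close>).  For a constant \<open>f\<close> the claim is van der Corput's lemma.

  \<^bold>\<open>The correlations.\<close>  By multilinearity all \<open>g j\<close> may be assumed to have integral zero; constant
  factors are dropped, and at least one \<open>g j\<close> is left.  The correlation is then an integral of some
  \<open>R^n H\<close> times a product over the polynomials \<open>p j (n + k)\<close> and \<open>p j n\<close>.  Some of these may agree
  up to a constant, and their factors are multiplied together.  Since the degrees are at least 2, a
  translation by \<open>k \<noteq> 0\<close> moves each \<open>p j\<close> out of its class modulo constants, and
  it cannot permute finitely many such classes; so some group consists of a single function, which has
  integral zero (\<open>prod_integral_grouped_eq_0\<close>).  It remains to see that the averages of these integrals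
  converge to the product of the integrals (\<open>nonlinear_factorizes\<close>).  One application of van der
  Corput's lemma to \<open>R^(-n) (\<Prod>j. S^(p j n) (g j))\<close> removes \<open>R\<close>, as \<open>R\<close> commutes with \<open>S\<close>
  (\<open>decays_step\<close>).  What is left concerns the weakly mixing \<open>S\<close> alone and is Bergelson's polynomial
  ergodic theorem, proved by PET induction (\<open>weakly_mixing_decays\<close>).
\<close>

section \<open>Averages and bounded measurable functions\<close>

text \<open>The average over \<open>1, \<dots>, N\<close> of a sequence indexed by the integers; it is 0 for \<open>N = 0\<close>.
  Indexing by all integers allows shifts of the sequence in both directions.\<close>

definition avg :: "(int \<Rightarrow> 'b::real_normed_vector) \<Rightarrow> nat \<Rightarrow> 'b" where
  "avg a N = (\<Sum>n=1..int N. a n) /\<^sub>R real N"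

lemma avg_add: "avg (\<lambda>n. a n + b n) N = avg a N + avg b N"
  by (simp add: avg_def sum.distrib scaleR_add_right)

lemma avg_mult_left: "avg (\<lambda>n. c * a n) N = c * avg a N" for c :: "'b::real_normed_algebra"
  by (simp add: avg_def sum_distrib_left [symmetric])

lemma avg_sum: "avg (\<lambda>n. \<Sum>k\<in>K. a k n) N = (\<Sum>k\<in>K. avg (a k) N)"
proof -
  have "(\<Sum>n=1..int N. \<Sum>k\<in>K. a k n) = (\<Sum>k\<in>K. \<Sum>n=1..int N. a k n)" by (rule sum.swap)
  then show ?thesis unfolding avg_def by (simp only: scaleR_right.sum)
qed

lemma avg_const: "N > 0 \<Longrightarrow> avg (\<lambda>n. c) N = c"
  using sum_constant_scaleR[of c "{1..int N}"] by (simp add: avg_def del: sum_constant)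

lemma tendsto_avg_const: "avg (\<lambda>n. c) \<longlonglongrightarrow> c"
  by (rule tendsto_eventually, rule eventually_mono[OF eventually_gt_at_top[of 0]]) (rule avg_const)

lemma norm_avg_le: "norm (avg a N) \<le> avg (\<lambda>n. norm (a n)) N"
proof -
  have "inverse (real N) * norm (\<Sum>n=1..int N. a n) \<le> inverse (real N) * (\<Sum>n=1..int N. norm (a n))"
    by (intro mult_left_mono norm_sum) simp
  then show ?thesis by (simp add: avg_def)
qed

lemma avg_mono:
  assumes "\<And>n. a n \<le> b n" shows "avg a N \<le> (avg b N :: real)"
proof -
  have "inverse (real N) * (\<Sum>n=1..int N. a n) \<le> inverse (real N) * (\<Sum>n=1..int N. b n)"
    by (intro mult_left_mono sum_mono assms) simp
  then show ?thesis by (simp add: avg_def)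
qed

lemma avg_le_const:
  assumes "\<And>n. a n \<le> (C::real)" "0 \<le> C"
  shows "avg a N \<le> C"
proof (cases "N = 0")
  case True
  then show ?thesis using assms(2) by (simp add: avg_def)
next
  case False
  have "avg a N \<le> avg (\<lambda>_. C) N" by (rule avg_mono) (rule assms)
  also have "\<dots> = C" using False by (intro avg_const) simp
  finally show ?thesis .
qed

lemma norm_avg_le_const:
  assumes "\<And>n. norm (a n) \<le> C" "0 \<le> C"
  shows "norm (avg a N) \<le> C"
proof -
  have "avg (\<lambda>n. norm (a n)) N \<le> C" by (rule avg_le_const) (rule assms)+
  then show ?thesis using norm_avg_le[of a N] by linarith
qed

lemma norm_avg_shift_le:
  fixes a :: "int \<Rightarrow> 'b::real_normed_vector"
  assumes B: "\<And>n. norm (a n) \<le> B"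
  shows "norm (avg (\<lambda>n. a (n + k)) N - avg a N) \<le> 2 * \<bar>real_of_int k\<bar> * B / N"
proof -
  have B0: "0 \<le> B" using B[of 0] norm_ge_zero order_trans by blast
  have step: "norm ((\<Sum>n=1..int N. a (n + k + 1)) - (\<Sum>n=1..int N. a (n + k))) \<le> 2 * B" for k
  proof -
    have "(\<Sum>n=1..int N. a (n + k + 1)) - (\<Sum>n=1..int N. a (n + k)) = (if N = 0 then 0 else a (int N + k + 1) - a (1 + k))"
    proof (induction N)
      case (Suc N)
      have "{1..int (Suc N)} = insert (int N + 1) {1..int N}" by auto
      then show ?case using Suc by (auto simp: algebra_simps)
    qed auto
    also have "norm \<dots> \<le> 2 * B"
      using B0 norm_triangle_ineq4[of "a (int N + k + 1)" "a (1 + k)"] B[of "int N + k + 1"] B[of "1 + k"] by auto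
    finally show ?thesis .
  qed
  have pos: "norm ((\<Sum>n=1..int N. a (n + k + int m)) - (\<Sum>n=1..int N. a (n + k))) \<le> 2 * real m * B" for k m
  proof (induction m)
    case (Suc m)
    have "norm ((\<Sum>n=1..int N. a (n + k + int (Suc m))) - (\<Sum>n=1..int N. a (n + k)))
        \<le> norm ((\<Sum>n=1..int N. a (n + (k + int m) + 1)) - (\<Sum>n=1..int N. a (n + (k + int m))))
          + norm ((\<Sum>n=1..int N. a (n + k + int m)) - (\<Sum>n=1..int N. a (n + k)))"
      by (rule order_trans[OF _ norm_triangle_ineq]) (simp add: algebra_simps)
    then show ?case using Suc step[of "k + int m"] by (simp add: algebra_simps)
  qed auto
  have "norm ((\<Sum>n=1..int N. a (n + k)) - (\<Sum>n=1..int N. a n)) \<le> 2 * \<bar>real_of_int k\<bar> * B"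
  proof (cases "k \<ge> 0")
    case True
    then show ?thesis using pos[of 0 "nat k"] by simp
  next
    case False
    then show ?thesis using pos[of k "nat (-k)"] by (simp add: norm_minus_commute)
  qed
  then have "inverse (real N) * norm ((\<Sum>n=1..int N. a (n + k)) - (\<Sum>n=1..int N. a n))
      \<le> inverse (real N) * (2 * \<bar>real_of_int k\<bar> * B)"
    by (rule mult_left_mono) simp
  then show ?thesis
    unfolding avg_def scaleR_diff_right [symmetric] norm_scaleR
    by (simp only: abs_inverse abs_of_nat divide_inverse mult.commute)
qed

lemma tendsto_avg_shift:
  fixes a :: "int \<Rightarrow> 'b::real_normed_vector"
  assumes B: "\<And>n. norm (a n) \<le> B" and L: "avg a \<longlonglongrightarrow> L"
  shows "avg (\<lambda>n. a (n + k)) \<longlonglongrightarrow> L"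
proof -
  have "(\<lambda>N. avg (\<lambda>n. a (n + k)) N - avg a N) \<longlonglongrightarrow> 0"
  proof (rule Lim_null_comparison)
    show "\<forall>\<^sub>F N in sequentially. norm (avg (\<lambda>n. a (n + k)) N - avg a N) \<le> 2 * \<bar>real_of_int k\<bar> * B / N"
      using norm_avg_shift_le[of a B k, OF B] by simp
    show "(\<lambda>N. 2 * \<bar>real_of_int k\<bar> * B / real N) \<longlonglongrightarrow> 0"
      by (rule lim_const_over_n)
  qed
  from tendsto_add[OF this L] show ?thesis by simp
qed

text \<open>Measurable functions that are bounded everywhere, not merely almost everywhere: pointwise
  bounds then survive composition with any map.\<close>

definition bm :: "'a measure \<Rightarrow> ('a \<Rightarrow> complex) set" where
  "bm M = {f \<in> borel_measurable M. \<exists>C. \<forall>x. norm (f x) \<le> C}"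

lemma bm_measurable [measurable_dest]: "f \<in> bm M \<Longrightarrow> f \<in> borel_measurable M"
  by (simp add: bm_def)

lemma bm_bound:
  assumes "f \<in> bm M"
  obtains C where "0 \<le> C" "\<And>x. norm (f x) \<le> C"
proof -
  obtain C where "\<And>x. norm (f x) \<le> C" using assms by (auto simp: bm_def)
  moreover from this have "0 \<le> C" using norm_ge_zero order_trans by blast
  ultimately show ?thesis using that by blast
qed

lemma bmI: "f \<in> borel_measurable M \<Longrightarrow> (\<And>x. norm (f x) \<le> C) \<Longrightarrow> f \<in> bm M"
  by (auto simp: bm_def)

lemma bm_const [simp]: "(\<lambda>x. c) \<in> bm M"
  by (rule bmI[of _ _ "norm c"]) auto

lemma bm_add:
  assumes "f \<in> bm M" "g \<in> bm M" shows "(\<lambda>x. f x + g x) \<in> bm M"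
proof -
  obtain C where "\<And>x. norm (f x) \<le> C" using bm_bound[OF assms(1)] by metis
  moreover obtain D where "\<And>x. norm (g x) \<le> D" using bm_bound[OF assms(2)] by metis
  ultimately show ?thesis using assms
    by (intro bmI[of _ _ "C + D"]) (auto intro: norm_triangle_mono dest: bm_measurable)
qed

lemma bm_mult:
  assumes "f \<in> bm M" "g \<in> bm M" shows "(\<lambda>x. f x * g x) \<in> bm M"
proof -
  obtain C where "0 \<le> C" "\<And>x. norm (f x) \<le> C" using bm_bound[OF assms(1)] by metis
  moreover obtain D where "\<And>x. norm (g x) \<le> D" using bm_bound[OF assms(2)] by metis
  ultimately show ?thesis using assms
    by (intro bmI[of _ _ "C * D"]) (auto simp: norm_mult intro: mult_mono dest: bm_measurable)
qed

lemma bm_cnj: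
  assumes "f \<in> bm M" shows "(\<lambda>x. cnj (f x)) \<in> bm M"
proof -
  obtain C where "\<And>x. norm (f x) \<le> C" using bm_bound[OF assms] by metis
  moreover have "(\<lambda>x. cnj (f x)) \<in> borel_measurable M"
    using bm_measurable[OF assms]
    by (rule borel_measurable_continuous_on[OF continuous_on_cnj[OF continuous_on_id]])
  ultimately show ?thesis by (intro bmI[of _ _ C]) auto
qed

lemma bm_diff: "f \<in> bm M \<Longrightarrow> g \<in> bm M \<Longrightarrow> (\<lambda>x. f x - g x) \<in> bm M"
  using bm_add[of f M "\<lambda>x. -1 * g x"] bm_mult[of "\<lambda>_. -1" M g] by simp

lemma bm_sum: "(\<And>i. i \<in> I \<Longrightarrow> f i \<in> bm M) \<Longrightarrow> (\<lambda>x. \<Sum>i\<in>I. f i x) \<in> bm M"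
  by (induction I rule: infinite_finite_induct) (auto intro!: bm_add)

lemma bm_prod: "(\<And>i. i \<in> I \<Longrightarrow> f i \<in> bm M) \<Longrightarrow> (\<lambda>x. \<Prod>i\<in>I. f i x) \<in> bm M"
  by (induction I rule: infinite_finite_induct) (auto intro!: bm_mult)

lemma bm_compose: "f \<in> bm M \<Longrightarrow> s \<in> measurable N M \<Longrightarrow> (\<lambda>x. f (s x)) \<in> bm N"
  by (auto simp: bm_def)

lemma bm_avg: "(\<And>n. f n \<in> bm M) \<Longrightarrow> (\<lambda>x. avg (\<lambda>n. f n x) N) \<in> bm M"
  unfolding avg_def scaleR_conv_of_real by (intro bm_mult bm_sum bm_const)

lemma (in finite_measure) bm_integrable:
  assumes "f \<in> bm M" shows "integrable M f"
proof -
  obtain C where "\<And>x. norm (f x) \<le> C" using bm_bound[OF assms] by metis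
  then show ?thesis
    by (intro integrable_const_bound[of _ C]) (use assms in \<open>auto dest: bm_measurable\<close>)
qed

lemma (in finite_measure) bm_integrable_norm_power:
  assumes "f \<in> bm M" shows "integrable M (\<lambda>x. norm (f x) ^ k)"
proof -
  obtain C where C: "0 \<le> C" "\<And>x. norm (f x) \<le> C" using bm_bound[OF assms] by metis
  show ?thesis
  proof (rule integrable_const_bound[of _ "C ^ k"])
    show "AE x in M. norm (norm (f x) ^ k) \<le> C ^ k"
      using power_mono[OF C(2) norm_ge_zero] by (simp add: norm_power)
  qed (use assms bm_measurable in measurable)
qed

lemma (in finite_measure) bm_integrable_norm:
  assumes "f \<in> bm M" shows "integrable M (\<lambda>x. norm (f x))"
  using bm_integrable_norm_power[OF assms, of 1] by simp

lemma (in finite_measure) integral_avg: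
  fixes f :: "int \<Rightarrow> 'a \<Rightarrow> 'b::{banach,second_countable_topology}"
  assumes "\<And>n. integrable M (f n)"
  shows "(LINT x|M. avg (\<lambda>n. f n x) N) = avg (\<lambda>n. LINT x|M. f n x) N"
  unfolding avg_def using assms by simp

lemma (in prob_space) norm_integral_le:
  fixes f :: "'a \<Rightarrow> 'b::{banach,second_countable_topology}"
  assumes "\<And>x. norm (f x) \<le> C" "0 \<le> C"
  shows "norm (LINT x|M. f x) \<le> C"
proof (cases "integrable M f")
  case True
  have "norm (LINT x|M. f x) \<le> (LINT x|M. norm (f x))" by (rule integral_norm_bound)
  also have "\<dots> \<le> (LINT x|M. C)" using True assms by (intro integral_mono) auto
  finally show ?thesis by (simp add: prob_space)
qed (use assms in \<open>simp add: not_integrable_integral_eq\<close>)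

lemma (in prob_space) integral_norm_square_le:
  assumes "f \<in> bm M"
  shows "(LINT x|M. norm (f x))\<^sup>2 \<le> (LINT x|M. (norm (f x))\<^sup>2)"
proof -
  let ?m = "LINT x|M. norm (f x)"
  note i = bm_integrable_norm[OF assms] bm_integrable_norm_power[OF assms, of 2]
  have "0 \<le> (LINT x|M. (norm (f x) - ?m)\<^sup>2)" by simp
  also have "\<dots> = (LINT x|M. (norm (f x))\<^sup>2 - 2 * ?m * norm (f x) + ?m\<^sup>2)"
    by (simp add: power2_eq_square algebra_simps)
  also have "\<dots> = (LINT x|M. (norm (f x))\<^sup>2) - ?m\<^sup>2"
    using i by (simp add: prob_space) (simp add: power2_eq_square)
  finally show ?thesis by simp
qed

lemma norm_square_sum:
  fixes y :: "'i \<Rightarrow> complex"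
  shows "complex_of_real ((norm (\<Sum>k\<in>K. c k * y k))\<^sup>2) = (\<Sum>k\<in>K. \<Sum>j\<in>K. c k * cnj (c j) * (y k * cnj (y j)))"
  unfolding complex_norm_square cnj_sum sum_product by (simp add: mult_ac)

lemma integral_norm_square_sum:
  fixes y :: "'i \<Rightarrow> 'b \<Rightarrow> complex"
  assumes "finite_measure N" and y: "\<And>k. y k \<in> bm N"
  shows "complex_of_real (LINT t|N. (norm (\<Sum>k\<in>K. c k * y k t))\<^sup>2)
    = (\<Sum>k\<in>K. \<Sum>j\<in>K. c k * cnj (c j) * (LINT t|N. y k t * cnj (y j t)))"
proof -
  interpret finite_measure N by fact
  have i: "integrable N (\<lambda>t. c k * cnj (c j) * (y k t * cnj (y j t)))" for k j
    by (intro bm_integrable bm_mult bm_const bm_cnj y)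
  have "complex_of_real (LINT t|N. (norm (\<Sum>k\<in>K. c k * y k t))\<^sup>2)
      = (LINT t|N. complex_of_real ((norm (\<Sum>k\<in>K. c k * y k t))\<^sup>2))"
    by (rule integral_complex_of_real[symmetric])
  also have "\<dots> = (LINT t|N. (\<Sum>k\<in>K. \<Sum>j\<in>K. c k * cnj (c j) * (y k t * cnj (y j t))))"
    by (simp only: norm_square_sum)
  also have "\<dots> = (\<Sum>k\<in>K. \<Sum>j\<in>K. LINT t|N. c k * cnj (c j) * (y k t * cnj (y j t)))"
    using i by (simp add: Bochner_Integration.integral_sum)
  finally show ?thesis by simp
qed

section \<open>The ergodic theorem and weak mixing\<close>

text \<open>The maximal ergodic theorem, by Garsia's argument.\<close>

lemma (in prob_space) maximal_ergodic:
  fixes F :: "'a \<Rightarrow> real"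
  assumes U [measurable]: "U \<in> measurable M M" and inv: "distr M M U = M"
    and F: "integrable M F"
    and pos: "AE x in M. \<exists>n. 0 < (\<Sum>i<n. F ((U ^^ i) x))"
  shows "0 \<le> (LINT x|M. F x)"
proof -
  have [measurable]: "F \<in> borel_measurable M" using F by auto
  \<comment> \<open>\<open>m N\<close> is the maximum of the first \<open>N + 1\<close> ergodic sums of \<open>F\<close>, the empty one included.\<close>
  define m where "m = rec_nat (\<lambda>x. 0) (\<lambda>_ g x. max 0 (F x + g (U x)))"
  have m0: "m 0 = (\<lambda>x. 0)" and mS: "m (Suc N) = (\<lambda>x. max 0 (F x + m N (U x)))" for N
    by (simp_all add: m_def)
  have m_int: "integrable M (m N)" for N
  proof (induction N)
    case (Suc N)
    have "integrable M (\<lambda>x. m N (U x))"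
      using Suc inv integrable_distr[OF U, of "m N"] by simp
    then show ?case unfolding mS using F by auto
  qed (simp add: m0)
  have m_nonneg: "0 \<le> m N x" for N x by (cases N) (auto simp: m0 mS)
  have m_mono: "m N x \<le> m (Suc N) x" for N x
  proof (induction N arbitrary: x)
    case (Suc N)
    show ?case using Suc[of "U x"] unfolding mS[of N] mS[of "Suc N"] by (intro max.mono) auto
  qed (simp add: m0 mS)
  have m_mono': "N \<le> N' \<Longrightarrow> m N x \<le> m N' x" for N N' x
    by (rule lift_Suc_mono_le[of "\<lambda>N. m N x"]) (use m_mono in auto)
  have sum_le: "(\<Sum>i<n. F ((U ^^ i) x)) \<le> m n x" for n x
  proof (induction n arbitrary: x)
    case (Suc n)
    have "(\<Sum>i<Suc n. F ((U ^^ i) x)) = F x + (\<Sum>i<n. F ((U ^^ i) (U x)))"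
      by (subst sum.lessThan_Suc_shift) (simp add: funpow_swap1 del: sum.lessThan_Suc)
    also have "\<dots> \<le> F x + m n (U x)" using Suc by simp
    finally show ?case by (simp add: mS)
  qed (simp add: m0)
  have le: "0 \<le> (LINT x|M. indicator {x. 0 < m (Suc N) x} x * F x)" for N
  proof -
    have [measurable]: "m N \<in> borel_measurable M" for N using m_int by auto
    have iU: "integrable M (\<lambda>x. m (Suc N) (U x))"
      using m_int inv integrable_distr[OF U, of "m (Suc N)"] by simp
    have "(LINT x|M. m (Suc N) (U x)) = (LINT x|distr M M U. m (Suc N) x)"
      by (rule integral_distr[symmetric]) auto
    then have "0 = (LINT x|M. m (Suc N) x - m (Suc N) (U x))"
      using iU m_int inv by simp
    also have "\<dots> \<le> (LINT x|M. indicator {x. 0 < m (Suc N) x} x * F x)"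
    proof (rule integral_mono)
      show "integrable M (\<lambda>x. m (Suc N) x - m (Suc N) (U x))" using iU m_int by auto
      have "integrable M (\<lambda>x. indicator {x \<in> space M. 0 < m (Suc N) x} x * F x)"
        using integrable_real_mult_indicator[OF _ F, of "{x \<in> space M. 0 < m (Suc N) x}"]
        by (simp add: mult.commute)
      then show "integrable M (\<lambda>x. indicator {x. 0 < m (Suc N) x} x * F x)"
        by (rule Bochner_Integration.integrable_cong[THEN iffD1, rotated -1]) (auto simp: indicator_def)
      fix x
      show "m (Suc N) x - m (Suc N) (U x) \<le> indicator {x. 0 < m (Suc N) x} x * F x"
        using m_mono[of N "U x"] m_nonneg[of "Suc N" "U x"] m_nonneg[of "Suc N" x]
        by (auto simp: indicator_def) (auto simp: mS max_def split: if_splits)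
    qed
    finally show ?thesis .
  qed
  have "(\<lambda>N. LINT x|M. indicator {x. 0 < m (Suc N) x} x * F x) \<longlonglongrightarrow> (LINT x|M. F x)"
  proof (rule integral_dominated_convergence[where w = "\<lambda>x. \<bar>F x\<bar>"])
    show "AE x in M. (\<lambda>N. indicator {x. 0 < m (Suc N) x} x * F x) \<longlonglongrightarrow> F x"
      using pos
    proof eventually_elim
      case (elim x)
      then obtain n where n: "0 < m n x" using sum_le less_le_trans by blast
      have "\<forall>\<^sub>F N in sequentially. indicator {x. 0 < m (Suc N) x} x * F x = F x"
        using eventually_ge_at_top[of n]
      proof eventually_elim
        case (elim N)
        have "0 < m (Suc N) x" using m_mono'[of n "Suc N" x] n elim by linarith
        then show ?case by simp
      qed
      then show ?case by (rule tendsto_eventually)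
    qed
  next
    fix N
    have [measurable]: "m (Suc N) \<in> borel_measurable M" using m_int by blast
    have "(\<lambda>x. indicator {x \<in> space M. 0 < m (Suc N) x} x * F x) \<in> borel_measurable M" by measurable
    then show "(\<lambda>x. indicator {x. 0 < m (Suc N) x} x * F x) \<in> borel_measurable M"
      by (rule measurable_cong[THEN iffD1, rotated]) (auto simp: indicator_def)
    show "AE x in M. norm (indicator {x. 0 < m (Suc N) x} x * F x) \<le> \<bar>F x\<bar>"
      by (auto simp: indicator_def)
  qed (use F in auto)
  then show ?thesis using le by (intro LIMSEQ_le_const) auto
qed

text \<open>The set on which the ergodic sums of \<open>F - e\<close> are unbounded above is strictly invariant, hence
  null or conull.  It is not conull, by the maximal ergodic theorem for \<open>F - e\<close>.\<close>

lemma (in prob_space) ergodic_sums_upper: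
  fixes F :: "'a \<Rightarrow> real" and e :: real
  assumes U [measurable]: "U \<in> measurable M M" and inv: "distr M M U = M" and erg: "ergodic M U"
    and F: "integrable M F" "(LINT x|M. F x) = 0" and e: "0 < e"
  shows "AE x in M. \<exists>k::nat. \<forall>n. (\<Sum>i<n. F ((U ^^ i) x)) \<le> e * n + k"
proof -
  have [measurable]: "F \<in> borel_measurable M" using F by auto
  have Ui [measurable]: "U ^^ i \<in> measurable M M" for i
    by (induction i) (auto intro: measurable_comp)
  define S where "S n x = (\<Sum>i<n. F ((U ^^ i) x) - e)" for n x
  have S_eq: "S n x = (\<Sum>i<n. F ((U ^^ i) x)) - e * n" for n x
    by (simp add: S_def sum_subtractf)
  have S_Suc: "S (Suc n) x = F x - e + S n (U x)" for n x
    unfolding S_def by (subst sum.lessThan_Suc_shift) (simp add: funpow_swap1 del: sum.lessThan_Suc)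
  have [measurable]: "S n \<in> borel_measurable M" for n unfolding S_def by measurable
  define E where "E = {x \<in> space M. \<forall>k::nat. \<exists>n. real k < S n x}"
  have E: "E \<in> sets M" unfolding E_def by measurable
  have inv': "U -` E \<inter> space M = E"
  proof (rule set_eqI)
    fix x
    have "(\<forall>k::nat. \<exists>n. real k < S n (U x)) \<longleftrightarrow> (\<forall>k::nat. \<exists>n. real k < S n x)"
    proof (intro iffI allI)
      fix k :: nat
      assume A: "\<forall>k::nat. \<exists>n. real k < S n (U x)"
      obtain k' :: nat where "real k - (F x - e) < real k'" using reals_Archimedean2 by blast
      moreover obtain n where "real k' < S n (U x)" using A by blast
      ultimately have "real k < S (Suc n) x" unfolding S_Suc by linarith
      then show "\<exists>n. real k < S n x" by blast
    next
      fix k :: nat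
      assume A: "\<forall>k::nat. \<exists>n. real k < S n x"
      obtain k' :: nat where k': "real k + \<bar>F x - e\<bar> < real k'" using reals_Archimedean2 by blast
      moreover obtain n where n: "real k' < S n x" using A by blast
      moreover obtain n' where "n = Suc n'" using k' n by (cases n) (auto simp: S_def)
      ultimately have "real k < S n' (U x)" unfolding S_Suc by (simp add: S_Suc)
      then show "\<exists>n. real k < S n (U x)" by blast
    qed
    moreover have "x \<in> space M \<Longrightarrow> U x \<in> space M" using measurable_space[OF U] by blast
    ultimately show "x \<in> U -` E \<inter> space M \<longleftrightarrow> x \<in> E" by (auto simp: E_def)
  qed
  have "emeasure M (space M - E) \<noteq> 0"
  proof
    assume "emeasure M (space M - E) = 0"
    then have "AE x in M. x \<in> E"
      using E by (intro AE_I[of _ _ "space M - E"]) auto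
    then have "AE x in M. \<exists>n. 0 < S n x"
    proof eventually_elim
      case (elim x)
      then have "\<exists>n. real 0 < S n x" unfolding E_def by blast
      then show ?case by simp
    qed
    then have "0 \<le> (LINT x|M. F x - e)"
      using F unfolding S_def by (intro maximal_ergodic[OF U inv]) auto
    then show False using F e by (simp add: prob_space)
  qed
  then have "emeasure M E = 0" using erg E inv' unfolding ergodic_def by blast
  then have "AE x in M. x \<notin> E" using E by (intro AE_I[of _ _ E]) auto
  then show ?thesis
    using AE_space
  proof eventually_elim
    case (elim x)
    then obtain k :: nat where k: "\<And>n. S n x \<le> k" unfolding E_def by (auto simp: not_less)
    have "(\<Sum>i<n. F ((U ^^ i) x)) \<le> e * n + k" for n
      using k[of n] unfolding S_eq by linarith
    then show ?case by blast
  qed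
qed

text \<open>Birkhoff's pointwise theorem for an ergodic transformation and a function with integral zero.\<close>

lemma (in prob_space) birkhoff_real:
  fixes F :: "'a \<Rightarrow> real"
  assumes U: "U \<in> measurable M M" "distr M M U = M" "ergodic M U"
    and F: "integrable M F" "(LINT x|M. F x) = 0"
  shows "AE x in M. (\<lambda>N. (\<Sum>i<N. F ((U ^^ i) x)) / N) \<longlonglongrightarrow> 0"
proof -
  have "AE x in M. \<forall>m::nat. \<exists>k::nat. \<forall>n. (\<Sum>i<n. F ((U ^^ i) x)) \<le> inverse (real (Suc m)) * n + k"
    unfolding AE_all_countable using ergodic_sums_upper[OF U F] by simp
  moreover have "AE x in M. \<forall>m::nat. \<exists>k::nat. \<forall>n. (\<Sum>i<n. - F ((U ^^ i) x)) \<le> inverse (real (Suc m)) * n + k"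
    unfolding AE_all_countable using F ergodic_sums_upper[OF U, of "\<lambda>x. - F x"] by simp
  ultimately show ?thesis
  proof eventually_elim
    case (elim x)
    show ?case
    proof (rule LIMSEQ_I)
      fix r :: real assume r: "0 < r"
      then obtain m where m: "inverse (real (Suc m)) < r / 2"
        using reals_Archimedean[of "r / 2"] by auto
      obtain k k' :: nat where k: "\<And>n. (\<Sum>i<n. F ((U ^^ i) x)) \<le> inverse (real (Suc m)) * n + k"
        and k': "\<And>n. (\<Sum>i<n. - F ((U ^^ i) x)) \<le> inverse (real (Suc m)) * n + k'"
        using elim by blast
      obtain n0 :: nat where n0: "2 * (real k + real k' + 1) / r < n0" using reals_Archimedean2 by blast
      show "\<exists>no. \<forall>n\<ge>no. norm ((\<Sum>i<n. F ((U ^^ i) x)) / real n - 0) < r"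
      proof (intro exI allI impI)
        fix n assume n: "Suc n0 \<le> n"
        then have "2 * (real k + real k' + 1) / r < n" using n0 by linarith
        then have kr: "real k + real k' + 1 < r / 2 * n" using r by (simp add: field_simps)
        have n_pos: "real n > 0" using n by simp
        have "inverse (real (Suc m)) * n \<le> r / 2 * n" using m by (intro mult_right_mono) auto
        then have "\<bar>\<Sum>i<n. F ((U ^^ i) x)\<bar> < r * n"
          using k[of n] k'[of n] kr unfolding sum_negf by linarith
        then show "norm ((\<Sum>i<n. F ((U ^^ i) x)) / real n - 0) < r"
          using n_pos by (simp add: divide_less_eq)
      qed
    qed
  qed
qed

lemma (in prob_space) ergodic_correlation:
  assumes U [measurable]: "U \<in> measurable M M" and inv: "distr M M U = M" and erg: "ergodic M U"
    and F: "F \<in> bm M" "(LINT x|M. F x) = 0" and G: "G \<in> bm M"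
  shows "(\<lambda>N. (\<Sum>i<N. LINT x|M. F ((U ^^ i) x) * G x) / of_nat N) \<longlonglongrightarrow> 0"
proof -
  have Ui [measurable]: "U ^^ i \<in> measurable M M" for i
    by (induction i) (auto intro: measurable_comp)
  have [measurable]: "F \<in> borel_measurable M" "G \<in> borel_measurable M" using F G by (auto intro: bm_measurable)
  obtain C where C: "0 \<le> C" "\<And>x. norm (F x) \<le> C" using bm_bound[OF F(1)] by metis
  obtain D where D: "0 \<le> D" "\<And>x. norm (G x) \<le> D" using bm_bound[OF G] by metis
  have iF: "integrable M F" by (rule bm_integrable[OF F(1)])
  have "AE x in M. (\<lambda>N. (\<Sum>i<N. Re (F ((U ^^ i) x))) / N) \<longlonglongrightarrow> 0"
    using iF F by (intro birkhoff_real[OF U inv erg]) auto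
  moreover have "AE x in M. (\<lambda>N. (\<Sum>i<N. Im (F ((U ^^ i) x))) / N) \<longlonglongrightarrow> 0"
    using iF F by (intro birkhoff_real[OF U inv erg]) auto
  ultimately have conv: "AE x in M. (\<lambda>N. (\<Sum>i<N. F ((U ^^ i) x)) / of_nat N) \<longlonglongrightarrow> 0"
    by eventually_elim (simp add: tendsto_complex_iff)
  have "(\<lambda>N. LINT x|M. (\<Sum>i<N. F ((U ^^ i) x)) / of_nat N * G x) \<longlonglongrightarrow> (LINT x|M. 0)"
  proof (rule integral_dominated_convergence[where w = "\<lambda>x. C * D"])
    show "AE x in M. (\<lambda>N. (\<Sum>i<N. F ((U ^^ i) x)) / of_nat N * G x) \<longlonglongrightarrow> 0"
      using conv by eventually_elim (rule tendsto_mult_left_zero)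
    fix N
    have le: "norm ((\<Sum>i<N. F ((U ^^ i) x)) / of_nat N) \<le> C" for x
    proof -
      have "norm (\<Sum>i<N. F ((U ^^ i) x)) \<le> (\<Sum>i<N. C)" by (intro sum_norm_le C(2))
      then show ?thesis using C(1) by (cases "N = 0") (auto simp: norm_divide field_simps)
    qed
    show "AE x in M. norm ((\<Sum>i<N. F ((U ^^ i) x)) / of_nat N * G x) \<le> C * D"
      unfolding norm_mult by (intro AE_I2 mult_mono le C D norm_ge_zero)
  qed auto
  moreover have "(LINT x|M. (\<Sum>i<N. F ((U ^^ i) x)) / of_nat N * G x) =
      (\<Sum>i<N. LINT x|M. F ((U ^^ i) x) * G x) / of_nat N" for N
  proof -
    have i: "integrable M (\<lambda>x. F ((U ^^ i) x) * G x)" for i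
      by (intro bm_integrable bm_mult bm_compose[OF F(1)] G) auto
    have "(LINT x|M. (\<Sum>i<N. F ((U ^^ i) x)) / of_nat N * G x) =
      (LINT x|M. (\<Sum>i<N. F ((U ^^ i) x) * G x) / of_nat N)"
      by (simp add: sum_distrib_right)
    also have "\<dots> = (\<Sum>i<N. LINT x|M. F ((U ^^ i) x) * G x) / of_nat N"
      using i by simp
    finally show ?thesis .
  qed
  ultimately show ?thesis by (simp only: Bochner_Integration.integral_zero)
qed

text \<open>For a weakly mixing map, the ergodic theorem applies to \<open>G x \<cdot> cnj (G y)\<close> on the product space.\<close>

lemma weakly_mixing_correlation:
  assumes M: "prob_space M" and S [measurable]: "S \<in> measurable M M" and inv: "distr M M S = M"
    and wm: "weakly_mixing M S"
    and G: "G \<in> bm M" "(LINT x|M. G x) = 0"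
  shows "(\<lambda>N. (\<Sum>i<N. (norm (LINT x|M. G ((S ^^ i) x) * cnj (G x)))\<^sup>2) / N) \<longlonglongrightarrow> 0"
proof -
  interpret prob_space M by fact
  interpret P: pair_prob_space M M by unfold_locales
  let ?U = "map_prod S S"
  let ?F = "\<lambda>z. G (fst z) * cnj (G (snd z))"
  have [measurable]: "G \<in> borel_measurable M" using G by (auto intro: bm_measurable)
  have [measurable]: "S ^^ i \<in> measurable M M" for i
    by (induction i) (auto intro: measurable_comp)
  have U: "?U \<in> measurable (M \<Otimes>\<^sub>M M) (M \<Otimes>\<^sub>M M)"
    unfolding map_prod_def by measurable
  have invU: "distr (M \<Otimes>\<^sub>M M) (M \<Otimes>\<^sub>M M) ?U = M \<Otimes>\<^sub>M M"
  proof -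
    have "sigma_finite_measure (distr M M S)"
      unfolding inv by (rule sigma_finite_measure_axioms)
    from pair_measure_distr[OF S S this] show ?thesis
      unfolding map_prod_def inv by (rule sym)
  qed
  have F_int: "(LINT z|(M \<Otimes>\<^sub>M M). g (fst z) * h (snd z)) = (LINT x|M. g x) * (LINT y|M. h y)"
    if "g \<in> bm M" "h \<in> bm M" for g h
  proof -
    have i: "integrable (M \<Otimes>\<^sub>M M) (\<lambda>z. g (fst z) * h (snd z))"
      by (rule P.bm_integrable[OF bm_mult[OF bm_compose[OF that(1) measurable_fst] bm_compose[OF that(2) measurable_snd]]])
    have "(LINT z|(M \<Otimes>\<^sub>M M). g (fst z) * h (snd z)) = (LINT x|M. LINT y|M. g x * h y)"
      using P.integral_fst'[OF i] by simp
    also have "\<dots> = (LINT x|M. g x) * (LINT y|M. h y)" by simp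
    finally show ?thesis .
  qed
  have bmF: "?F \<in> bm (M \<Otimes>\<^sub>M M)"
    by (rule bm_mult[OF bm_compose[OF G(1) measurable_fst] bm_cnj[OF bm_compose[OF G(1) measurable_snd]]])
  have "(LINT z|(M \<Otimes>\<^sub>M M). ?F z) = 0"
    by (rule trans[OF F_int[OF G(1) bm_cnj[OF G(1)]]]) (simp only: G(2) mult_zero_left)
  from P.ergodic_correlation[OF U invU wm[unfolded weakly_mixing_def] bmF this bm_cnj[OF bmF]]
  have "(\<lambda>N. (\<Sum>i<N. LINT z|(M \<Otimes>\<^sub>M M). ?F ((?U ^^ i) z) * cnj (?F z)) / of_nat N) \<longlonglongrightarrow> 0" .
  moreover have "(LINT z|(M \<Otimes>\<^sub>M M). ?F ((?U ^^ i) z) * cnj (?F z)) =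
    of_real ((norm (LINT x|M. G ((S ^^ i) x) * cnj (G x)))\<^sup>2)" for i
  proof -
    let ?c = "LINT x|M. G ((S ^^ i) x) * cnj (G x)"
    have Ui: "(?U ^^ i) z = ((S ^^ i) (fst z), (S ^^ i) (snd z))" for z
      by (induction i) auto
    have b: "(\<lambda>x. G ((S ^^ i) x) * cnj (G x)) \<in> bm M"
      by (intro bm_mult bm_cnj G bm_compose[OF G(1)]) auto
    have "(LINT z|(M \<Otimes>\<^sub>M M). ?F ((?U ^^ i) z) * cnj (?F z)) =
      (LINT z|(M \<Otimes>\<^sub>M M). (G ((S ^^ i) (fst z)) * cnj (G (fst z))) * cnj (G ((S ^^ i) (snd z)) * cnj (G (snd z))))"
      by (simp add: Ui mult_ac)
    also have "\<dots> = ?c * (LINT x|M. cnj (G ((S ^^ i) x) * cnj (G x)))"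
      by (rule F_int[OF b bm_cnj[OF b]])
    also have "\<dots> = ?c * cnj ?c" by (simp only: Bochner_Integration.integral_cnj)
    also have "\<dots> = of_real ((norm ?c)\<^sup>2)" by (rule complex_norm_square[symmetric])
    finally show ?thesis .
  qed
  ultimately have "(\<lambda>N. complex_of_real ((\<Sum>i<N. (norm (LINT x|M. G ((S ^^ i) x) * cnj (G x)))\<^sup>2) / N)) \<longlonglongrightarrow> of_real 0"
    by simp
  then show ?thesis unfolding tendsto_of_real_iff .
qed

section \<open>Actions of the integers\<close>

text \<open>A measure preserving action of the integers on a probability space; the laws of an action are
  only required on the space itself.\<close>

locale mp_action = prob_space M for M :: "'a measure" +
  fixes s :: "int \<Rightarrow> 'a \<Rightarrow> 'a"
  assumes action_measurable [measurable]: "s k \<in> measurable M M"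
    and action_distr: "distr M M (s k) = M"
    and action_zero: "x \<in> space M \<Longrightarrow> s 0 x = x"
    and action_add: "x \<in> space M \<Longrightarrow> s (j + k) x = s j (s k x)"
begin

lemma action_space: "x \<in> space M \<Longrightarrow> s k x \<in> space M"
  using measurable_space[OF action_measurable] .

lemma integral_action:
  fixes f :: "'a \<Rightarrow> 'b::{banach,second_countable_topology}"
  assumes "f \<in> borel_measurable M"
  shows "(LINT x|M. f (s k x)) = (LINT x|M. f x)"
  using integral_distr[OF action_measurable assms, of k] action_distr[of k] by simp

lemma bm_action: "f \<in> bm M \<Longrightarrow> (\<lambda>x. f (s k x)) \<in> bm M"
  by (rule bm_compose[OF _ action_measurable])

lemma AE_action:
  assumes "AE x in M. P x" shows "AE x in M. P (s k x)"
proof (rule AE_distrD[OF action_measurable])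
  show "AE x in distr M M (s k). P x" unfolding action_distr by (rule assms)
qed

end

lemma mp_action_trivial: "prob_space M \<Longrightarrow> mp_action M (\<lambda>k x. x)"
  unfolding mp_action_def mp_action_axioms_def by (auto simp: distr_id2)

lemma funpow_measurable:
  assumes "U \<in> measurable M M" shows "U ^^ i \<in> measurable M M"
proof (induction i)
  case (Suc i)
  show ?case unfolding funpow.simps by (rule measurable_comp[OF Suc assms])
qed simp

lemma distr_funpow:
  assumes "U \<in> measurable M M" "distr M M U = M" shows "distr M M (U ^^ i) = M"
proof (induction i)
  case (Suc i)
  have "distr M M (U \<circ> (U ^^ i)) = distr (distr M M (U ^^ i)) M U"
    by (rule distr_distr[symmetric]) (use assms funpow_measurable in auto)
  then show ?case unfolding funpow.simps Suc assms(2) .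
qed (simp add: distr_id2)

lemma mp_automorphism_distr:
  assumes "mp_automorphism M R"
  shows "distr M M R = M" "distr M M (the_inv_into (space M) R) = M"
proof -
  let ?I = "the_inv_into (space M) R"
  have b: "bij_betw R (space M) (space M)" and m: "R \<in> measurable M M" "?I \<in> measurable M M"
    and e: "\<And>A. A \<in> sets M \<Longrightarrow> emeasure M (R -` A \<inter> space M) = emeasure M A"
    "\<And>A. A \<in> sets M \<Longrightarrow> emeasure M (R ` A) = emeasure M A"
    using assms by (auto simp: mp_automorphism_def)
  show "distr M M R = M"
    by (rule measure_eqI) (auto simp: emeasure_distr m e)
  show "distr M M ?I = M"
  proof (rule measure_eqI)
    fix A assume A: "A \<in> sets (distr M M ?I)"
    then have A': "A \<in> sets M" "A \<subseteq> space M" using sets.sets_into_space by auto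
    have "?I -` A \<inter> space M = R ` A"
    proof (intro set_eqI iffI)
      fix x assume "x \<in> ?I -` A \<inter> space M"
      then have "x = R (?I x)" "?I x \<in> A"
        using f_the_inv_into_f_bij_betw[OF b] by auto
      then show "x \<in> R ` A" by blast
    next
      fix x assume "x \<in> R ` A"
      then obtain y where y: "y \<in> A" "x = R y" by blast
      then have "y \<in> space M" using A' by blast
      then show "x \<in> ?I -` A \<inter> space M"
        using y b the_inv_into_f_f[of R "space M" y] by (auto simp: bij_betw_def)
    qed
    then show "emeasure (distr M M ?I) A = emeasure M A"
      using A' by (simp add: emeasure_distr m e)
  qed simp
qed

lemma mp_action_aut_pow:
  assumes M: "prob_space M" and R: "mp_automorphism M R"
  shows "mp_action M (aut_pow M R)"
proof -
  interpret prob_space M by fact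
  let ?I = "the_inv_into (space M) R"
  let ?s = "aut_pow M R"
  have b: "bij_betw R (space M) (space M)" and m: "R \<in> measurable M M" "?I \<in> measurable M M"
    using R by (auto simp: mp_automorphism_def)
  have RI: "R (?I x) = x" if "x \<in> space M" for x
    using f_the_inv_into_f_bij_betw[OF b] that by auto
  have IR: "?I (R x) = x" if "x \<in> space M" for x
    using b the_inv_into_f_f[of R "space M" x] that by (auto simp: bij_betw_def)
  have sp: "?s k x \<in> space M" if "x \<in> space M" for k x
    using measurable_space[OF funpow_measurable[OF m(1)]] measurable_space[OF funpow_measurable[OF m(2)]] that
    by (auto simp: aut_pow_def)
  have up: "?s (k + 1) x = R (?s k x)" if x: "x \<in> space M" for k x
  proof (cases "0 \<le> k")
    case True
    then show ?thesis by (simp add: aut_pow_def nat_add_distrib)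
  next
    case False
    define i where "i = nat (- k - 1)"
    have k: "k = - int (Suc i)" using False by (simp add: i_def)
    have "(?I ^^ i) x \<in> space M" using measurable_space[OF funpow_measurable[OF m(2)]] x by blast
    then have "R (?s k x) = (?I ^^ i) x"
      using False k RI by (simp add: aut_pow_def nat_add_distrib)
    also have "\<dots> = ?s (k + 1) x" by (cases "i = 0") (auto simp: aut_pow_def k)
    finally show ?thesis ..
  qed
  have down: "?s (k - 1) x = ?I (?s k x)" if x: "x \<in> space M" for k x
    using up[OF x, of "k - 1"] IR[OF sp[OF x, of "k - 1"]] by simp
  have add: "?s (j + k) x = ?s j (?s k x)" if x: "x \<in> space M" for j k x
  proof (induction j rule: int_induct[where k = 0])
    case base
    show ?case by (simp add: aut_pow_def)
  next
    case (step1 i)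
    then show ?case using up[OF x, of "i + k"] up[OF sp[OF x, of k], of i] by (simp add: algebra_simps)
  next
    case (step2 i)
    then show ?case using down[OF x, of "i + k"] down[OF sp[OF x, of k], of i] by (simp add: algebra_simps)
  qed
  show ?thesis
  proof
    show "?s k \<in> measurable M M" for k
      using funpow_measurable[OF m(1)] funpow_measurable[OF m(2)] by (simp add: aut_pow_def)
    show "distr M M (?s k) = M" for k
      using distr_funpow[OF m(1)] distr_funpow[OF m(2)] mp_automorphism_distr[OF R] by (simp add: aut_pow_def)
    show "?s 0 x = x" for x by (simp add: aut_pow_def)
    show "?s (j + k) x = ?s j (?s k x)" if "x \<in> space M" for j k x using add[OF that] .
  qed
qed

section \<open>Van der Corput's lemma\<close>

lemma norm_avg_square_le: "(norm (avg a N))\<^sup>2 \<le> avg (\<lambda>n. (norm (a n))\<^sup>2) N"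
proof (cases "N = 0")
  case False
  have "(avg (\<lambda>n. norm (a n)) N)\<^sup>2 = (\<Sum>n=1..int N. norm (a n))\<^sup>2 / (real N)\<^sup>2"
    by (simp add: avg_def power_mult_distrib power_divide divide_inverse power_inverse mult.commute)
  also have "\<dots> \<le> ((\<Sum>n=1..int N. (norm (a n))\<^sup>2) * real N) / (real N)\<^sup>2"
    using sum_squared_le_sum_of_squares[of "\<lambda>n. norm (a n)" "{1..int N}"]
    by (intro divide_right_mono) auto
  also have "\<dots> = avg (\<lambda>n. (norm (a n))\<^sup>2) N"
    using False by (simp add: avg_def power2_eq_square field_simps)
  finally show ?thesis
    using power_mono[OF norm_avg_le[of a N] norm_ge_zero, of 2] by linarith
qed (simp add: avg_def)

context prob_space
begin

text \<open>If the correlations \<open>\<langle>v (n + k), v n\<rangle>\<close> have the limiting average \<open>\<gamma> k\<close>, then the quadratic averages of the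
  moving combinations of \<open>v\<close> are given by the corresponding quadratic form.\<close>

lemma avg_norm_square_combination:
  fixes v :: "int \<Rightarrow> 'a \<Rightarrow> complex" and c :: "int \<Rightarrow> complex"
  assumes v: "\<And>n. v n \<in> bm M" and B: "\<And>n x. norm (v n x) \<le> B"
    and \<gamma>: "\<And>k. avg (\<lambda>n. LINT x|M. v (n + k) x * cnj (v n x)) \<longlonglongrightarrow> \<gamma> k"
  shows "(\<lambda>N. complex_of_real (avg (\<lambda>n. LINT x|M. (norm (\<Sum>k\<in>K. c k * v (n + k) x))\<^sup>2) N))
    \<longlonglongrightarrow> (\<Sum>k\<in>K. \<Sum>j\<in>K. c k * cnj (c j) * \<gamma> (k - j))"
proof -
  have B0: "0 \<le> B" using B[of 0 undefined] norm_ge_zero order_trans by blast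
  let ?w = "\<lambda>n x. \<Sum>k\<in>K. c k * v (n + k) x"
  let ?p = "\<lambda>k j n. LINT x|M. v (n + k) x * cnj (v (n + j) x)"
  have bp: "norm (?p k j n) \<le> B * B" for k j n
    by (rule norm_integral_le) (use B B0 in \<open>auto simp: norm_mult intro!: mult_mono\<close>)
  have eq: "complex_of_real (LINT x|M. (norm (?w n x))\<^sup>2) = (\<Sum>k\<in>K. \<Sum>j\<in>K. c k * cnj (c j) * ?p k j n)" for n
    by (rule integral_norm_square_sum[OF finite_measure_axioms, where y = "\<lambda>k. v (n + k)"]) (rule v)
  have lim: "avg (?p k j) \<longlonglongrightarrow> \<gamma> (k - j)" for k j
    using tendsto_avg_shift[of "?p (k - j) 0" "B * B" "\<gamma> (k - j)" j, OF bp] \<gamma>[of "k - j"]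
    by (simp add: algebra_simps)
  have "complex_of_real (avg (\<lambda>n. LINT x|M. (norm (?w n x))\<^sup>2) N)
      = (\<Sum>k\<in>K. \<Sum>j\<in>K. c k * cnj (c j) * avg (?p k j) N)" for N
  proof -
    have "complex_of_real (avg (\<lambda>n. LINT x|M. (norm (?w n x))\<^sup>2) N)
      = avg (\<lambda>n. complex_of_real (LINT x|M. (norm (?w n x))\<^sup>2)) N"
      by (simp add: avg_def scaleR_conv_of_real)
    then show ?thesis by (simp only: eq avg_sum avg_mult_left)
  qed
  then show ?thesis
    by (simp only:) (intro tendsto_sum tendsto_mult tendsto_const lim)
qed

text \<open>Replace \<open>v n\<close> by the mean \<open>w n\<close> of \<open>v (n + k)\<close> over \<open>0 \<le> k < H\<close>, which changes the
  averages by \<open>O(H / N)\<close>, and apply \<open>avg_norm_square_combination\<close> to \<open>w\<close>.\<close>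

lemma van_der_Corput:
  fixes v :: "int \<Rightarrow> 'a \<Rightarrow> complex"
  assumes v: "\<And>n. v n \<in> bm M" and B: "\<And>n x. norm (v n x) \<le> B"
    and \<gamma>: "\<And>k. avg (\<lambda>n. LINT x|M. v (n + k) x * cnj (v n x)) \<longlonglongrightarrow> \<gamma> k"
    and \<gamma>0: "(\<lambda>H. (\<Sum>k\<in>{-int H..int H}. norm (\<gamma> k)) / H) \<longlonglongrightarrow> 0"
  shows "(\<lambda>N. LINT x|M. (norm (avg (\<lambda>n. v n x) N))\<^sup>2) \<longlonglongrightarrow> 0"
proof (rule LIMSEQ_I)
  fix e :: real assume e: "0 < e"
  have B0: "0 \<le> B" using B[of 0 undefined] norm_ge_zero order_trans by blast
  obtain H0 where H0: "\<And>H. H \<ge> H0 \<Longrightarrow> norm ((\<Sum>k\<in>{-int H..int H}. norm (\<gamma> k)) / H - 0) < e / 8"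
    using LIMSEQ_D[OF \<gamma>0, of "e / 8"] e by auto
  define H where "H = Suc H0"
  have H: "0 < real H" "(\<Sum>k\<in>{-int H..int H}. norm (\<gamma> k)) / H < e / 8"
    using H0[of H] abs_ge_self[of "(\<Sum>k\<in>{-int H..int H}. norm (\<gamma> k)) / H"]
    unfolding diff_0_right real_norm_def by (linarith | simp add: H_def)+
  let ?K = "{0..<int H}"
  let ?c = "\<lambda>k::int. complex_of_real (1 / H)"
  define w where "w n x = (\<Sum>k\<in>?K. ?c k * v (n + k) x)" for n x
  define Q where "Q N = avg (\<lambda>n. LINT x|M. (norm (w n x))\<^sup>2) N" for N
  let ?L = "\<Sum>k\<in>?K. \<Sum>j\<in>?K. ?c k * cnj (?c j) * \<gamma> (k - j)"
  have Q_lim: "(\<lambda>N. complex_of_real (Q N)) \<longlonglongrightarrow> ?L"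
    unfolding Q_def w_def by (rule avg_norm_square_combination[OF v B \<gamma>])
  have row: "(\<Sum>j\<in>?K. norm (\<gamma> (k - j))) \<le> (\<Sum>m\<in>{-int H..int H}. norm (\<gamma> m))" if k: "k \<in> ?K" for k
  proof -
    have "(\<Sum>j\<in>?K. norm (\<gamma> (k - j))) = (\<Sum>m\<in>(\<lambda>j. k - j) ` ?K. norm (\<gamma> m))"
      by (subst sum.reindex) (auto simp: inj_on_def)
    also have "\<dots> \<le> (\<Sum>m\<in>{-int H..int H}. norm (\<gamma> m))"
      using k by (intro sum_mono2) auto
    finally show ?thesis .
  qed
  have "norm ?L \<le> (\<Sum>k\<in>?K. \<Sum>j\<in>?K. norm (?c k * cnj (?c j) * \<gamma> (k - j)))"
    by (intro order_trans[OF norm_sum] sum_mono norm_sum)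
  also have "\<dots> = (\<Sum>k\<in>?K. (\<Sum>j\<in>?K. norm (\<gamma> (k - j))) / H / H)"
    by (simp add: norm_mult norm_divide sum_divide_distrib)
  also have "\<dots> \<le> (\<Sum>k\<in>?K. (e / 8) / H)"
  proof (rule sum_mono)
    fix k assume "k \<in> ?K"
    then have "(\<Sum>j\<in>?K. norm (\<gamma> (k - j))) / H \<le> (\<Sum>m\<in>{-int H..int H}. norm (\<gamma> m)) / H"
      using row H by (intro divide_right_mono) auto
    then show "(\<Sum>j\<in>?K. norm (\<gamma> (k - j))) / H / H \<le> (e / 8) / H"
      using H by (intro divide_right_mono) linarith+
  qed
  also have "\<dots> = e / 8" using H by simp
  finally have L: "norm ?L \<le> e / 8" .
  have "0 < e / 8" using e by simp
  from LIMSEQ_D[OF Q_lim this] obtain N1 where N1: "\<And>N. N \<ge> N1 \<Longrightarrow> norm (complex_of_real (Q N) - ?L) < e / 8"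
    by blast
  have Q: "Q N < e / 4" if "N \<ge> N1" for N
  proof -
    have "Q N \<le> norm (complex_of_real (Q N))" by simp
    also have "\<dots> \<le> norm (complex_of_real (Q N) - ?L) + norm ?L"
      using norm_triangle_ineq[of "complex_of_real (Q N) - ?L" ?L] by simp
    also have "\<dots> < e / 4" using N1[OF that] L by linarith
    finally show ?thesis .
  qed
  have "(\<lambda>N. 2 * (2 * H * B / N)\<^sup>2) \<longlonglongrightarrow> 2 * 0\<^sup>2"
    by (intro tendsto_intros lim_const_over_n)
  then have "(\<lambda>N. 2 * (2 * H * B / N)\<^sup>2) \<longlonglongrightarrow> 0" by simp
  from LIMSEQ_D[OF this, of "e / 2"] e obtain N2 :: nat where N2: "\<And>N. N \<ge> N2 \<Longrightarrow> 2 * (2 * H * B / N)\<^sup>2 < e / 2"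
    by auto
  have main: "(LINT x|M. (norm (avg (\<lambda>n. v n x) N))\<^sup>2) \<le> 2 * Q N + 2 * (2 * H * B / N)\<^sup>2" for N
  proof -
    have w: "w n \<in> bm M" for n unfolding w_def by (intro bm_sum bm_mult bm_const v)
    have av: "avg (\<lambda>n. v n x) N = (\<Sum>k\<in>?K. ?c k * avg (\<lambda>n. v n x) N)" for x
      using H by simp
    have close: "norm (avg (\<lambda>n. v n x) N - avg (\<lambda>n. w n x) N) \<le> 2 * H * B / N" for x
    proof -
      have "avg (\<lambda>n. w n x) N - avg (\<lambda>n. v n x) N
          = (\<Sum>k\<in>?K. ?c k * (avg (\<lambda>n. v (n + k) x) N - avg (\<lambda>n. v n x) N))"
        unfolding w_def avg_sum avg_mult_left right_diff_distrib sum_subtractf using av by simp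
      also have "norm \<dots> \<le> (\<Sum>k\<in>?K. (1 / H) * (2 * H * B / N))"
      proof (rule sum_norm_le)
        fix k assume k: "k \<in> ?K"
        have "norm (avg (\<lambda>n. v (n + k) x) N - avg (\<lambda>n. v n x) N) \<le> 2 * \<bar>real_of_int k\<bar> * B / N"
          by (rule norm_avg_shift_le) (rule B)
        also have "\<dots> \<le> 2 * H * B / N"
          using k B0 by (intro divide_right_mono mult_right_mono) auto
        finally have "1 / H * norm (avg (\<lambda>n. v (n + k) x) N - avg (\<lambda>n. v n x) N) \<le> 1 / H * (2 * H * B / N)"
          by (rule mult_left_mono) simp
        then show "norm (?c k * (avg (\<lambda>n. v (n + k) x) N - avg (\<lambda>n. v n x) N)) \<le> (1 / H) * (2 * H * B / N)"
          by (simp add: norm_mult norm_divide)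
      qed
      also have "\<dots> = 2 * H * B / N" using H by simp
      finally show ?thesis by (simp add: norm_minus_commute)
    qed
    have "(norm (avg (\<lambda>n. v n x) N))\<^sup>2 \<le> 2 * avg (\<lambda>n. (norm (w n x))\<^sup>2) N + 2 * (2 * H * B / N)\<^sup>2" for x
    proof -
      let ?a = "norm (avg (\<lambda>n. w n x) N)" and ?b = "2 * H * B / N"
      have "norm (avg (\<lambda>n. v n x) N) \<le> ?a + ?b"
        using close[of x] norm_triangle_sub[of "avg (\<lambda>n. v n x) N" "avg (\<lambda>n. w n x) N"] by linarith
      then have "(norm (avg (\<lambda>n. v n x) N))\<^sup>2 \<le> (?a + ?b)\<^sup>2" by (intro power_mono) auto
      also have "\<dots> \<le> 2 * ?a\<^sup>2 + 2 * ?b\<^sup>2" by (use sum_squares_bound[of ?a ?b] in \<open>simp add: power2_sum\<close>)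
      also have "?a\<^sup>2 \<le> avg (\<lambda>n. (norm (w n x))\<^sup>2) N" by (rule norm_avg_square_le)
      finally show ?thesis by simp
    qed
    moreover have "integrable M (\<lambda>x. (norm (avg (\<lambda>n. v n x) N))\<^sup>2)"
      by (intro bm_integrable_norm_power bm_avg v)
    moreover have iw: "integrable M (\<lambda>x. (norm (w n x))\<^sup>2)" for n
      by (intro bm_integrable_norm_power w)
    moreover have "integrable M (\<lambda>x. avg (\<lambda>n. (norm (w n x))\<^sup>2) N)"
      unfolding avg_def using iw by simp
    ultimately have "(LINT x|M. (norm (avg (\<lambda>n. v n x) N))\<^sup>2)
        \<le> (LINT x|M. 2 * avg (\<lambda>n. (norm (w n x))\<^sup>2) N + 2 * (2 * H * B / N)\<^sup>2)"
      by (intro integral_mono) auto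
    also have "\<dots> = 2 * (LINT x|M. avg (\<lambda>n. (norm (w n x))\<^sup>2) N) + 2 * (2 * H * B / N)\<^sup>2"
      using \<open>integrable M (\<lambda>x. avg (\<lambda>n. (norm (w n x))\<^sup>2) N)\<close>
      by (subst Bochner_Integration.integral_add) (auto simp: prob_space)
    also have "(LINT x|M. avg (\<lambda>n. (norm (w n x))\<^sup>2) N) = Q N"
      unfolding Q_def by (rule integral_avg[OF iw])
    finally show ?thesis .
  qed
  show "\<exists>no. \<forall>N\<ge>no. norm ((LINT x|M. (norm (avg (\<lambda>n. v n x) N))\<^sup>2) - 0) < e"
  proof (intro exI allI impI)
    fix N assume N: "max N1 N2 \<le> N"
    have "(LINT x|M. (norm (avg (\<lambda>n. v n x) N))\<^sup>2) < e"
      using main[of N] Q[of N] N2[of N] N by linarith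
    then show "norm ((LINT x|M. (norm (avg (\<lambda>n. v n x) N))\<^sup>2) - 0) < e" by simp
  qed
qed

end

section \<open>Integer polynomials modulo constants\<close>

lemma ipoly_value_eq:
  assumes "integer_poly p" shows "of_int (ipoly_value p n) = poly p (of_int n)"
  using assms unfolding integer_poly_def ipoly_value_def by (metis Ints_cases floor_of_int)

lemma ipoly_value_eqI:
  assumes "integer_poly p" "poly p (of_int n) = of_int m" shows "ipoly_value p n = m"
  using ipoly_value_eq[OF assms(1), of n] assms(2) by simp

lemma integer_poly_diff: "integer_poly p \<Longrightarrow> integer_poly q \<Longrightarrow> integer_poly (p - q)"
  by (simp add: integer_poly_def)

lemma ipoly_value_diff:
  assumes "integer_poly p" "integer_poly q"
  shows "ipoly_value (p - q) n = ipoly_value p n - ipoly_value q n"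
  by (rule ipoly_value_eqI) (use assms in \<open>simp_all add: integer_poly_diff ipoly_value_eq\<close>)

text \<open>Classes of integer polynomials modulo constants, represented by the members with vanishing
  constant term.  Essentially distinct polynomials have distinct representatives.\<close>

definition Z0 :: "rat poly set" where
  "Z0 = {p. integer_poly p \<and> coeff p 0 = 0}"

text \<open>The representative of the class of \<open>p\<close>.\<close>

definition drop_const :: "rat poly \<Rightarrow> rat poly" where
  "drop_const p = p - [:coeff p 0:]"

lemma Z0_integer: "p \<in> Z0 \<Longrightarrow> integer_poly p"
  by (simp add: Z0_def)

lemma Z0_diff: "p \<in> Z0 \<Longrightarrow> q \<in> Z0 \<Longrightarrow> p - q \<in> Z0"
  by (simp add: Z0_def integer_poly_diff)

lemma ipoly_value_0: "p \<in> Z0 \<Longrightarrow> ipoly_value p 0 = 0"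
  by (rule ipoly_value_eqI) (simp_all add: Z0_def poly_0_coeff_0)

lemma ipoly_value_zero [simp]: "ipoly_value 0 n = 0"
  by (simp add: ipoly_value_def)

lemma Z0_degree_pos: "p \<in> Z0 \<Longrightarrow> p \<noteq> 0 \<Longrightarrow> 0 < degree p"
  by (rule ccontr) (auto simp: Z0_def dest: degree0_coeffs)

lemma coeff_drop_const: "coeff (drop_const p) i = (if i = 0 then 0 else coeff p i)"
  by (cases i) (auto simp: drop_const_def)

lemma degree_drop_const: "degree (drop_const p) = degree p"
proof (rule antisym)
  show "degree (drop_const p) \<le> degree p"
    by (rule degree_le) (auto simp: coeff_drop_const coeff_eq_0)
  show "degree p \<le> degree (drop_const p)"
    by (cases "degree p = 0") (auto intro!: le_degree simp: coeff_drop_const)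
qed

lemma integer_poly_const: "c \<in> \<int> \<Longrightarrow> integer_poly [:c:]"
  by (simp add: integer_poly_def)

lemma integer_poly_coeff_0:
  assumes "integer_poly p" shows "coeff p 0 \<in> \<int>"
proof -
  have "poly p (of_int 0) \<in> \<int>" using assms unfolding integer_poly_def by blast
  then show ?thesis by (simp add: poly_0_coeff_0)
qed

lemma drop_const_Z0:
  assumes "integer_poly p" shows "drop_const p \<in> Z0"
  unfolding Z0_def mem_Collect_eq
proof
  show "integer_poly (drop_const p)" unfolding drop_const_def
    by (intro integer_poly_diff integer_poly_const integer_poly_coeff_0 assms)
qed (simp add: coeff_drop_const)

lemma ipoly_value_drop_const:
  assumes p: "integer_poly p"
  shows "ipoly_value p n = ipoly_value (drop_const p) n + ipoly_value p 0"
proof -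
  have c: "integer_poly [:coeff p 0:]" by (intro integer_poly_const integer_poly_coeff_0 p)
  have "ipoly_value [:coeff p 0:] n = ipoly_value p 0"
    by (simp add: ipoly_value_def poly_0_coeff_0)
  then show ?thesis unfolding drop_const_def using ipoly_value_diff[OF p c, of n] by simp
qed

lemma drop_const_eq_imp_diff_const:
  assumes "drop_const p = drop_const q" shows "p - q = [:coeff p 0 - coeff q 0:]"
proof -
  have "p - q = drop_const p - drop_const q + ([:coeff p 0:] - [:coeff q 0:])"
    by (simp add: drop_const_def)
  then show ?thesis using assms by simp
qed

text \<open>The representative of the class of \<open>p (x + k)\<close>.\<close>

definition translate :: "int \<Rightarrow> rat poly \<Rightarrow> rat poly" where
  "translate k p = drop_const (pcompose p [:of_int k, 1:])"

lemma integer_poly_pcompose_shift: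
  assumes "integer_poly p" shows "integer_poly (pcompose p [:of_int k, 1:])"
proof -
  have "poly p (of_int (k + x)) \<in> \<int>" for x
    using assms unfolding integer_poly_def by blast
  then show ?thesis by (simp add: integer_poly_def poly_pcompose)
qed

lemma translate_Z0: "p \<in> Z0 \<Longrightarrow> translate k p \<in> Z0"
  unfolding translate_def by (intro drop_const_Z0 integer_poly_pcompose_shift Z0_integer)

lemma ipoly_value_translate:
  assumes p: "p \<in> Z0"
  shows "ipoly_value p (n + k) = ipoly_value (translate k p) n + ipoly_value p k"
proof -
  let ?q = "pcompose p [:of_int k, 1:]"
  have q: "integer_poly ?q" by (intro integer_poly_pcompose_shift Z0_integer p)
  have "ipoly_value ?q m = ipoly_value p (m + k)" for m
    by (simp add: ipoly_value_def poly_pcompose add.commute)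
  then show ?thesis
    using ipoly_value_drop_const[OF q, of n] by (simp add: translate_def)
qed

lemma Z0_eqI:
  assumes p: "p \<in> Z0" and q: "q \<in> Z0" and eq: "\<And>m::nat. ipoly_value p (int m * k) = ipoly_value q (int m * k)" and k: "k \<noteq> 0"
  shows "p = q"
proof (rule ccontr)
  assume "p \<noteq> q"
  then have "finite {x. poly (p - q) x = 0}" by (intro poly_roots_finite) simp
  moreover have "range (\<lambda>m::nat. of_int (int m * k)) \<subseteq> {x. poly (p - q) x = 0}"
  proof safe
    fix m :: nat
    show "poly (p - q) (of_int (int m * k)) = 0"
      using eq[of m] ipoly_value_eq[OF Z0_integer[OF p], of "int m * k"] ipoly_value_eq[OF Z0_integer[OF q], of "int m * k"]
      by simp
  qed
  moreover have "inj (\<lambda>m::nat. of_int (int m * k) :: rat)" using k by (auto simp: inj_on_def)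
  ultimately show False using finite_subset range_inj_infinite by blast
qed

lemma translate_translate:
  assumes p: "p \<in> Z0" shows "translate j (translate k p) = translate (j + k) p"
proof (rule Z0_eqI[of _ _ 1])
  fix m :: nat
  have "ipoly_value (translate j (translate k p)) n = ipoly_value p (n + j + k) - ipoly_value p (j + k)" for n
    using ipoly_value_translate[OF p, of "n + j" k] ipoly_value_translate[OF p, of j k]
      ipoly_value_translate[OF translate_Z0[OF p, of k], of n j] by (simp add: algebra_simps)
  moreover have "ipoly_value (translate (j + k) p) n = ipoly_value p (n + j + k) - ipoly_value p (j + k)" for n
    using ipoly_value_translate[OF p, of n "j + k"] by (simp add: algebra_simps)
  ultimately show "ipoly_value (translate j (translate k p)) (int m * 1) = ipoly_value (translate (j + k) p) (int m * 1)"
    by simp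
qed (simp_all add: translate_Z0 p)

lemma translate_0: "p \<in> Z0 \<Longrightarrow> translate 0 p = p"
  by (auto simp: translate_def drop_const_def pcompose_pCons Z0_def pcompose_idR)

lemma translate_uminus: "p \<in> Z0 \<Longrightarrow> translate (- k) (translate k p) = p"
  by (simp add: translate_translate translate_0)

lemma degree_translate: "degree (translate k p) = degree p"
  by (simp add: translate_def degree_drop_const degree_pcompose)

lemma lead_coeff_translate:
  assumes "p \<in> Z0" shows "lead_coeff (translate k p) = lead_coeff p"
proof (cases "p = 0")
  case False
  then have d: "0 < degree p" using assms Z0_degree_pos by blast
  have "lead_coeff (translate k p) = coeff (pcompose p [:of_int k, 1:]) (degree p)"
    using d unfolding degree_translate by (simp add: translate_def coeff_drop_const)
  also have "\<dots> = lead_coeff (pcompose p [:of_int k, 1:])" by (simp add: degree_pcompose)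
  also have "\<dots> = lead_coeff p" by (subst lead_coeff_comp) auto
  finally show ?thesis .
qed (simp add: translate_def drop_const_def)

text \<open>A polynomial \<open>p\<close> that is unchanged, up to a constant, by the translation by \<open>k \<noteq> 0\<close> is linear on
  the multiples of \<open>k\<close>, hence everywhere.\<close>

lemma translate_fixed_imp_linear:
  assumes p: "p \<in> Z0" and k: "k \<noteq> 0" and fixed: "translate k p = p"
  shows "degree p \<le> 1"
proof -
  let ?c = "ipoly_value p k"
  have lin: "ipoly_value p (int m * k) = int m * ?c" for m
  proof (induction m)
    case (Suc m)
    have "ipoly_value p (int (Suc m) * k) = ipoly_value p (int m * k + k)" by (simp add: algebra_simps)
    also have "\<dots> = ipoly_value p (int m * k) + ?c"
      using ipoly_value_translate[OF p, of "int m * k" k] fixed by simp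
    finally show ?case using Suc by (simp add: algebra_simps)
  qed (simp add: ipoly_value_0 p)
  let ?q = "[:0, of_int ?c / of_int k:] :: rat poly"
  have "p = ?q"
  proof (rule ccontr)
    assume "p \<noteq> ?q"
    then have "finite {x. poly (p - ?q) x = 0}" by (intro poly_roots_finite) simp
    moreover have "range (\<lambda>m::nat. of_int (int m * k)) \<subseteq> {x. poly (p - ?q) x = 0}"
    proof safe
      fix m :: nat
      have "poly p (of_int (int m * k)) = of_int (int m * ?c)"
        using ipoly_value_eq[OF Z0_integer[OF p], of "int m * k"] lin[of m] by simp
      then show "poly (p - ?q) (of_int (int m * k)) = 0" using k by simp
    qed
    moreover have "inj (\<lambda>m::nat. of_int (int m * k) :: rat)" using k by (auto simp: inj_on_def)
    ultimately show False using finite_subset range_inj_infinite by blast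
  qed
  then have "degree p = degree ?q" by (rule arg_cong)
  then show ?thesis by (simp split: if_splits)
qed

lemma Z0_linear:
  assumes p: "p \<in> Z0" and d: "degree p \<le> 1"
  shows "ipoly_value p n = ipoly_value p 1 * n" and "translate k p = p"
proof -
  have p_eq: "p = [:0, coeff p 1:]"
  proof (rule poly_eqI)
    fix i :: nat
    consider "i = 0" | "i = 1" | "1 < i" by linarith
    then show "coeff p i = coeff [:0, coeff p 1:] i"
    proof cases
      case 3
      then have "coeff p i = 0" "degree [:0, coeff p 1:] < i" using d by (auto intro: coeff_eq_0)
      then show ?thesis by (simp add: coeff_eq_0)
    qed (use p in \<open>simp_all add: Z0_def\<close>)
  qed
  have "poly p x = coeff p 1 * x" for x
    by (subst p_eq) simp
  then have lin: "of_int (ipoly_value p n) = coeff p 1 * of_int n" for n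
    using ipoly_value_eq[OF Z0_integer[OF p]] by simp
  show val: "ipoly_value p n = ipoly_value p 1 * n" for n
  proof -
    have "(of_int (ipoly_value p n) :: rat) = of_int (ipoly_value p 1 * n)"
      using lin[of n] lin[of 1] by simp
    then show ?thesis unfolding of_int_eq_iff .
  qed
  show "translate k p = p"
  proof (rule Z0_eqI[of _ _ 1])
    fix m :: nat
    show "ipoly_value (translate k p) (int m * 1) = ipoly_value p (int m * 1)"
      using ipoly_value_translate[OF p, of "int m" k] val[of "int m + k"] val[of "int m"] val[of k]
      by (simp add: algebra_simps)
  qed (simp_all add: translate_Z0 p)
qed

text \<open>Hence a finite set containing a nonlinear polynomial is not closed under translation: the
  translates of this polynomial are all distinct.\<close>

lemma ex_translate_notin:
  assumes Q: "finite Q" "Q \<subseteq> Z0" and p: "p \<in> Q" "2 \<le> degree p" and k: "k \<noteq> 0"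
  shows "\<exists>q\<in>Q. translate k q \<notin> Q"
proof (rule ccontr)
  assume "\<not> ?thesis"
  then have closed: "\<And>q. q \<in> Q \<Longrightarrow> translate k q \<in> Q" by blast
  have pZ: "p \<in> Z0" using p Q by blast
  have mem: "translate (int m * k) p \<in> Q" for m
  proof (induction m)
    case (Suc m)
    then show ?case using closed[OF Suc] by (simp add: translate_translate[OF pZ] algebra_simps)
  qed (simp add: translate_0 pZ p)
  have "\<not> inj (\<lambda>m::nat. translate (int m * k) p)"
    using mem Q(1) finite_subset[of "range (\<lambda>m::nat. translate (int m * k) p)" Q] range_inj_infinite by blast
  then obtain i j :: nat where ij: "i \<noteq> j" "translate (int i * k) p = translate (int j * k) p"
    by (auto simp: inj_on_def)
  have "translate ((int i - int j) * k) p = translate (- (int j * k)) (translate (int i * k) p)"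
    by (simp add: translate_translate[OF pZ] algebra_simps)
  also have "\<dots> = p" by (simp add: ij translate_uminus[OF pZ])
  finally have "degree p \<le> 1" using ij k by (intro translate_fixed_imp_linear[OF pZ]) auto
  then show False using p by simp
qed

section \<open>The induction measure\<close>

text \<open>For PET induction two polynomials are equivalent if they have the same degree and the same
  leading coefficient; \<open>leading p\<close> encodes the equivalence class of \<open>p\<close>.\<close>

definition leading :: "rat poly \<Rightarrow> nat \<times> rat" where
  "leading p = (degree p, lead_coeff p)"

text \<open>The weight of a finite family: the multiset of the degrees of its equivalence classes.  Weights
  are compared by the multiset order, which amounts to comparing the numbers of classes of the
  highest degree first.\<close>

definition weight :: "rat poly set \<Rightarrow> nat multiset" where
  "weight P = image_mset fst (mset_set (leading ` P))"

text \<open>Let \<open>q\<close> have minimal degree in \<open>Q\<close>.  Subtracting \<open>q\<close> from polynomials that represent no other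
  equivalence classes than those of \<open>Q\<close> keeps the degree of every class but that of \<open>q\<close>, which is
  replaced by classes of smaller degree.\<close>

lemma weight_decreasing:
  assumes Q: "finite Q" and q: "q \<in> Q" "q \<in> Z0" "q \<noteq> 0"
    and min: "\<And>p. p \<in> Q \<Longrightarrow> degree q \<le> degree p"
    and D: "finite D" "leading ` D \<subseteq> leading ` Q"
    and E: "E \<subseteq> (\<lambda>p. p - q) ` D - {0}"
  shows "(weight E, weight Q) \<in> mult less_than"
proof -
  let ?d = "degree q" and ?a = "lead_coeff q"
  \<comment> \<open>the effect of subtracting \<open>q\<close> on the classes other than that of \<open>q\<close>\<close>
  define \<phi> :: "nat \<times> rat \<Rightarrow> nat \<times> rat" where "\<phi> = (\<lambda>(e, b). if e = ?d then (e, b - ?a) else (e, b))"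
  have inj: "inj_on \<phi> A" for A by (auto simp: inj_on_def \<phi>_def split: if_splits)
  have fst_\<phi>: "fst (\<phi> z) = fst z" for z by (auto simp: \<phi>_def split: prod.splits)
  define C where "C = leading ` Q - {leading q}"
  have fin: "finite C" "finite (leading ` E)"
    using Q D(1) finite_subset[OF E] by (simp_all add: C_def)
  have d: "0 < ?d" using q Z0_degree_pos by blast
  have cls: "z \<in> \<phi> ` C \<or> fst z < ?d" if z: "z \<in> leading ` E" for z
  proof -
    obtain e where e: "e \<in> E" "z = leading e" using z by blast
    then have "e \<in> (\<lambda>p. p - q) ` D" "e \<noteq> 0" using E by blast+
    then obtain p where p: "p \<in> D" "p \<noteq> q" and z: "z = leading (p - q)" using e by auto
    obtain p' where p': "p' \<in> Q" "leading p = leading p'" using p D by blast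
    have deg: "?d \<le> degree p" using p' min[of p'] by (simp add: leading_def)
    have inC: "leading p \<in> C" if "leading p \<noteq> leading q"
      using p' that by (auto simp: C_def)
    consider "?d < degree p" | "?d = degree p" "lead_coeff p \<noteq> ?a" | "?d = degree p" "lead_coeff p = ?a"
      using deg by linarith
    then show ?thesis
    proof cases
      case 1
      then have deg_eq: "degree (p - q) = degree p"
        using degree_add_eq_left[of "- q" p] by simp
      have "lead_coeff (p - q) = lead_coeff p"
        unfolding deg_eq using 1 by (simp add: coeff_eq_0)
      with deg_eq have "z = \<phi> (leading p)" using 1 z by (simp add: leading_def \<phi>_def)
      moreover have "leading p \<noteq> leading q" using 1 by (simp add: leading_def)
      ultimately show ?thesis using inC by blast
    next
      case 2
      have "degree (p - q) \<le> ?d" using 2 by (intro degree_diff_le) auto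
      moreover have "?d \<le> degree (p - q)" by (rule le_degree) (use 2 in simp)
      ultimately have "degree (p - q) = ?d" by simp
      then have "z = \<phi> (leading p)" using 2 z by (simp add: leading_def \<phi>_def)
      moreover have "leading p \<noteq> leading q" using 2 by (simp add: leading_def)
      ultimately show ?thesis using inC by blast
    next
      case 3
      have "degree (p - q) \<le> ?d" using 3 by (intro degree_diff_le) auto
      moreover have "degree (p - q) \<noteq> ?d"
      proof
        assume eq: "degree (p - q) = ?d"
        have "lead_coeff (p - q) = 0" unfolding eq using 3 by simp
        then have "p - q = 0" by (rule leading_coeff_0_iff[THEN iffD1])
        then show False using eq d by simp
      qed
      ultimately show ?thesis using z by (simp add: leading_def)
    qed
  qed
  define E1 where "E1 = leading ` E \<inter> \<phi> ` C"
  define E2 where "E2 = leading ` E - \<phi> ` C"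
  have fin12: "finite E1" "finite E2" using fin(2) by (simp_all add: E1_def E2_def)
  have E12: "leading ` E = E1 \<union> E2" "E1 \<inter> E2 = {}" unfolding E1_def E2_def by blast+
  have wE: "weight E = image_mset fst (mset_set E1) + image_mset fst (mset_set E2)"
    unfolding weight_def E12(1) mset_set_Union[OF fin12 E12(2)] by (rule image_mset_union)
  have lQ: "leading ` Q = insert (leading q) C" "leading q \<notin> C" using q(1) unfolding C_def by blast+
  have wQ: "weight Q = image_mset fst (mset_set C) + {#?d#}"
    unfolding weight_def lQ(1) mset_set.insert[OF fin(1) lQ(2)] by (simp add: leading_def)
  have "image_mset fst (mset_set (\<phi> ` C)) = image_mset fst (image_mset \<phi> (mset_set C))"
    by (simp only: image_mset_mset_set[OF inj])
  also have "\<dots> = image_mset (\<lambda>z. fst (\<phi> z)) (mset_set C)" by (simp only: multiset.map_comp comp_def)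
  also have "\<dots> = image_mset fst (mset_set C)" by (simp only: fst_\<phi>)
  finally have \<phi>C: "image_mset fst (mset_set (\<phi> ` C)) = image_mset fst (mset_set C)" .
  have "E1 \<subseteq> \<phi> ` C" by (simp add: E1_def)
  then have "mset_set E1 \<subseteq># mset_set (\<phi> ` C)"
    using fin(1) by (intro subset_imp_msubset_mset_set) simp_all
  then have "image_mset fst (mset_set E1) \<subseteq># image_mset fst (mset_set (\<phi> ` C))"
    by (rule image_mset_subseteq_mono)
  then have "image_mset fst (mset_set E1) \<subseteq># image_mset fst (mset_set C)"
    unfolding \<phi>C .
  then obtain J where J: "image_mset fst (mset_set C) = image_mset fst (mset_set E1) + J"
    unfolding subset_mset.le_iff_add by blast
  have less: "fst z < ?d" if "z \<in> E2" for z using cls that unfolding E2_def by blast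
  have "(image_mset fst (mset_set E1) + image_mset fst (mset_set E2),
      image_mset fst (mset_set E1) + (J + {#?d#})) \<in> mult less_than"
    by (rule one_step_implies_mult) (use less fin12 in auto)
  then show ?thesis unfolding wE wQ J by (simp add: add.assoc)
qed

section \<open>Polynomial correlations\<close>

text \<open>Two commuting measure preserving actions of the integers.\<close>

locale commuting_actions = mp_action M s + R: mp_action M r for M :: "'a measure" and s r +
  assumes commute: "x \<in> space M \<Longrightarrow> r j (s k x) = s k (r j x)"

lemma (in mp_action) commuting_trivial: "commuting_actions M s (\<lambda>k x. x)"
  by (intro commuting_actions.intro commuting_actions_axioms.intro mp_action_trivial)
    (unfold_locales, simp)

text \<open>The integral of \<open>H \<circ> r n\<close> times the product of the \<open>G p \<circ> s (p n)\<close> for \<open>p \<in> P\<close>.\<close>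

definition poly_corr :: "'a measure \<Rightarrow> (int \<Rightarrow> 'a \<Rightarrow> 'a) \<Rightarrow> (int \<Rightarrow> 'a \<Rightarrow> 'a) \<Rightarrow> rat poly set \<Rightarrow>
    ('a \<Rightarrow> complex) \<Rightarrow> (rat poly \<Rightarrow> 'a \<Rightarrow> complex) \<Rightarrow> int \<Rightarrow> complex" where
  "poly_corr M s r P H G n = (LINT x|M. H (r n x) * (\<Prod>p\<in>P. G p (s (ipoly_value p n) x)))"

text \<open>For all bounded functions the mean of these integrals is the product of the integrals.\<close>

definition factorizes :: "'a measure \<Rightarrow> (int \<Rightarrow> 'a \<Rightarrow> 'a) \<Rightarrow> (int \<Rightarrow> 'a \<Rightarrow> 'a) \<Rightarrow> rat poly set \<Rightarrow> bool" where
  "factorizes M s r P \<longleftrightarrow> (\<forall>H G. H \<in> bm M \<longrightarrow> (\<forall>p. G p \<in> bm M) \<longrightarrow>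
     avg (poly_corr M s r P H G) \<longlonglongrightarrow> (LINT x|M. H x) * (\<Prod>p\<in>P. LINT x|M. G p x))"

text \<open>The mean is 0 for all \<open>G p\<close> with integral zero; the integral of \<open>H\<close> is arbitrary.\<close>

definition decays :: "'a measure \<Rightarrow> (int \<Rightarrow> 'a \<Rightarrow> 'a) \<Rightarrow> (int \<Rightarrow> 'a \<Rightarrow> 'a) \<Rightarrow> rat poly set \<Rightarrow> bool" where
  "decays M s r P \<longleftrightarrow> (\<forall>H G. H \<in> bm M \<longrightarrow> (\<forall>p. G p \<in> bm M) \<longrightarrow> (\<forall>p\<in>P. (LINT x|M. G p x) = 0) \<longrightarrow>
     avg (poly_corr M s r P H G) \<longlonglongrightarrow> 0)"

lemma factorizesD: "factorizes M s r P \<Longrightarrow> H \<in> bm M \<Longrightarrow> (\<And>p. G p \<in> bm M) \<Longrightarrow>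
   avg (poly_corr M s r P H G) \<longlonglongrightarrow> (LINT x|M. H x) * (\<Prod>p\<in>P. LINT x|M. G p x)"
  unfolding factorizes_def by blast

lemma decaysD: "decays M s r P \<Longrightarrow> H \<in> bm M \<Longrightarrow> (\<And>p. G p \<in> bm M) \<Longrightarrow> (\<And>p. p \<in> P \<Longrightarrow> (LINT x|M. G p x) = 0) \<Longrightarrow>
   avg (poly_corr M s r P H G) \<longlonglongrightarrow> 0"
  unfolding decays_def by blast

context commuting_actions
begin

lemma poly_corr_integrand_bm:
  assumes "H \<in> bm M" "\<And>p. G p \<in> bm M"
  shows "(\<lambda>x. H (r n x) * (\<Prod>p\<in>P. G p (s (ipoly_value p n) x))) \<in> bm M"
  by (intro bm_mult bm_prod R.bm_action[OF assms(1)] bm_action[OF assms(2)])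

text \<open>Each \<open>G p\<close> is the sum of its integral and a function with integral zero.  Expanding the product
  leaves subfamilies to which the hypothesis applies, and the product of all the integrals.\<close>

lemma factorizes_of_decays:
  assumes fin: "finite P" and dec: "\<And>Q. Q \<subseteq> P \<Longrightarrow> Q \<noteq> {} \<Longrightarrow> decays M s r Q"
  shows "factorizes M s r P"
proof -
  \<comment> \<open>the functions of \<open>B\<close> have integral zero, those of \<open>A\<close> are still to be split\<close>
  have gen: "avg (poly_corr M s r (A \<union> B) H G) \<longlonglongrightarrow> (LINT x|M. H x) * (\<Prod>p\<in>A \<union> B. LINT x|M. G p x)"
    if "finite A" "A \<union> B \<subseteq> P" "A \<inter> B = {}" "H \<in> bm M" "\<And>p. G p \<in> bm M" "\<And>p. p \<in> B \<Longrightarrow> (LINT x|M. G p x) = 0"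
    for A B H G
    using that
  proof (induction A arbitrary: B G rule: finite_induct)
    case empty
    show ?case
    proof (cases "B = {}")
      case True
      have "poly_corr M s r ({} \<union> B) H G n = (LINT x|M. H x)" for n
        unfolding poly_corr_def using True R.integral_action[of H n] bm_measurable[OF empty(3)] by simp
      then have "poly_corr M s r ({} \<union> B) H G = (\<lambda>n. LINT x|M. H x)" by (rule ext)
      then show ?thesis using True tendsto_avg_const[of "LINT x|M. H x"] by simp
    next
      case False
      have "avg (poly_corr M s r ({} \<union> B) H G) \<longlonglongrightarrow> 0"
        by (rule decaysD[OF dec]) (use empty False in auto)
      moreover have "(\<Prod>p\<in>{} \<union> B. LINT x|M. G p x) = 0"
      proof (rule prod_zero)
        show "finite ({} \<union> B)" using finite_subset[OF empty(1) fin] .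
        show "\<exists>p\<in>{} \<union> B. (LINT x|M. G p x) = 0" using False empty(5) by blast
      qed
      ultimately show ?thesis by (simp only: mult_zero_right)
    qed
  next
    case (insert a A)
    let ?c = "LINT x|M. G a x"
    define G0 where "G0 = G(a := \<lambda>x. G a x - ?c)"
    have a: "a \<notin> A" "a \<notin> B" using insert by blast+
    have finAB: "finite (A \<union> B)" using finite_subset[OF _ fin] insert.prems by blast
    have G0: "G0 p \<in> bm M" for p unfolding G0_def using insert.prems(4) by (auto intro: bm_diff)
    have G0a: "(LINT x|M. G0 a x) = 0"
      unfolding G0_def using bm_integrable[OF insert.prems(4)[of a]] by (simp add: prob_space)
    have G0p: "p \<noteq> a \<Longrightarrow> G0 p = G p" for p by (simp add: G0_def)
    have IH1: "avg (poly_corr M s r (A \<union> B) H G) \<longlonglongrightarrow> (LINT x|M. H x) * (\<Prod>p\<in>A \<union> B. LINT x|M. G p x)"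
      by (rule insert.IH) (use insert.prems in auto)
    have IH2: "avg (poly_corr M s r (A \<union> insert a B) H G0) \<longlonglongrightarrow> (LINT x|M. H x) * (\<Prod>p\<in>A \<union> insert a B. LINT x|M. G0 p x)"
    proof (rule insert.IH)
      show "A \<union> insert a B \<subseteq> P" "A \<inter> insert a B = {}" "H \<in> bm M" using insert.prems a by auto
      show "G0 p \<in> bm M" for p by (rule G0)
      show "(LINT x|M. G0 p x) = 0" if "p \<in> insert a B" for p
        using that G0a G0p insert.prems(5) by (cases "p = a") auto
    qed
    have set_eq: "insert a A \<union> B = insert a (A \<union> B)" "A \<union> insert a B = insert a (A \<union> B)" by auto
    have prodG0: "(\<Prod>p\<in>A \<union> B. G0 p (y p)) = (\<Prod>p\<in>A \<union> B. G p (y p))" for y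
      using a by (intro prod.cong refl) (auto simp: G0_def)
    have eq: "poly_corr M s r (insert a A \<union> B) H G n
        = ?c * poly_corr M s r (A \<union> B) H G n + poly_corr M s r (A \<union> insert a B) H G0 n" for n
    proof -
      have i1: "integrable M (\<lambda>x. H (r n x) * (\<Prod>p\<in>A \<union> B. G p (s (ipoly_value p n) x)))"
        by (intro bm_integrable poly_corr_integrand_bm insert.prems)
      have i2: "integrable M (\<lambda>x. H (r n x) * (\<Prod>p\<in>A \<union> insert a B. G0 p (s (ipoly_value p n) x)))"
        by (intro bm_integrable poly_corr_integrand_bm insert.prems G0)
      have "H (r n x) * (\<Prod>p\<in>insert a A \<union> B. G p (s (ipoly_value p n) x)) =
        ?c * (H (r n x) * (\<Prod>p\<in>A \<union> B. G p (s (ipoly_value p n) x)))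
        + H (r n x) * (\<Prod>p\<in>A \<union> insert a B. G0 p (s (ipoly_value p n) x))" for x
      proof -
        have "a \<notin> A \<union> B" using a by simp
        then show ?thesis
          unfolding set_eq prod.insert[OF finAB \<open>a \<notin> A \<union> B\<close>] prodG0 by (simp add: G0_def algebra_simps)
      qed
      then show ?thesis unfolding poly_corr_def
        using i1 i2 by (simp only: Bochner_Integration.integral_add integrable_mult_right integral_mult_right_zero)
    qed
    have "avg (poly_corr M s r (insert a A \<union> B) H G) N
        = ?c * avg (poly_corr M s r (A \<union> B) H G) N + avg (poly_corr M s r (A \<union> insert a B) H G0) N" for N
    proof -
      have "poly_corr M s r (insert a A \<union> B) H G = (\<lambda>n. ?c * poly_corr M s r (A \<union> B) H G n + poly_corr M s r (A \<union> insert a B) H G0 n)"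
        by (rule ext) (rule eq)
      then show ?thesis by (simp only: avg_add avg_mult_left)
    qed
    moreover have "(\<lambda>N. ?c * avg (poly_corr M s r (A \<union> B) H G) N + avg (poly_corr M s r (A \<union> insert a B) H G0) N)
        \<longlonglongrightarrow> ?c * ((LINT x|M. H x) * (\<Prod>p\<in>A \<union> B. LINT x|M. G p x)) + (LINT x|M. H x) * (\<Prod>p\<in>A \<union> insert a B. LINT x|M. G0 p x)"
      by (intro tendsto_add tendsto_mult tendsto_const IH1 IH2)
    moreover have "(\<Prod>p\<in>A \<union> insert a B. LINT x|M. G0 p x) = 0"
      by (rule prod_zero) (use finAB G0a in auto)
    moreover have "(\<Prod>p\<in>insert a A \<union> B. LINT x|M. G p x) = ?c * (\<Prod>p\<in>A \<union> B. LINT x|M. G p x)"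
      unfolding set_eq using a finAB by simp
    ultimately show ?case by (simp only: mult_zero_right add_0_right mult.left_commute)
  qed
  show ?thesis
    unfolding factorizes_def using gen[of P "{}"] fin by simp
qed

end

text \<open>Subtracting the same polynomial \<open>q\<close> from all members of a family does not change the
  correlations, because the action preserves the measure.  The function belonging to \<open>q\<close> itself
  then takes the place of \<open>H\<close>.\<close>

lemma (in mp_action) product_average_of_decays:
  assumes P: "finite P" "P \<subseteq> Z0" and q: "q \<in> P"
    and dec: "\<And>E. E \<subseteq> (\<lambda>p. p - q) ` P - {0} \<Longrightarrow> finite E \<Longrightarrow> E \<subseteq> Z0 - {0} \<Longrightarrow> E \<noteq> {} \<Longrightarrow>
      decays M s (\<lambda>k x. x) E"
    and G: "\<And>p. G p \<in> bm M"
  shows "avg (\<lambda>n. LINT x|M. (\<Prod>p\<in>P. G p (s (ipoly_value p n) x))) \<longlonglongrightarrow> (\<Prod>p\<in>P. LINT x|M. G p x)"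
proof -
  let ?P = "(\<lambda>p. p - q) ` P - {0}"
  interpret C: commuting_actions M s "\<lambda>k x. x" by (rule commuting_trivial)
  have fac: "factorizes M s (\<lambda>k x. x) ?P"
  proof (rule C.factorizes_of_decays)
    show fin: "finite ?P" using P by simp
    fix E assume E: "E \<subseteq> ?P" "E \<noteq> {}"
    have "(\<lambda>p. p - q) ` P \<subseteq> Z0" using P q Z0_diff by blast
    then have "E \<subseteq> Z0 - {0}" using E(1) by blast
    then show "decays M s (\<lambda>k x. x) E" by (rule dec[OF E(1) finite_subset[OF E(1) fin] _ E(2)])
  qed
  define G' where "G' p = G (p + q)" for p
  have P': "?P = (\<lambda>p. p - q) ` (P - {q})" by auto
  have inj: "inj_on (\<lambda>p. p - q) (P - {q})" by (auto simp: inj_on_def)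
  have eq: "(LINT x|M. (\<Prod>p\<in>P. G p (s (ipoly_value p n) x))) = poly_corr M s (\<lambda>k x. x) ?P (G q) G' n" for n
  proof -
    let ?m = "- ipoly_value q n"
    have "(LINT x|M. (\<Prod>p\<in>P. G p (s (ipoly_value p n) x))) = (LINT x|M. (\<Prod>p\<in>P. G p (s (ipoly_value p n) (s ?m x))))"
      by (rule integral_action[symmetric]) (intro bm_measurable bm_prod bm_action G)
    also have "\<dots> = (LINT x|M. G q x * (\<Prod>p\<in>?P. G' p (s (ipoly_value p n) x)))"
    proof (rule Bochner_Integration.integral_cong[OF refl])
      fix x assume x: "x \<in> space M"
      have val: "s (ipoly_value p n) (s ?m x) = s (ipoly_value (p - q) n) x" if "p \<in> P" for p
      proof -
        have "integer_poly p" "integer_poly q" using that q P(2) Z0_integer by blast+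
        then show ?thesis
          using action_add[OF x, of "ipoly_value p n" ?m] by (simp add: ipoly_value_diff)
      qed
      have "(\<Prod>p\<in>P. G p (s (ipoly_value p n) (s ?m x))) = (\<Prod>p\<in>P. G p (s (ipoly_value (p - q) n) x))"
        by (rule prod.cong[OF refl]) (simp only: val)
      also have "\<dots> = G q (s (ipoly_value (q - q) n) x) * (\<Prod>p\<in>P - {q}. G p (s (ipoly_value (p - q) n) x))"
        by (rule prod.remove[OF P(1) q])
      also have "(\<Prod>p\<in>P - {q}. G p (s (ipoly_value (p - q) n) x)) = (\<Prod>p\<in>?P. G' p (s (ipoly_value p n) x))"
        unfolding P' prod.reindex[OF inj] by (simp add: G'_def)
      finally show "(\<Prod>p\<in>P. G p (s (ipoly_value p n) (s ?m x))) = G q x * (\<Prod>p\<in>?P. G' p (s (ipoly_value p n) x))"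
        by (simp add: action_zero[OF x])
    qed
    finally show ?thesis by (simp only: poly_corr_def)
  qed
  have "avg (poly_corr M s (\<lambda>k x. x) ?P (G q) G') \<longlonglongrightarrow> (LINT x|M. G q x) * (\<Prod>p\<in>?P. LINT x|M. G' p x)"
    by (rule factorizesD[OF fac]) (auto simp: G'_def G)
  moreover have "(LINT x|M. G q x) * (\<Prod>p\<in>?P. LINT x|M. G' p x) = (\<Prod>p\<in>P. LINT x|M. G p x)"
    unfolding P' prod.reindex[OF inj] prod.remove[OF P(1) q] by (simp add: G'_def)
  ultimately show ?thesis unfolding eq by simp
qed

text \<open>In a product over \<open>p \<in> Q\<close> of \<open>A p \<circ> s (p (n + k))\<close> and \<open>B p \<circ> s (p n)\<close>, the factors are grouped
  according to the polynomial in \<open>n\<close>, modulo constants.  A group contains at most one factor of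
  each kind, because translation is injective; a missing factor is 1.\<close>

definition grouped :: "(int \<Rightarrow> 'a \<Rightarrow> 'a) \<Rightarrow> rat poly set \<Rightarrow> int \<Rightarrow> (rat poly \<Rightarrow> 'a \<Rightarrow> complex) \<Rightarrow>
    (rat poly \<Rightarrow> 'a \<Rightarrow> complex) \<Rightarrow> rat poly \<Rightarrow> 'a \<Rightarrow> complex" where
  "grouped s Q k A B p x =
     (if p \<in> translate k ` Q then A (translate (- k) p) (s (ipoly_value (translate (- k) p) k) x) else 1) *
     (if p \<in> Q then B p x else 1)"

context mp_action
begin

lemma grouped_bm:
  assumes "\<And>p. A p \<in> bm M" "\<And>p. B p \<in> bm M"
  shows "grouped s Q k A B p \<in> bm M"
proof -
  have "(\<lambda>x. if p \<in> translate k ` Q then A (translate (- k) p) (s (ipoly_value (translate (- k) p) k) x) else 1) \<in> bm M"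
    by (cases "p \<in> translate k ` Q") (simp_all add: bm_action[OF assms(1)])
  moreover have "(\<lambda>x. if p \<in> Q then B p x else 1) \<in> bm M"
    by (cases "p \<in> Q") (simp_all add: assms(2))
  ultimately show ?thesis unfolding grouped_def by (rule bm_mult)
qed

lemma prod_doubled:
  assumes Q: "finite Q" "Q \<subseteq> Z0" and x: "x \<in> space M"
  shows "(\<Prod>p\<in>Q. A p (s (ipoly_value p (n + k)) x)) * (\<Prod>p\<in>Q. B p (s (ipoly_value p n) x))
    = (\<Prod>p\<in>Q \<union> translate k ` Q. grouped s Q k A B p (s (ipoly_value p n) x))"
proof -
  let ?T = "translate k ` Q" and ?U = "Q \<union> translate k ` Q"
  let ?A = "\<lambda>p x. A (translate (- k) p) (s (ipoly_value (translate (- k) p) k) x)"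
  have inv: "translate (- k) (translate k p) = p" if "p \<in> Q" for p
    using translate_uminus that Q(2) by blast
  have inj: "inj_on (translate k) Q" by (rule inj_on_inverseI) (rule inv)
  have fin: "finite ?U" using Q by simp
  have "(\<Prod>p\<in>Q. A p (s (ipoly_value p (n + k)) x)) = (\<Prod>p\<in>Q. ?A (translate k p) (s (ipoly_value (translate k p) n) x))"
  proof (rule prod.cong[OF refl])
    fix p assume p: "p \<in> Q"
    then have pZ: "p \<in> Z0" using Q by blast
    show "A p (s (ipoly_value p (n + k)) x) = ?A (translate k p) (s (ipoly_value (translate k p) n) x)"
      unfolding ipoly_value_translate[OF pZ, of n k] inv[OF p] action_add[OF x, symmetric] add.commute[of "ipoly_value p k"] ..
  qed
  also have "\<dots> = (\<Prod>p\<in>?T. ?A p (s (ipoly_value p n) x))"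
    using prod.reindex[OF inj, of "\<lambda>p. ?A p (s (ipoly_value p n) x)"] by simp
  also have "\<dots> = (\<Prod>p\<in>?U \<inter> ?T. ?A p (s (ipoly_value p n) x))"
    by (rule prod.cong) auto
  also have "\<dots> = (\<Prod>p\<in>?U. if p \<in> ?T then ?A p (s (ipoly_value p n) x) else 1)"
    by (rule prod.inter_restrict[OF fin])
  finally have 1: "(\<Prod>p\<in>Q. A p (s (ipoly_value p (n + k)) x)) = \<dots>" .
  have "(\<Prod>p\<in>Q. B p (s (ipoly_value p n) x)) = (\<Prod>p\<in>?U \<inter> Q. B p (s (ipoly_value p n) x))"
    by (rule prod.cong) auto
  also have "\<dots> = (\<Prod>p\<in>?U. if p \<in> Q then B p (s (ipoly_value p n) x) else 1)"
    by (rule prod.inter_restrict[OF fin])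
  finally have 2: "(\<Prod>p\<in>Q. B p (s (ipoly_value p n) x)) = \<dots>" .
  show ?thesis unfolding 1 2 prod.distrib[symmetric] grouped_def ..
qed

text \<open>If some polynomial is nonlinear, some group consists of a single function with integral zero.\<close>

lemma prod_integral_grouped_eq_0:
  assumes Q: "finite Q" "Q \<subseteq> Z0" and p: "p \<in> Q" "2 \<le> degree p" and k: "k \<noteq> 0"
    and A: "\<And>p. A p \<in> bm M" "\<And>p. p \<in> Q \<Longrightarrow> (LINT x|M. A p x) = 0"
  shows "(\<Prod>p\<in>Q \<union> translate k ` Q. LINT x|M. grouped s Q k A B p x) = 0"
proof -
  obtain q where q: "q \<in> Q" "translate k q \<notin> Q"
    using ex_translate_notin[OF Q p k] by blast
  have "translate (- k) (translate k q) = q" using q(1) Q(2) translate_uminus by blast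
  then have "grouped s Q k A B (translate k q) = (\<lambda>x. A q (s (ipoly_value q k) x))"
    using q by (simp add: grouped_def fun_eq_iff)
  then have "(LINT x|M. grouped s Q k A B (translate k q) x) = (LINT x|M. A q (s (ipoly_value q k) x))"
    by simp
  also have "\<dots> = 0"
    using integral_action[OF bm_measurable[OF A(1)]] A(2)[OF q(1)] by simp
  finally show ?thesis
    using q Q by (intro prod_zero) auto
qed

end

section \<open>PET induction\<close>

text \<open>The Cesaro form of weak mixing, for the action and for its restrictions to all nontrivial
  subgroups of the integers.\<close>

definition weakly_mixing_action :: "'a measure \<Rightarrow> (int \<Rightarrow> 'a \<Rightarrow> 'a) \<Rightarrow> bool" where
  "weakly_mixing_action M s \<longleftrightarrow> (\<forall>G a. G \<in> bm M \<longrightarrow> (LINT x|M. G x) = 0 \<longrightarrow> a \<noteq> 0 \<longrightarrow>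
     (\<lambda>H. (\<Sum>k\<in>{-int H..int H}. norm (LINT x|M. G (s (a * k) x) * cnj (G x))) / H) \<longlonglongrightarrow> 0)"

lemma (in prob_space) norm_integral_mult_le:
  assumes H: "H \<in> bm M" "\<And>x. norm (H x) \<le> C" "0 \<le> C" and f: "f \<in> bm M"
  shows "norm (LINT x|M. H x * f x) \<le> C * sqrt (LINT x|M. (norm (f x))\<^sup>2)"
proof -
  have "norm (LINT x|M. H x * f x) \<le> (LINT x|M. norm (H x * f x))" by (rule integral_norm_bound)
  also have "\<dots> \<le> (LINT x|M. C * norm (f x))"
    by (rule integral_mono)
      (use bm_integrable_norm[OF bm_mult[OF H(1) f]] bm_integrable_norm[OF f] H in \<open>auto simp: norm_mult intro: mult_right_mono\<close>)
  also have "\<dots> = C * (LINT x|M. norm (f x))" by simp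
  also have "\<dots> \<le> C * sqrt (LINT x|M. (norm (f x))\<^sup>2)"
    by (intro mult_left_mono H real_le_rsqrt integral_norm_square_le f)
  finally show ?thesis .
qed

context commuting_actions
begin

text \<open>The van der Corput step.  Moving \<open>r n\<close> to the other factors and applying van der Corput's lemma to
  these, the action \<open>r\<close> disappears from the correlations.  By the hypothesis \<open>fac\<close> the correlations
  have means \<open>\<gamma> k\<close>.  If there is a nonlinear polynomial, then \<open>\<gamma> k = 0\<close> for \<open>k \<noteq> 0\<close>.  If all
  polynomials are linear, then \<open>\<gamma> k\<close> is a product of correlations of the functions with their own
  translates, and weak mixing makes it small for most \<open>k\<close>; here \<open>r\<close> has to be trivial.\<close>

lemma decays_step:
  assumes Q: "finite Q" "Q \<subseteq> Z0 - {0}" "Q \<noteq> {}"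
    and fac: "\<And>k G. (\<And>p. G p \<in> bm M) \<Longrightarrow>
      avg (\<lambda>n. LINT x|M. (\<Prod>p\<in>Q \<union> translate k ` Q. G p (s (ipoly_value p n) x)))
        \<longlonglongrightarrow> (\<Prod>p\<in>Q \<union> translate k ` Q. LINT x|M. G p x)"
    and alt: "(\<exists>p\<in>Q. 2 \<le> degree p) \<or> weakly_mixing_action M s \<and> r = (\<lambda>k x. x)"
  shows "decays M s r Q"
  unfolding decays_def
proof (intro allI impI)
  fix H and G :: "rat poly \<Rightarrow> 'a \<Rightarrow> complex"
  assume H: "H \<in> bm M" and G_all: "\<forall>p. G p \<in> bm M" and G0: "\<forall>p\<in>Q. (LINT x|M. G p x) = 0"
  have G: "G p \<in> bm M" for p using G_all by blast
  have QZ: "Q \<subseteq> Z0" using Q by blast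
  obtain C where C: "0 \<le> C" "\<And>x. norm (H x) \<le> C" using bm_bound[OF H] by metis
  define v where "v n x = (\<Prod>p\<in>Q. G p (s (ipoly_value p n) (r (- n) x)))" for n x
  have v: "v n \<in> bm M" for n
    unfolding v_def by (intro bm_prod R.bm_action[of "\<lambda>x. G _ (s _ x)"] bm_action G)
  have "\<forall>p. \<exists>b. 0 \<le> b \<and> (\<forall>x. norm (G p x) \<le> b)" using bm_bound[OF G] by metis
  then obtain b where b: "\<And>p. 0 \<le> b p" "\<And>p x. norm (G p x) \<le> b p" by metis
  have vB: "norm (v n x) \<le> (\<Prod>p\<in>Q. b p)" for n x
    unfolding v_def prod_norm[symmetric] by (intro prod_mono conjI norm_ge_zero b)
  have corr_eq: "poly_corr M s r Q H G n = (LINT x|M. H x * v n x)" for n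
  proof -
    have "poly_corr M s r Q H G n = (LINT x|M. H (r n (r (- n) x)) * (\<Prod>p\<in>Q. G p (s (ipoly_value p n) (r (- n) x))))"
      unfolding poly_corr_def
      by (rule R.integral_action[symmetric, of "\<lambda>x. H (r n x) * (\<Prod>p\<in>Q. G p (s (ipoly_value p n) x))"])
        (intro bm_measurable poly_corr_integrand_bm H G)
    also have "\<dots> = (LINT x|M. H x * v n x)"
    proof (rule Bochner_Integration.integral_cong[OF refl])
      fix x assume x: "x \<in> space M"
      have "r n (r (- n) x) = x" using R.action_add[OF x, of n "- n"] R.action_zero[OF x] by simp
      then show "H (r n (r (- n) x)) * (\<Prod>p\<in>Q. G p (s (ipoly_value p n) (r (- n) x))) = H x * v n x"
        by (simp only: v_def)
    qed
    finally show ?thesis .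
  qed
  \<comment> \<open>the correlations of \<open>v\<close>, with both factors moved by \<open>r n\<close>\<close>
  define A where "A k p x = G p (r (- k) x)" for k p x
  define B where "B p x = cnj (G p x)" for p x
  have A: "A k p \<in> bm M" for k p unfolding A_def by (rule R.bm_action[OF G])
  have B: "B p \<in> bm M" for p unfolding B_def by (rule bm_cnj[OF G])
  have A0: "p \<in> Q \<Longrightarrow> (LINT x|M. A k p x) = 0" for k p
    unfolding A_def using R.integral_action[OF bm_measurable[OF G[of p]], of "- k"] G0 by simp
  define \<gamma> where "\<gamma> k = (\<Prod>p\<in>Q \<union> translate k ` Q. LINT x|M. grouped s Q k (A k) B p x)" for k
  have corr_v: "(LINT x|M. v (n + k) x * cnj (v n x)) =
      (LINT x|M. (\<Prod>p\<in>Q \<union> translate k ` Q. grouped s Q k (A k) B p (s (ipoly_value p n) x)))" for n k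
  proof -
    have "(LINT x|M. v (n + k) x * cnj (v n x)) = (LINT x|M. v (n + k) (r n x) * cnj (v n (r n x)))"
      by (rule R.integral_action[symmetric, of "\<lambda>x. v (n + k) x * cnj (v n x)"]) (intro bm_measurable bm_mult bm_cnj v)
    also have "\<dots> = (LINT x|M. (\<Prod>p\<in>Q \<union> translate k ` Q. grouped s Q k (A k) B p (s (ipoly_value p n) x)))"
    proof (rule Bochner_Integration.integral_cong[OF refl])
      fix x assume x: "x \<in> space M"
      have r1: "r (- (n + k)) (r n x) = r (- k) x" using R.action_add[OF x, of "- (n + k)" n] by simp
      have r2: "r (- n) (r n x) = x" using R.action_add[OF x, of "- n" n] R.action_zero[OF x] by simp
      have "v (n + k) (r n x) = (\<Prod>p\<in>Q. A k p (s (ipoly_value p (n + k)) x))"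
        unfolding v_def r1 A_def commute[OF x] ..
      moreover have "cnj (v n (r n x)) = (\<Prod>p\<in>Q. B p (s (ipoly_value p n) x))"
        unfolding v_def r2 B_def by simp
      ultimately show "v (n + k) (r n x) * cnj (v n (r n x)) =
          (\<Prod>p\<in>Q \<union> translate k ` Q. grouped s Q k (A k) B p (s (ipoly_value p n) x))"
        using prod_doubled[OF Q(1) QZ x, of "A k" n k B] by simp
    qed
    finally show ?thesis .
  qed
  have \<gamma>: "avg (\<lambda>n. LINT x|M. v (n + k) x * cnj (v n x)) \<longlonglongrightarrow> \<gamma> k" for k
    unfolding corr_v \<gamma>_def by (rule fac) (intro grouped_bm A B)
  have \<gamma>_avg: "(\<lambda>H. (\<Sum>k\<in>{-int H..int H}. norm (\<gamma> k)) / H) \<longlonglongrightarrow> 0"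
  proof (cases "\<exists>p\<in>Q. 2 \<le> degree p")
    case True
    then obtain p where p: "p \<in> Q" "2 \<le> degree p" by blast
    have \<gamma>0: "\<gamma> k = 0" if "k \<noteq> 0" for k
      unfolding \<gamma>_def by (rule prod_integral_grouped_eq_0[OF Q(1) QZ p that A A0])
    have "(\<Sum>k\<in>{-int H..int H}. norm (\<gamma> k)) = norm (\<gamma> 0)" for H
    proof -
      have "(\<Sum>k\<in>{-int H..int H}. norm (\<gamma> k)) = (\<Sum>k\<in>{0}. norm (\<gamma> k))"
        by (rule sum.mono_neutral_right) (use \<gamma>0 in auto)
      then show ?thesis by simp
    qed
    then show ?thesis by (simp add: lim_const_over_n)
  next
    case False
    then have wm: "weakly_mixing_action M s \<and> r = (\<lambda>k x. x)" using alt by blast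
    have lin: "degree p \<le> 1" if "p \<in> Q" for p using that False by fastforce
    obtain q where q: "q \<in> Q" using Q by blast
    then have qZ: "q \<in> Z0" "q \<noteq> 0" using Q by blast+
    let ?a = "ipoly_value q 1"
    let ?c = "\<lambda>k. LINT x|M. G q (s (?a * k) x) * cnj (G q x)"
    have a: "?a \<noteq> 0"
    proof
      assume a0: "?a = 0"
      have "q = 0"
      proof (rule Z0_eqI[OF qZ(1), of 0 1])
        show "0 \<in> Z0" by (simp add: Z0_def integer_poly_def)
        fix m :: nat
        have "ipoly_value q (int m * 1) = 0"
          using Z0_linear(1)[OF qZ(1) lin[OF q], of "int m * 1"] unfolding a0 by (simp only: mult_zero_left)
        then show "ipoly_value q (int m * 1) = ipoly_value 0 (int m * 1)" by simp
      qed simp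
      then show False using qZ by simp
    qed
    have fixed: "translate k p = p" if "p \<in> Q" for k p
      using Z0_linear(2)[OF _ lin[OF that]] that QZ by blast
    have img: "translate k ` Q = Q" for k using fixed by auto
    define D where "D = (\<Prod>p\<in>Q - {q}. b p * b p)"
    have D0: "0 \<le> D" unfolding D_def by (intro prod_nonneg) (simp add: b)
    have le: "norm (\<gamma> k) \<le> D * norm (?c k)" for k
    proof -
      have grp: "grouped s Q k (A k) B p = (\<lambda>x. G p (s (ipoly_value p k) x) * cnj (G p x))" if "p \<in> Q" for p
        using that wm by (simp add: grouped_def fun_eq_iff img fixed A_def B_def)
      have "\<gamma> k = (\<Prod>p\<in>Q. LINT x|M. G p (s (ipoly_value p k) x) * cnj (G p x))"
        unfolding \<gamma>_def img Un_absorb by (rule prod.cong[OF refl]) (simp only: grp)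
      also have "\<dots> = (LINT x|M. G q (s (ipoly_value q k) x) * cnj (G q x)) *
          (\<Prod>p\<in>Q - {q}. LINT x|M. G p (s (ipoly_value p k) x) * cnj (G p x))"
        by (rule prod.remove[OF Q(1) q])
      also have "(LINT x|M. G q (s (ipoly_value q k) x) * cnj (G q x)) = ?c k"
        by (simp only: Z0_linear(1)[OF qZ(1) lin[OF q], of k])
      finally have n1: "norm (\<gamma> k) = norm (?c k) * norm (\<Prod>p\<in>Q - {q}. LINT x|M. G p (s (ipoly_value p k) x) * cnj (G p x))"
        by (simp only: norm_mult)
      have n2: "norm (\<Prod>p\<in>Q - {q}. LINT x|M. G p (s (ipoly_value p k) x) * cnj (G p x)) \<le> D"
        unfolding D_def prod_norm[symmetric]
      proof (intro prod_mono conjI norm_ge_zero norm_integral_le)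
        fix p x
        show "norm (G p (s (ipoly_value p k) x) * cnj (G p x)) \<le> b p * b p"
          unfolding norm_mult complex_mod_cnj by (intro mult_mono b norm_ge_zero)
        show "0 \<le> b p * b p" by (simp add: b)
      qed
      show ?thesis unfolding n1 mult.commute[of D] by (rule mult_left_mono[OF n2 norm_ge_zero])
    qed
    have "(\<lambda>H. (\<Sum>k\<in>{-int H..int H}. norm (?c k)) / H) \<longlonglongrightarrow> 0"
      using wm a G[of q] G0 q unfolding weakly_mixing_action_def by blast
    then have "(\<lambda>H. D * ((\<Sum>k\<in>{-int H..int H}. norm (?c k)) / H)) \<longlonglongrightarrow> D * 0"
      by (intro tendsto_mult tendsto_const)
    then have lim: "(\<lambda>H. D * ((\<Sum>k\<in>{-int H..int H}. norm (?c k)) / H)) \<longlonglongrightarrow> 0" by simp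
    show ?thesis
    proof (rule tendsto_sandwich[OF _ _ tendsto_const lim])
      show "\<forall>\<^sub>F H in sequentially. 0 \<le> (\<Sum>k\<in>{-int H..int H}. norm (\<gamma> k)) / H"
        by (intro always_eventually allI divide_nonneg_nonneg sum_nonneg) auto
      have "(\<Sum>k\<in>{-int H..int H}. norm (\<gamma> k)) / H \<le> D * ((\<Sum>k\<in>{-int H..int H}. norm (?c k)) / H)" for H
      proof -
        have "(\<Sum>k\<in>{-int H..int H}. norm (\<gamma> k)) \<le> D * (\<Sum>k\<in>{-int H..int H}. norm (?c k))"
          unfolding sum_distrib_left by (intro sum_mono le)
        then show ?thesis unfolding times_divide_eq_right by (intro divide_right_mono) auto
      qed
      then show "\<forall>\<^sub>F H in sequentially. (\<Sum>k\<in>{-int H..int H}. norm (\<gamma> k)) / H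
          \<le> D * ((\<Sum>k\<in>{-int H..int H}. norm (?c k)) / H)"
        by (intro always_eventually allI)
    qed
  qed
  have vdc: "(\<lambda>N. LINT x|M. (norm (avg (\<lambda>n. v n x) N))\<^sup>2) \<longlonglongrightarrow> 0"
    by (rule van_der_Corput[OF v vB \<gamma> \<gamma>_avg])
  have bound: "norm (avg (poly_corr M s r Q H G) N) \<le> C * sqrt (LINT x|M. (norm (avg (\<lambda>n. v n x) N))\<^sup>2)" for N
  proof -
    have "avg (poly_corr M s r Q H G) N = avg (\<lambda>n. LINT x|M. H x * v n x) N"
      by (rule arg_cong[of _ _ "\<lambda>a. avg a N"]) (rule ext, rule corr_eq)
    also have "\<dots> = (LINT x|M. avg (\<lambda>n. H x * v n x) N)"
      by (rule integral_avg[symmetric]) (intro bm_integrable bm_mult H v)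
    also have "\<dots> = (LINT x|M. H x * avg (\<lambda>n. v n x) N)" by (simp only: avg_mult_left)
    finally show ?thesis
      using norm_integral_mult_le[OF H C(2) C(1) bm_avg[of v, OF v]] by simp
  qed
  have "(\<lambda>N. C * sqrt (LINT x|M. (norm (avg (\<lambda>n. v n x) N))\<^sup>2)) \<longlonglongrightarrow> C * sqrt 0"
    by (intro tendsto_mult tendsto_const tendsto_real_sqrt vdc)
  then have "(\<lambda>N. C * sqrt (LINT x|M. (norm (avg (\<lambda>n. v n x) N))\<^sup>2)) \<longlonglongrightarrow> 0" by simp
  then show "avg (poly_corr M s r Q H G) \<longlonglongrightarrow> 0"
    by (rule Lim_null_comparison[rotated]) (intro always_eventually allI bound)
qed

end

context mp_action
begin

text \<open>PET induction on the weight.  The doubled family of the van der Corput step contributes no new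
  equivalence class, so subtracting a member of minimal degree lowers the weight.\<close>

lemma weakly_mixing_decays:
  assumes wm: "weakly_mixing_action M s"
  shows "finite Q \<Longrightarrow> Q \<subseteq> Z0 - {0} \<Longrightarrow> Q \<noteq> {} \<Longrightarrow> decays M s (\<lambda>k x. x) Q"
proof (induction Q rule: wf_induct_rule[OF wf_inv_image[OF wf_mult[OF wf_less_than], of weight]])
  case (1 Q)
  interpret C: commuting_actions M s "\<lambda>k x. x" by (rule commuting_trivial)
  have QZ: "Q \<subseteq> Z0" using 1 by blast
  obtain q where q: "q \<in> Q" "\<And>p. p \<in> Q \<Longrightarrow> degree q \<le> degree p"
    using arg_min_if_finite[OF 1(2,4), of degree] by (metis not_less)
  then have qZ: "q \<in> Z0" "q \<noteq> 0" using 1 by blast+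
  show ?case
  proof (rule C.decays_step[OF 1(2-4)])
    fix k and G :: "rat poly \<Rightarrow> 'a \<Rightarrow> complex"
    assume G: "\<And>p. G p \<in> bm M"
    let ?D = "Q \<union> translate k ` Q"
    have D: "finite ?D" "?D \<subseteq> Z0" "q \<in> ?D" using 1 QZ q translate_Z0 by auto
    have "leading (translate k p) = leading p" if "p \<in> Q" for p
      using that QZ by (auto simp: leading_def degree_translate lead_coeff_translate[unfolded degree_translate])
    then have lead: "leading ` ?D \<subseteq> leading ` Q" by (auto simp: image_iff)
    show "avg (\<lambda>n. LINT x|M. (\<Prod>p\<in>?D. G p (s (ipoly_value p n) x))) \<longlonglongrightarrow> (\<Prod>p\<in>?D. LINT x|M. G p x)"
    proof (rule product_average_of_decays[OF D _ G])
      fix E assume E: "E \<subseteq> (\<lambda>p. p - q) ` ?D - {0}" "finite E" "E \<subseteq> Z0 - {0}" "E \<noteq> {}"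
      show "decays M s (\<lambda>k x. x) E"
      proof (rule 1(1)[OF _ E(2-4)])
        show "(E, Q) \<in> inv_image (mult less_than) weight"
          unfolding in_inv_image
          by (rule weight_decreasing[OF 1(2) q(1) qZ q(2) D(1) lead E(1)])
      qed
    qed
  qed (use wm in blast)
qed

lemma weakly_mixing_factorizes:
  assumes wm: "weakly_mixing_action M s" and P: "finite P" "P \<subseteq> Z0" and G: "\<And>p. G p \<in> bm M"
  shows "avg (\<lambda>n. LINT x|M. (\<Prod>p\<in>P. G p (s (ipoly_value p n) x))) \<longlonglongrightarrow> (\<Prod>p\<in>P. LINT x|M. G p x)"
proof (cases "P = {}")
  case False
  then obtain q where q: "q \<in> P" by blast
  show ?thesis by (rule product_average_of_decays[OF P q weakly_mixing_decays[OF wm] G])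
qed (use tendsto_avg_const[of "1 :: complex"] in \<open>simp add: prob_space\<close>)

end

context commuting_actions
begin

text \<open>For polynomials of degree at least 2 the other action may be arbitrary.\<close>

lemma nonlinear_factorizes:
  assumes wm: "weakly_mixing_action M s" and P: "finite P" "P \<subseteq> Z0" "\<And>p. p \<in> P \<Longrightarrow> 2 \<le> degree p"
  shows "factorizes M s r P"
proof (rule factorizes_of_decays[OF P(1)])
  fix Q assume Q: "Q \<subseteq> P" "Q \<noteq> {}"
  show "decays M s r Q"
  proof (rule decays_step)
    show fin: "finite Q" using Q P finite_subset by blast
    show "Q \<subseteq> Z0 - {0}" using Q P(2) P(3)[of 0] by fastforce
    show "(\<exists>p\<in>Q. 2 \<le> degree p) \<or> weakly_mixing_action M s \<and> r = (\<lambda>k x. x)" using Q P(3) by blast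
    fix k and G :: "rat poly \<Rightarrow> 'a \<Rightarrow> complex"
    assume "\<And>p. G p \<in> bm M"
    then show "avg (\<lambda>n. LINT x|M. (\<Prod>p\<in>Q \<union> translate k ` Q. G p (s (ipoly_value p n) x)))
        \<longlonglongrightarrow> (\<Prod>p\<in>Q \<union> translate k ` Q. LINT x|M. G p x)"
      using fin Q(1) P(2) translate_Z0 by (intro weakly_mixing_factorizes[OF wm]) blast+
  qed fact
qed

text \<open>The sequence \<open>v\<close> is uncorrelated in mean with its translates.\<close>

lemma nonlinear_self_correlation:
  assumes wm: "weakly_mixing_action M s" and Q: "finite Q" "Q \<subseteq> Z0" "\<And>p. p \<in> Q \<Longrightarrow> 2 \<le> degree p" "Q \<noteq> {}"
    and h: "h \<in> bm M" and G: "\<And>p. G p \<in> bm M" "\<And>p. p \<in> Q \<Longrightarrow> (LINT x|M. G p x) = 0"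
  defines "v \<equiv> \<lambda>n x. h (r n x) * (\<Prod>p\<in>Q. G p (s (ipoly_value p n) x))"
  shows "\<exists>\<gamma>. (\<forall>k. avg (\<lambda>n. LINT x|M. v (n + k) x * cnj (v n x)) \<longlonglongrightarrow> \<gamma> k) \<and> (\<forall>k. k \<noteq> 0 \<longrightarrow> \<gamma> k = 0)"
proof -
  define B where "B p x = cnj (G p x)" for p x
  have B: "B p \<in> bm M" for p unfolding B_def by (rule bm_cnj[OF G(1)])
  define Hk where "Hk k x = h (r k x) * cnj (h x)" for k x
  have Hk: "Hk k \<in> bm M" for k unfolding Hk_def by (intro bm_mult bm_cnj R.bm_action h)
  let ?D = "\<lambda>k. Q \<union> translate k ` Q"
  let ?g = "\<lambda>k. grouped s Q k G B"
  define \<gamma> where "\<gamma> k = (LINT x|M. Hk k x) * (\<Prod>p\<in>?D k. LINT x|M. ?g k p x)" for k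
  have eq: "(LINT x|M. v (n + k) x * cnj (v n x)) = poly_corr M s r (?D k) (Hk k) (?g k) n" for n k
    unfolding poly_corr_def
  proof (rule Bochner_Integration.integral_cong[OF refl])
    fix x assume x: "x \<in> space M"
    have "v (n + k) x * cnj (v n x) = h (r (n + k) x) * cnj (h (r n x)) *
        ((\<Prod>p\<in>Q. G p (s (ipoly_value p (n + k)) x)) * (\<Prod>p\<in>Q. B p (s (ipoly_value p n) x)))"
      by (simp add: v_def B_def mult_ac)
    also have "h (r (n + k) x) * cnj (h (r n x)) = Hk k (r n x)"
      unfolding Hk_def using R.action_add[OF x, of k n] by (simp add: add.commute)
    finally show "v (n + k) x * cnj (v n x) = Hk k (r n x) * (\<Prod>p\<in>?D k. ?g k p (s (ipoly_value p n) x))"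
      unfolding prod_doubled[OF Q(1,2) x] .
  qed
  have "avg (\<lambda>n. LINT x|M. v (n + k) x * cnj (v n x)) \<longlonglongrightarrow> \<gamma> k" for k
  proof -
    have "factorizes M s r (?D k)"
      by (rule nonlinear_factorizes[OF wm]) (use Q translate_Z0 in \<open>auto simp: degree_translate\<close>)
    from factorizesD[OF this Hk grouped_bm[OF G(1) B]]
    show ?thesis unfolding eq \<gamma>_def .
  qed
  moreover have "\<gamma> k = 0" if k: "k \<noteq> 0" for k
  proof -
    obtain p where p: "p \<in> Q" "2 \<le> degree p" using Q(3,4) by blast
    have "(\<Prod>p\<in>?D k. LINT x|M. ?g k p x) = 0"
      by (rule prod_integral_grouped_eq_0[OF Q(1,2) p k G])
    then show ?thesis unfolding \<gamma>_def by (simp only: mult_zero_right)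
  qed
  ultimately show ?thesis by blast
qed

end

section \<open>Trigonometric polynomials and singular measures\<close>

text \<open>The characters of the circle \<open>[0,1)\<close>, with the sign used in the Fourier coefficients.\<close>

definition chi :: "int \<Rightarrow> real \<Rightarrow> complex" where
  "chi k t = cis (- (2 * pi * of_int k * t))"

lemma chi_mult: "chi k t * chi j t = chi (k + j) t"
  by (simp add: chi_def cis_mult algebra_simps)

lemma chi_cnj: "cnj (chi k t) = chi (- k) t"
  by (simp add: chi_def cis_cnj)

lemma norm_chi [simp]: "norm (chi k t) = 1"
  by (simp add: chi_def)

lemma chi_0 [simp]: "chi 0 t = 1"
  by (simp add: chi_def)

lemma continuous_chi: "continuous_on A (chi k)"
  unfolding chi_def by (intro continuous_intros)

lemma chi_measurable [measurable]: "chi k \<in> borel_measurable borel"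
  by (intro borel_measurable_continuous_onI continuous_chi)

lemma space_circle: "space circle_lebesgue = {0..<1}"
  by (simp add: circle_lebesgue_def space_restrict_space)

lemma sets_circle: "sets circle_lebesgue = sets (restrict_space borel {0..<1})"
  unfolding circle_lebesgue_def by (intro sets_restrict_space_cong) simp

lemma circle_measurable:
  assumes "sets \<nu> = sets (restrict_space borel {0..<1})" "g \<in> borel_measurable borel"
  shows "g \<in> borel_measurable \<nu>"
  using measurable_restrict_space1[OF assms(2), of "{0..<1}"] measurable_cong_sets[OF assms(1) refl] by blast

lemma prob_space_circle: "prob_space circle_lebesgue"
proof
  show "emeasure circle_lebesgue (space circle_lebesgue) = 1"
    unfolding space_circle unfolding circle_lebesgue_def by (subst emeasure_restrict_space) auto
qed

lemma integral_chi: "(LINT t|circle_lebesgue. chi k t) = (if k = 0 then 1 else 0)"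
proof (cases "k = 0")
  case True
  interpret prob_space circle_lebesgue by (rule prob_space_circle)
  show ?thesis using True by (simp add: prob_space)
next
  case False
  let ?w = "- (2 * pi * of_int k) :: real"
  have w: "?w \<noteq> 0" using False by simp
  define F where "F t = cis (?w * t) / (\<i> * of_real ?w)" for t
  have F: "(F has_vector_derivative chi k t) (at t within {0..1})" for t
  proof -
    have "((\<lambda>t. exp (\<i> * of_real ?w * of_real t) / (\<i> * of_real ?w)) has_vector_derivative
        (\<i> * of_real ?w) * exp (\<i> * of_real ?w * of_real t) / (\<i> * of_real ?w)) (at t within {0..1})"
      by (rule has_vector_derivative_real_field) (use w in \<open>auto intro!: derivative_eq_intros\<close>)
    then show ?thesis
      unfolding F_def[abs_def] chi_def cis_conv_exp using w False by (simp add: mult_ac)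
  qed
  have "has_bochner_integral lborel (\<lambda>t. indicator {0..1} t *\<^sub>R chi k t) (F 1 - F 0)"
    by (rule has_bochner_integral_FTC_Icc) (use F continuous_chi in auto)
  then have "(LINT t|lborel. indicator {0..1} t *\<^sub>R chi k t) = F 1 - F 0"
    by (rule has_bochner_integral_integral_eq)
  also have "F 1 - F 0 = 0"
  proof -
    have "cis (?w * 1) = 1" using cis_multiple_2pi[of "- of_int k"] by simp
    then show ?thesis by (simp add: F_def)
  qed
  also have "(LINT t|lborel. indicator {0..1} t *\<^sub>R chi k t) = (LINT t|lborel. indicator {0..<1} t *\<^sub>R chi k t)"
  proof (rule integral_cong_AE)
    show "AE t in lborel. indicator {0..1} t *\<^sub>R chi k t = indicator {0..<1} t *\<^sub>R chi k t"
      using AE_lborel_singleton[of 1] by eventually_elim (auto simp: indicator_def)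
  qed auto
  finally show ?thesis
    unfolding circle_lebesgue_def using False by (subst integral_restrict_space) auto
qed

lemma chi_bm:
  assumes "sets \<nu> = sets (restrict_space borel {0..<1})" shows "chi k \<in> bm \<nu>"
  by (rule bmI[of _ _ 1]) (simp_all add: circle_measurable[OF assms])

lemma parseval:
  assumes "finite K"
  shows "(LINT t|circle_lebesgue. (norm (\<Sum>k\<in>K. c k * chi k t))\<^sup>2) = (\<Sum>k\<in>K. (norm (c k))\<^sup>2)"
proof -
  interpret prob_space circle_lebesgue by (rule prob_space_circle)
  have "complex_of_real (LINT t|circle_lebesgue. (norm (\<Sum>k\<in>K. c k * chi k t))\<^sup>2)
      = (\<Sum>k\<in>K. \<Sum>j\<in>K. c k * cnj (c j) * (if j = k then 1 else 0))"
    unfolding integral_norm_square_sum[OF finite_measure_axioms chi_bm[OF sets_circle]]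
    by (intro sum.cong refl) (simp add: chi_cnj chi_mult integral_chi)
  also have "\<dots> = (\<Sum>k\<in>K. c k * cnj (c k))"
    using assms by (simp add: if_distrib[of "\<lambda>x. _ * x"] cong: if_cong)
  also have "\<dots> = complex_of_real (\<Sum>k\<in>K. (norm (c k))\<^sup>2)"
    by (simp add: complex_norm_square[symmetric])
  finally show ?thesis by (simp only: of_real_eq_iff)
qed

text \<open>Trigonometric polynomials, with an arbitrary finite set of frequencies.\<close>

definition trig_poly :: "(real \<Rightarrow> complex) set" where
  "trig_poly = {g. \<exists>K c. finite K \<and> g = (\<lambda>t. \<Sum>k\<in>K. c k * chi k t)}"

lemma trig_polyI:
  assumes "finite Z" shows "(\<lambda>t. \<Sum>z\<in>Z. c z * chi (\<sigma> z) t) \<in> trig_poly"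
proof -
  have "(\<Sum>z\<in>Z. c z * chi (\<sigma> z) t) = (\<Sum>m\<in>\<sigma> ` Z. (\<Sum>z\<in>{z\<in>Z. \<sigma> z = m}. c z) * chi m t)" for t
  proof -
    have "(\<Sum>z\<in>Z. c z * chi (\<sigma> z) t) = (\<Sum>m\<in>\<sigma> ` Z. \<Sum>z\<in>{z\<in>Z. \<sigma> z = m}. c z * chi (\<sigma> z) t)"
      by (rule sum.image_gen[OF assms])
    also have "\<dots> = (\<Sum>m\<in>\<sigma> ` Z. (\<Sum>z\<in>{z\<in>Z. \<sigma> z = m}. c z) * chi m t)"
      unfolding sum_distrib_right by (intro sum.cong refl) auto
    finally show ?thesis .
  qed
  then show ?thesis
    unfolding trig_poly_def mem_Collect_eq
    by (intro exI[of _ "\<sigma> ` Z"] exI[of _ "\<lambda>m. \<Sum>z\<in>{z\<in>Z. \<sigma> z = m}. c z"]) (use assms in auto)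
qed

lemma trig_poly_chi: "(\<lambda>t. c * chi k t) \<in> trig_poly"
  using trig_polyI[of "{k}" "\<lambda>_. c" "\<lambda>k. k"] by simp

lemma trig_poly_add:
  assumes "g \<in> trig_poly" "h \<in> trig_poly" shows "(\<lambda>t. g t + h t) \<in> trig_poly"
proof -
  obtain K c J d where gh: "finite K" "g = (\<lambda>t. \<Sum>k\<in>K. c k * chi k t)" "finite J" "h = (\<lambda>t. \<Sum>k\<in>J. d k * chi k t)"
    using assms unfolding trig_poly_def by blast
  have "(\<lambda>t. g t + h t) = (\<lambda>t. \<Sum>z\<in>K <+> J. case_sum c d z * chi (case_sum (\<lambda>k. k) (\<lambda>k. k) z) t)"
    unfolding gh(2,4) sum.Plus[OF gh(1,3)] by simp
  then show ?thesis using trig_polyI[of "K <+> J"] gh by simp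
qed

lemma trig_poly_mult:
  assumes "g \<in> trig_poly" "h \<in> trig_poly" shows "(\<lambda>t. g t * h t) \<in> trig_poly"
proof -
  obtain K c J d where gh: "finite K" "g = (\<lambda>t. \<Sum>k\<in>K. c k * chi k t)" "finite J" "h = (\<lambda>t. \<Sum>k\<in>J. d k * chi k t)"
    using assms unfolding trig_poly_def by blast
  have "g t * h t = (\<Sum>z\<in>K \<times> J. (c (fst z) * d (snd z)) * chi (fst z + snd z) t)" for t
    unfolding gh(2,4) sum_product sum.cartesian_product
    by (intro sum.cong refl) (auto simp: chi_mult[symmetric])
  then have "(\<lambda>t. g t * h t) = (\<lambda>t. \<Sum>z\<in>K \<times> J. (c (fst z) * d (snd z)) * chi (fst z + snd z) t)"
    by (rule ext)
  then show ?thesis using trig_polyI[of "K \<times> J"] gh by simp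
qed

text \<open>Real polynomial functions on the plane are trigonometric polynomials on the circle.\<close>

lemma polynomial_trig_poly:
  assumes "real_polynomial_function g"
  shows "(\<lambda>t. complex_of_real (g (chi (-1) t))) \<in> trig_poly"
  using assms
proof induction
  case (linear f)
  have f_eq: "complex_of_real (f z) = (f 1 / 2 - \<i> * f \<i> / 2) * z + (f 1 / 2 + \<i> * f \<i> / 2) * cnj z" for z
  proof -
    interpret bounded_linear f by fact
    have "f z = f (Re z *\<^sub>R 1 + Im z *\<^sub>R \<i>)" by (rule arg_cong[of _ _ f]) (simp add: complex_eq_iff)
    also have "\<dots> = Re z * f 1 + Im z * f \<i>" by (simp only: add scaleR real_scaleR_def)
    finally have "f z = Re z * f 1 + Im z * f \<i>" .
    then show ?thesis by (simp add: complex_eq_iff algebra_simps)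
  qed
  have "(\<lambda>t. complex_of_real (f (chi (-1) t)))
      = (\<lambda>t. (f 1 / 2 - \<i> * f \<i> / 2) * chi (-1) t + (f 1 / 2 + \<i> * f \<i> / 2) * chi 1 t)"
    unfolding f_eq[of "chi (-1) _"] chi_cnj by simp
  then show ?case using trig_poly_add[OF trig_poly_chi trig_poly_chi] by simp
next
  case (const c)
  show ?case using trig_poly_chi[of "of_real c" 0] by simp
next
  case (add f g)
  then show ?case using trig_poly_add by simp
next
  case (mult f g)
  then show ?case using trig_poly_mult by simp
qed

lemma chi_inj:
  assumes "t \<in> {0..<1}" "u \<in> {0..<1}" "chi (-1) t = chi (-1) u" shows "t = u"
proof -
  have "cis (2 * pi * t) = cis (2 * pi * u)" using assms(3) by (simp add: chi_def)
  then have "exp (\<i> * of_real (2 * pi * t)) = exp (\<i> * of_real (2 * pi * u))" by (simp only: cis_conv_exp)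
  then obtain n :: int where "\<i> * of_real (2 * pi * t) = \<i> * of_real (2 * pi * u) + of_int (2 * n) * pi * \<i>"
    using exp_eq by blast
  then have "Im (\<i> * of_real (2 * pi * t)) = Im (\<i> * of_real (2 * pi * u) + of_int (2 * n) * pi * \<i>)" by (rule arg_cong)
  then have "pi * (2 * t) = pi * (2 * u + 2 * of_int n)" by (simp add: algebra_simps)
  then have n: "t = u + of_int n" by simp
  then have "\<bar>real_of_int n\<bar> < 1" using assms by auto
  then have "n = 0" by linarith
  then show ?thesis using n by simp
qed

text \<open>For a singular measure there is a trigonometric polynomial close to 1 for this measure and close
  to 0 for Lebesgue measure.  Take a compact Lebesgue null set \<open>K\<close> that carries almost all of the
  singular measure, and a continuous function \<open>\<phi>\<close> on the circle that is 1 on \<open>K\<close> and decreases rapidly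
  away from it; \<open>\<phi>\<close> is approximated uniformly by the Stone--Weierstrass theorem.  The circle is
  embedded in the plane in order that \<open>\<phi>\<close> be continuous across the point \<open>0\<close>.\<close>

lemma singular_trig_poly:
  assumes \<nu>: "finite_circle_measure \<nu>"
    and S: "S \<in> sets \<nu>" "emeasure circle_lebesgue S = 0" "emeasure \<nu> (space \<nu> - S) = 0"
    and e: "0 < e"
  shows "\<exists>g\<in>trig_poly. (LINT t|\<nu>. (norm (1 - g t))\<^sup>2) < e \<and> (LINT t|circle_lebesgue. (norm (g t))\<^sup>2) < e"
proof -
  interpret N: finite_measure \<nu> using \<nu> by (simp add: finite_circle_measure_def)
  interpret L: prob_space circle_lebesgue by (rule prob_space_circle)
  have sets_\<nu>: "sets \<nu> = sets (restrict_space borel {0..<1})" using \<nu> by (simp add: finite_circle_measure_def)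
  have space_\<nu>: "space \<nu> = {0..<1}"
    using sets_eq_imp_space_eq[OF sets_\<nu>] by (simp add: space_restrict_space)
  have S_borel: "S \<in> sets borel" "S \<subseteq> {0..<1}"
    using S(1) unfolding sets_\<nu> by (auto simp: sets_restrict_space)
  define e1 where "e1 = e / 8"
  have e1: "0 < e1" using e by (simp add: e1_def)
  define \<nu>1 where "\<nu>1 = distr \<nu> borel (\<lambda>t. t)"
  have id_m: "(\<lambda>t. t) \<in> borel_measurable \<nu>" by (rule circle_measurable[OF sets_\<nu>]) simp
  have \<nu>1: "emeasure \<nu>1 B = emeasure \<nu> B" if "B \<in> sets borel" "B \<subseteq> {0..<1}" for B
    unfolding \<nu>1_def using that id_m by (subst emeasure_distr) (auto simp: space_\<nu> Int_absorb2)
  have sets_mem: "B \<in> sets \<nu>" if "B \<in> sets borel" "B \<subseteq> {0..<1}" for B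
    unfolding sets_\<nu> sets_restrict_space using that by auto
  obtain K where K: "K \<subseteq> S" "compact K" "measure \<nu> S < measure \<nu> K + e1"
  proof -
    have S_sup: "emeasure \<nu>1 S = (SUP K\<in>{K. K \<subseteq> S \<and> compact K}. emeasure \<nu>1 K)"
    proof (rule inner_regular)
      show "sets \<nu>1 = sets borel" by (simp add: \<nu>1_def)
      interpret N1: finite_measure \<nu>1 unfolding \<nu>1_def by (rule N.finite_measure_distr[OF id_m])
      show "emeasure \<nu>1 (space \<nu>1) \<noteq> \<infinity>" using N1.emeasure_finite by simp
    qed (use S_borel in auto)
    have "\<exists>K. K \<subseteq> S \<and> compact K \<and> measure \<nu> S < measure \<nu> K + e1"
    proof (rule ccontr)
      assume "\<not> ?thesis"
      then have no: "measure \<nu> K \<le> measure \<nu> S - e1" if "K \<subseteq> S" "compact K" for K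
        using that by fastforce
      have "emeasure \<nu>1 S \<le> ennreal (measure \<nu> S - e1)"
        unfolding S_sup
      proof (rule SUP_least)
        fix K assume "K \<in> {K. K \<subseteq> S \<and> compact K}"
        then have K: "K \<subseteq> S" "compact K" by simp_all
        then have "emeasure \<nu>1 K = ennreal (measure \<nu> K)"
          using \<nu>1[of K] S_borel(2) by (simp add: borel_compact N.emeasure_eq_measure)
        also have "\<dots> \<le> ennreal (measure \<nu> S - e1)" by (rule ennreal_leI[OF no[OF K]])
        finally show "emeasure \<nu>1 K \<le> ennreal (measure \<nu> S - e1)" .
      qed
      then have "ennreal (measure \<nu> S) \<le> ennreal (measure \<nu> S - e1)"
        using \<nu>1[OF S_borel] by (simp add: N.emeasure_eq_measure)
      moreover have "0 \<le> measure \<nu> S - e1" using no[of "{}"] by simp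
      ultimately have "measure \<nu> S \<le> measure \<nu> S - e1" by (rule ennreal_le_iff[THEN iffD1, rotated])
      then show False using e1 by simp
    qed
    then show ?thesis using that by blast
  qed
  have K_sets: "K \<in> sets \<nu>" "K \<subseteq> {0..<1}"
    using K(1,2) S_borel(2) sets_mem[of K] borel_compact by auto
  have "measure \<nu> (space \<nu> - S) = 0" using S(3) by (simp add: measure_def)
  then have "measure \<nu> (space \<nu>) = measure \<nu> S" using N.finite_measure_compl[OF S(1)] by simp
  then have compl_K: "measure \<nu> (space \<nu> - K) < e1"
    using N.finite_measure_compl[OF K_sets(1)] K(3) by simp
  have AE_S: "AE t in circle_lebesgue. t \<notin> S"
    using S(1,2) by (intro AE_I[of _ _ S]) (auto simp: sets_\<nu> sets_circle)
  let ?e = "chi (-1)"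
  let ?m = "measure \<nu> (space \<nu>)"
  show ?thesis
  proof (cases "K = {}")
    case True
    have "(\<lambda>t. 0 :: complex) \<in> trig_poly" using trig_poly_chi[of 0 0] by simp
    moreover have "(LINT t|\<nu>. (norm (1 - 0 :: complex))\<^sup>2) < e"
      using compl_K True e by (simp add: e1_def)
    ultimately show ?thesis using e by (intro bexI[of _ "\<lambda>t. 0"]) auto
  next
    case False
    define C where "C = ?e ` K"
    have C: "compact C" "C \<noteq> {}"
      unfolding C_def using K(2) False continuous_chi by (auto intro: compact_continuous_image)
    define \<phi> where "\<phi> n z = max 0 (1 - real n * infdist z C)" for n and z :: complex
    have \<phi>_cont: "continuous_on A (\<phi> n)" for A n
      unfolding \<phi>_def by (intro continuous_intros)
    have \<phi>01: "0 \<le> \<phi> n z" "\<phi> n z \<le> 1" for n z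
      unfolding \<phi>_def using infdist_nonneg[of z C] by (auto simp: max_def)
    have \<phi>_m: "(\<lambda>t. \<phi> n (?e t)) \<in> borel_measurable borel" for n
      by (intro borel_measurable_continuous_onI continuous_on_compose2[OF \<phi>_cont continuous_chi]) auto
    have \<phi>K: "\<phi> n (?e t) = 1" if "t \<in> K" for n t
      unfolding \<phi>_def using that by (simp add: C_def)
    have \<phi>_lim: "(\<lambda>n. (\<phi> n (?e t))\<^sup>2) \<longlonglongrightarrow> 0" if t: "t \<in> {0..<1}" "t \<notin> K" for t
    proof -
      have "?e t \<notin> C" unfolding C_def using t K_sets(2) chi_inj by blast
      then have d: "0 < infdist (?e t) C"
        using in_closed_iff_infdist_zero[OF compact_imp_closed[OF C(1)] C(2), of "?e t"] infdist_nonneg[of "?e t" C]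
        by linarith
      obtain n0 :: nat where n0: "1 / infdist (?e t) C < n0" using reals_Archimedean2 by blast
      have "\<phi> n (?e t) = 0" if "n \<ge> n0" for n
      proof -
        have "1 / infdist (?e t) C < n" using n0 that by linarith
        then have "1 < n * infdist (?e t) C" using d by (simp add: field_simps)
        then show ?thesis by (simp add: \<phi>_def)
      qed
      then have "\<forall>\<^sub>F n in sequentially. (\<phi> n (?e t))\<^sup>2 = 0"
        by (intro eventually_sequentiallyI[of n0]) simp
      then show ?thesis by (rule tendsto_eventually)
    qed
    have "(\<lambda>n. LINT t|circle_lebesgue. (\<phi> n (?e t))\<^sup>2) \<longlonglongrightarrow> (LINT t|circle_lebesgue. 0)"
    proof (rule integral_dominated_convergence[where w = "\<lambda>t. 1"])
      show "AE t in circle_lebesgue. (\<lambda>n. (\<phi> n (?e t))\<^sup>2) \<longlonglongrightarrow> 0"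
        using AE_S AE_space by eventually_elim (use K(1) \<phi>_lim space_circle in blast)
      show "(\<lambda>t. (\<phi> n (?e t))\<^sup>2) \<in> borel_measurable circle_lebesgue" for n
        by (intro borel_measurable_power circle_measurable[OF sets_circle] \<phi>_m)
      show "AE t in circle_lebesgue. norm ((\<phi> n (?e t))\<^sup>2) \<le> 1" for n
        using \<phi>01 by (intro AE_I2) (simp add: power_le_one)
    qed auto
    then have "(\<lambda>n. LINT t|circle_lebesgue. (\<phi> n (?e t))\<^sup>2) \<longlonglongrightarrow> 0" by simp
    from LIMSEQ_D[OF this e1] obtain n where n: "(LINT t|circle_lebesgue. (\<phi> n (?e t))\<^sup>2) < e1"
      by (metis abs_ge_self diff_0_right le_refl order_le_less_trans real_norm_def)
    define \<delta> where "\<delta> = sqrt (e1 / (?m + 1))"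
    have m1: "0 < ?m + 1" using measure_nonneg[of \<nu> "space \<nu>"] by linarith
    then have q: "0 < e1 / (?m + 1)" using e1 by (rule divide_pos_pos[rotated])
    then have \<delta>: "0 < \<delta>" "\<delta>\<^sup>2 = e1 / (?m + 1)"
      unfolding \<delta>_def by (rule real_sqrt_gt_zero, intro real_sqrt_pow2 less_imp_le)
    have "\<delta>\<^sup>2 * (?m + 1) = e1" unfolding \<delta>(2) using m1 by simp
    moreover have "0 \<le> \<delta>\<^sup>2 * ?m" by (intro mult_nonneg_nonneg) simp_all
    ultimately have \<delta>m: "\<delta>\<^sup>2 * ?m \<le> e1" "\<delta>\<^sup>2 \<le> e1"
      using zero_le_power2[of \<delta>] unfolding distrib_left mult_1_right by linarith+
    obtain g where g: "real_polynomial_function g" "\<And>z. z \<in> sphere 0 1 \<Longrightarrow> \<bar>\<phi> n z - g z\<bar> < \<delta>"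
      using Stone_Weierstrass_real_polynomial_function[of "sphere 0 1" "\<phi> n" \<delta>] \<phi>_cont \<delta>(1) by auto
    define P where "P t = complex_of_real (g (?e t))" for t
    have P: "P \<in> trig_poly" unfolding P_def[abs_def] by (rule polynomial_trig_poly[OF g(1)])
    have close: "\<bar>\<phi> n (?e t) - g (?e t)\<bar> < \<delta>" for t by (rule g(2)) simp
    have g_cont: "continuous_on A g" for A
      using continuous_on_polymonial_function g(1) by (simp add: real_polynomial_function_eq)
    have g_m: "(\<lambda>t. g (?e t)) \<in> borel_measurable borel"
      by (intro borel_measurable_continuous_onI continuous_on_compose2[OF g_cont continuous_chi]) auto
    have sq: "(x + y)\<^sup>2 \<le> 2 * x\<^sup>2 + 2 * \<delta>\<^sup>2" if "\<bar>y\<bar> < \<delta>" for x y :: real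
    proof -
      have "y\<^sup>2 \<le> \<delta>\<^sup>2" using that \<delta>(1) by (intro abs_le_square_iff[THEN iffD1]) simp
      then show ?thesis using sum_squares_bound[of x y] by (simp add: power2_sum)
    qed
    have sq1: "(norm (1 - P t))\<^sup>2 \<le> 2 * (1 - \<phi> n (?e t))\<^sup>2 + 2 * \<delta>\<^sup>2" for t
    proof -
      have "norm (1 - P t) = \<bar>1 - g (?e t)\<bar>"
        unfolding P_def by (metis norm_of_real of_real_1 of_real_diff)
      then show ?thesis using sq[OF close[of t], of "1 - \<phi> n (?e t)"] by simp
    qed
    have sq2: "(norm (P t))\<^sup>2 \<le> 2 * (\<phi> n (?e t))\<^sup>2 + 2 * \<delta>\<^sup>2" for t
      using sq[of "g (?e t) - \<phi> n (?e t)" "\<phi> n (?e t)"] close[of t] by (simp add: P_def abs_minus_commute)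
    have gb: "\<bar>g (?e t)\<bar> \<le> 1 + \<delta>" for t
      using close[of t] \<phi>01[of n "?e t"] by (simp add: abs_if split: if_splits)
    have Pm: "P \<in> borel_measurable borel"
      unfolding P_def[abs_def] using g_m by simp
    have Pb: "norm (P t) \<le> 1 + \<delta>" for t using gb by (simp add: P_def)
    have Pbm\<nu>: "(\<lambda>t. 1 - P t) \<in> bm \<nu>" and PbmL: "P \<in> bm circle_lebesgue"
      by (auto intro!: bm_diff bmI[OF circle_measurable[OF sets_\<nu> Pm] Pb] bmI[OF circle_measurable[OF sets_circle Pm] Pb])
    have \<phi>i: "integrable \<nu> (\<lambda>t. (1 - \<phi> n (?e t))\<^sup>2)"
    proof (rule N.integrable_const_bound[of _ 1])
      show "AE t in \<nu>. norm ((1 - \<phi> n (?e t))\<^sup>2) \<le> 1"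
        using \<phi>01 by (intro AE_I2) (simp add: power_le_one)
    qed (intro borel_measurable_power borel_measurable_diff borel_measurable_const circle_measurable[OF sets_\<nu>] \<phi>_m)
    have \<phi>iL: "integrable circle_lebesgue (\<lambda>t. (\<phi> n (?e t))\<^sup>2)"
    proof (rule L.integrable_const_bound[of _ 1])
      show "AE t in circle_lebesgue. norm ((\<phi> n (?e t))\<^sup>2) \<le> 1"
        using \<phi>01 by (intro AE_I2) (simp add: power_le_one)
    qed (intro borel_measurable_power circle_measurable[OF sets_circle] \<phi>_m)
    have "(LINT t|\<nu>. (1 - \<phi> n (?e t))\<^sup>2) \<le> (LINT t|\<nu>. indicator (space \<nu> - K) t)"
    proof (rule integral_mono[OF \<phi>i])
      show "integrable \<nu> (indicat_real (space \<nu> - K))"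
      proof (rule integrable_real_indicator)
        show "emeasure \<nu> (space \<nu> - K) < \<infinity>"
          using N.emeasure_finite[of "space \<nu> - K"] unfolding infinity_ennreal_def less_top .
      qed (use K_sets(1) in blast)
      fix t assume t: "t \<in> space \<nu>"
      show "(1 - \<phi> n (?e t))\<^sup>2 \<le> indicat_real (space \<nu> - K) t"
        using \<phi>01[of n "?e t"] \<phi>K[of t n] t by (cases "t \<in> K") (auto simp: power_le_one)
    qed
    also have "\<dots> = measure \<nu> (space \<nu> - K)" using K_sets(1) by (simp add: Int_absorb1)
    also have "\<dots> < e1" by (rule compl_K)
    finally have \<phi>\<nu>: "(LINT t|\<nu>. (1 - \<phi> n (?e t))\<^sup>2) < e1" .
    have "(LINT t|\<nu>. (norm (1 - P t))\<^sup>2) \<le> (LINT t|\<nu>. 2 * (1 - \<phi> n (?e t))\<^sup>2 + 2 * \<delta>\<^sup>2)"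
      by (rule integral_mono[OF N.bm_integrable_norm_power[OF Pbm\<nu>] _ sq1]) (use \<phi>i in simp)
    also have "\<dots> = 2 * (LINT t|\<nu>. (1 - \<phi> n (?e t))\<^sup>2) + 2 * (\<delta>\<^sup>2 * ?m)"
      by (subst Bochner_Integration.integral_add) (use \<phi>i in \<open>simp_all add: mult_ac\<close>)
    also have "\<dots> < e" using \<phi>\<nu> \<delta>m(1) e unfolding e1_def by linarith
    finally have 1: "(LINT t|\<nu>. (norm (1 - P t))\<^sup>2) < e" .
    have "(LINT t|circle_lebesgue. (norm (P t))\<^sup>2) \<le> (LINT t|circle_lebesgue. 2 * (\<phi> n (?e t))\<^sup>2 + 2 * \<delta>\<^sup>2)"
      by (rule integral_mono[OF L.bm_integrable_norm_power[OF PbmL] _ sq2]) (use \<phi>iL in simp)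
    also have "\<dots> = 2 * (LINT t|circle_lebesgue. (\<phi> n (?e t))\<^sup>2) + 2 * \<delta>\<^sup>2"
      by (subst Bochner_Integration.integral_add) (use \<phi>iL in \<open>simp_all add: L.prob_space\<close>)
    also have "\<dots> < e" using n \<delta>m(2) e unfolding e1_def by linarith
    finally have "(LINT t|circle_lebesgue. (norm (P t))\<^sup>2) < e" .
    with 1 P show ?thesis by blast
  qed
qed

section \<open>Spectral measures\<close>

context mp_action
begin

lemma integral_translates:
  assumes f: "f \<in> bm M"
  shows "(LINT x|M. f (s k x) * cnj (f (s j x))) = (LINT x|M. f (s (k - j) x) * cnj (f x))"
proof -
  have "(LINT x|M. f (s k x) * cnj (f (s j x))) = (LINT x|M. f (s k (s (- j) x)) * cnj (f (s j (s (- j) x))))"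
    by (rule integral_action[symmetric, of "\<lambda>x. f (s k x) * cnj (f (s j x))"])
      (intro bm_measurable bm_mult bm_cnj bm_action f)
  also have "\<dots> = (LINT x|M. f (s (k - j) x) * cnj (f x))"
  proof (rule Bochner_Integration.integral_cong[OF refl])
    fix x assume x: "x \<in> space M"
    have "s k (s (- j) x) = s (k - j) x" "s j (s (- j) x) = x"
      using action_add[OF x, of k "- j"] action_add[OF x, of j "- j"] action_zero[OF x] by simp_all
    then show "f (s k (s (- j) x)) * cnj (f (s j (s (- j) x))) = f (s (k - j) x) * cnj (f x)" by simp
  qed
  finally show ?thesis .
qed

text \<open>Herglotz: the Fejer means of the correlations are nonnegative densities.  By Helly's theorem the
  corresponding measures, normalized and taken on the line, have a weak limit point; folded into
  \<open>[0,1)\<close> and multiplied by the normalizing constant \<open>b\<close> it is the spectral measure.\<close>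

lemma ex_spectral_measure:
  assumes f: "f \<in> bm M"
  shows "\<exists>\<nu>. finite_circle_measure \<nu> \<and> (\<forall>n. fourier_coeff \<nu> n = (LINT x|M. f (s n x) * cnj (f x)))"
proof -
  let ?a = "\<lambda>n. LINT x|M. f (s n x) * cnj (f x)"
  define b where "b = (LINT x|M. (norm (f x))\<^sup>2)"
  have a0: "?a 0 = of_real b"
  proof -
    have "?a 0 = (LINT x|M. complex_of_real ((norm (f x))\<^sup>2))"
      by (rule Bochner_Integration.integral_cong[OF refl]) (simp only: action_zero complex_norm_square)
    then show ?thesis unfolding b_def by (simp only: integral_complex_of_real)
  qed
  have b0: "0 \<le> b" unfolding b_def by simp
  have fs: "(\<lambda>x. f (s k x)) \<in> bm M" for k by (rule bm_action[OF f])
  show ?thesis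
  proof (cases "b = 0")
    case True
    obtain C where C: "0 \<le> C" "\<And>x. norm (f x) \<le> C" using bm_bound[OF f] by metis
    have "?a n = 0" for n
      using norm_integral_mult_le[OF fs C(2) C(1) bm_cnj[OF f], of n] True by (simp add: b_def)
    moreover have "finite_circle_measure (null_measure (restrict_space borel {0..<1}))"
      unfolding finite_circle_measure_def by (auto intro!: finite_measureI)
    moreover have "fourier_coeff (null_measure (restrict_space borel {0..<1})) n = 0" for n
      by (simp add: fourier_coeff_def)
    ultimately show ?thesis by auto
  next
    case False
    then have b: "0 < b" using b0 by simp
    interpret L: prob_space circle_lebesgue by (rule prob_space_circle)
    \<comment> \<open>The normalized Fejer means; as squared norms they are nonnegative.\<close>
    define D where "D N t = (LINT x|M. (norm (\<Sum>m\<in>{0..<int N}. chi (- m) t * f (s m x)))\<^sup>2) / (N * b)" for N t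
    have D_eq: "complex_of_real (D N t) = (\<Sum>m\<in>{0..<int N}. \<Sum>j\<in>{0..<int N}. chi (j - m) t * ?a (m - j)) / of_real (N * b)" for N t
    proof -
      have "complex_of_real (LINT x|M. (norm (\<Sum>m\<in>{0..<int N}. chi (- m) t * f (s m x)))\<^sup>2)
          = (\<Sum>m\<in>{0..<int N}. \<Sum>j\<in>{0..<int N}. chi (j - m) t * ?a (m - j))"
        unfolding integral_norm_square_sum[OF finite_measure_axioms fs] integral_translates[OF f]
        by (simp add: chi_cnj chi_mult)
      then show ?thesis unfolding D_def of_real_divide by (rule arg_cong)
    qed
    have D0: "0 \<le> D N t" for N t unfolding D_def using b by (intro divide_nonneg_nonneg integral_nonneg_AE) auto
    have Dm: "D N \<in> borel_measurable borel" for N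
    proof -
      have "(\<lambda>t. Re (complex_of_real (D N t))) \<in> borel_measurable borel"
        unfolding D_eq by measurable
      then show ?thesis by simp
    qed
    have coeff: "(LINT t|circle_lebesgue. complex_of_real (D N t) * chi k t)
        = of_nat (card {m\<in>{0..<int N}. m - k \<in> {0..<int N}}) * ?a k / of_real (N * b)" for N k
    proof -
      let ?I = "{0..<int N}"
      have i: "integrable circle_lebesgue (\<lambda>t. chi (j - m + k) t * ?a (m - j))" for j m
        by (intro L.bm_integrable bm_mult bm_const chi_bm[OF sets_circle])
      have "(LINT t|circle_lebesgue. complex_of_real (D N t) * chi k t)
          = (LINT t|circle_lebesgue. (\<Sum>m\<in>?I. \<Sum>j\<in>?I. chi (j - m + k) t * ?a (m - j)) / of_real (N * b))"
        unfolding D_eq times_divide_eq_left sum_distrib_right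
        by (simp add: chi_mult[symmetric] mult_ac)
      also have "\<dots> = (\<Sum>m\<in>?I. \<Sum>j\<in>?I. (if j - m + k = 0 then 1 else 0) * ?a (m - j)) / of_real (N * b)"
        using i by (simp add: Bochner_Integration.integral_sum integral_chi)
      also have "(\<Sum>m\<in>?I. \<Sum>j\<in>?I. (if j - m + k = 0 then 1 else 0) * ?a (m - j))
          = (\<Sum>m\<in>?I. if m - k \<in> ?I then ?a k else 0)"
      proof (rule sum.cong[OF refl])
        fix m
        have "(\<Sum>j\<in>?I. (if j - m + k = 0 then 1 else 0) * ?a (m - j)) = (\<Sum>j\<in>?I. if j = m - k then ?a k else 0)"
          by (rule sum.cong[OF refl]) auto
        also have "\<dots> = (if m - k \<in> ?I then ?a k else 0)" by (rule sum.delta) simp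
        finally show "(\<Sum>j\<in>?I. (if j - m + k = 0 then 1 else 0) * ?a (m - j)) = (if m - k \<in> ?I then ?a k else 0)" .
      qed
      also have "\<dots> = of_nat (card {m\<in>?I. m - k \<in> ?I}) * ?a k"
        by (subst sum.inter_filter[symmetric]) simp_all
      finally show ?thesis .
    qed
    have card_lim: "(\<lambda>N. real (card {m\<in>{0..<int (Suc N)}. m - k \<in> {0..<int (Suc N)}}) / real (Suc N)) \<longlonglongrightarrow> 1" for k
    proof (rule tendsto_sandwich)
      have card_eq: "card {m\<in>{0..<int N}. m - k \<in> {0..<int N}} = nat (int N - \<bar>k\<bar>)" for N
      proof -
        have "{m\<in>{0..<int N}. m - k \<in> {0..<int N}} = {max 0 k..<min (int N) (int N + k)}" by auto
        then show ?thesis by simp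
      qed
      show "\<forall>\<^sub>F N in sequentially. 1 - \<bar>real_of_int k\<bar> / real (Suc N)
          \<le> real (card {m\<in>{0..<int (Suc N)}. m - k \<in> {0..<int (Suc N)}}) / real (Suc N)"
      proof (intro always_eventually allI)
        fix N
        have "real (Suc N) - \<bar>real_of_int k\<bar> \<le> real (nat (int (Suc N) - \<bar>k\<bar>))" by linarith
        then have "(real (Suc N) - \<bar>real_of_int k\<bar>) / real (Suc N) \<le> real (nat (int (Suc N) - \<bar>k\<bar>)) / real (Suc N)"
          by (intro divide_right_mono) auto
        then show "1 - \<bar>real_of_int k\<bar> / real (Suc N)
          \<le> real (card {m\<in>{0..<int (Suc N)}. m - k \<in> {0..<int (Suc N)}}) / real (Suc N)"
          unfolding card_eq diff_divide_distrib by simp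
      qed
      show "\<forall>\<^sub>F N in sequentially. real (card {m\<in>{0..<int (Suc N)}. m - k \<in> {0..<int (Suc N)}}) / real (Suc N) \<le> 1"
        unfolding card_eq by (intro always_eventually allI) (simp add: divide_le_eq)
      have "(\<lambda>N. \<bar>real_of_int k\<bar> / real (Suc N)) \<longlonglongrightarrow> 0"
        using LIMSEQ_Suc[OF lim_const_over_n[of "\<bar>real_of_int k\<bar>"]] by simp
      from tendsto_diff[OF tendsto_const this, of 1]
      show "(\<lambda>N. 1 - \<bar>real_of_int k\<bar> / real (Suc N)) \<longlonglongrightarrow> 1" by simp
    qed (rule tendsto_const)
    have coeff_lim: "(\<lambda>N. LINT t|circle_lebesgue. complex_of_real (D (Suc N) t) * chi k t) \<longlonglongrightarrow> ?a k / b" for k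
    proof -
      have "(\<lambda>N. complex_of_real (real (card {m\<in>{0..<int (Suc N)}. m - k \<in> {0..<int (Suc N)}}) / real (Suc N)) * (?a k / b))
          \<longlonglongrightarrow> complex_of_real 1 * (?a k / b)"
        by (intro tendsto_mult tendsto_const tendsto_of_real card_lim)
      then show ?thesis unfolding coeff by (simp add: field_simps)
    qed
    define \<mu> where "\<mu> N = distr (density circle_lebesgue (\<lambda>t. ennreal (D (Suc N) t))) borel (\<lambda>t. t)" for N
    have Dc: "D N \<in> borel_measurable circle_lebesgue" for N
      by (rule circle_measurable[OF sets_circle Dm])
    have id_m: "(\<lambda>t. t) \<in> borel_measurable circle_lebesgue"
      by (rule circle_measurable[OF sets_circle]) simp
    have id_m': "(\<lambda>t. t) \<in> borel_measurable (density circle_lebesgue (\<lambda>t. ennreal (D N t)))" for N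
      using id_m by simp
    have int_\<mu>: "(LINT t|\<mu> N. g t) = (LINT t|circle_lebesgue. complex_of_real (D (Suc N) t) * g t)"
      if g: "g \<in> borel_measurable borel" for g :: "real \<Rightarrow> complex" and N
    proof -
      have gc: "g \<in> borel_measurable circle_lebesgue" by (rule circle_measurable[OF sets_circle g])
      have "(LINT t|\<mu> N. g t) = (LINT t|density circle_lebesgue (\<lambda>t. ennreal (D (Suc N) t)). g t)"
        unfolding \<mu>_def by (rule integral_distr[OF id_m' g])
      also have "\<dots> = (LINT t|circle_lebesgue. D (Suc N) t *\<^sub>R g t)"
        by (rule integral_density) (use gc Dc D0 in auto)
      finally show ?thesis by (simp only: scaleR_conv_of_real)
    qed
    have D_int: "integrable circle_lebesgue (D N)" for N
    proof -
      have "(\<lambda>t. complex_of_real (D N t)) \<in> bm circle_lebesgue"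
        unfolding D_eq divide_inverse
        by (intro bm_mult bm_sum bm_const chi_bm[OF sets_circle])
      then have "integrable circle_lebesgue (\<lambda>t. complex_of_real (D N t))" by (rule L.bm_integrable)
      then have "integrable circle_lebesgue (\<lambda>t. Re (complex_of_real (D N t)))" by (rule integrable_Re)
      then show ?thesis by simp
    qed
    have \<mu>_space: "emeasure (\<mu> N) B = 1" if B: "B \<in> sets borel" "{0..<1} \<subseteq> B" for B N
    proof -
      have "{m\<in>{0..<int (Suc N)}. m - 0 \<in> {0..<int (Suc N)}} = {0..<int (Suc N)}" by auto
      then have card0: "card {m\<in>{0..<int (Suc N)}. m - 0 \<in> {0..<int (Suc N)}} = Suc N" by simp
      have "complex_of_real (real (Suc N) * b) \<noteq> 0" using b by (simp del: of_nat_Suc)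
      then have "(LINT t|circle_lebesgue. complex_of_real (D (Suc N) t)) = 1"
        using coeff[of "Suc N" 0] unfolding card0 a0 by (simp del: of_nat_Suc)
      then have D1: "(LINT t|circle_lebesgue. D (Suc N) t) = 1"
        by (metis integral_complex_of_real of_real_eq_1_iff)
      have "emeasure (\<mu> N) B = emeasure (density circle_lebesgue (\<lambda>t. ennreal (D (Suc N) t))) (space circle_lebesgue)"
        unfolding \<mu>_def using B id_m' by (subst emeasure_distr) (auto simp: space_circle Int_absorb1)
      also have "\<dots> = (\<integral>\<^sup>+t. ennreal (D (Suc N) t) \<partial>circle_lebesgue)"
        using Dc by (subst emeasure_density) (auto intro!: nn_integral_cong)
      also have "\<dots> = ennreal (LINT t|circle_lebesgue. D (Suc N) t)"
        by (rule nn_integral_eq_integral[OF D_int]) (simp add: D0)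
      finally show ?thesis by (simp add: D1)
    qed
    have rd: "real_distribution (\<mu> N)" for N
      unfolding real_distribution_def real_distribution_axioms_def
    proof (intro conjI prob_spaceI)
      show "emeasure (\<mu> N) (space (\<mu> N)) = 1" by (rule \<mu>_space) (simp_all add: \<mu>_def)
    qed (simp_all add: \<mu>_def)
    have "tight \<mu>"
      unfolding tight_def
    proof (intro conjI allI impI rd)
      fix \<epsilon> :: real assume "0 < \<epsilon>"
      moreover have "measure (\<mu> N) {-1<..1} = 1" for N
      proof -
        have "emeasure (\<mu> N) {-1<..1} = 1" by (rule \<mu>_space) auto
        then show ?thesis by (simp add: measure_def)
      qed
      ultimately show "\<exists>a b. a < b \<and> (\<forall>n. 1 - \<epsilon> < measure (\<mu> n) {a<..b})"
        by (intro exI[of _ "-1"] exI[of _ 1]) auto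
    qed
    from tight_imp_convergent_subsubsequence[OF this strict_mono_id]
    obtain r M' where r: "strict_mono (r :: nat \<Rightarrow> nat)" and M': "real_distribution M'"
      and conv: "weak_conv_m (\<mu> \<circ> id \<circ> r) M'" by blast
    interpret M': real_distribution M' by (rule M')
    have chi_iexp: "iexp ((- (2 * pi * of_int k)) * t) = chi k t" for k t
      by (simp add: chi_def cis_conv_exp)
    have lim: "(LINT t|M'. chi k t) = ?a k / b" for k
    proof -
      have "(\<lambda>n. char ((\<mu> \<circ> id \<circ> r) n) (- (2 * pi * of_int k))) \<longlonglongrightarrow> char M' (- (2 * pi * of_int k))"
        by (rule levy_continuity1[OF _ M' conv]) (simp add: rd)
      then have "(\<lambda>n. LINT t|\<mu> (r n). chi k t) \<longlonglongrightarrow> (LINT t|M'. chi k t)"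
        unfolding char_def chi_iexp by simp
      moreover have "(\<lambda>n. LINT t|\<mu> (r n). chi k t) \<longlonglongrightarrow> ?a k / b"
        unfolding int_\<mu>[OF chi_measurable]
        using LIMSEQ_subseq_LIMSEQ[OF coeff_lim r] by (simp add: comp_def)
      ultimately show ?thesis by (rule LIMSEQ_unique)
    qed
    define \<nu> where "\<nu> = distr (density M' (\<lambda>_. ennreal b)) (restrict_space borel {0..<1}) frac"
    have frac_b: "(frac :: real \<Rightarrow> real) \<in> borel_measurable borel" 
      unfolding frac_def[abs_def] by (intro borel_measurable_diff borel_measurable_real_floor) simp
    have frac_m: "frac \<in> measurable (density M' (\<lambda>_. ennreal b)) (restrict_space borel {0..<1})"
    proof (rule measurable_restrict_space2)
      show "frac \<in> space (density M' (\<lambda>_. ennreal b)) \<rightarrow> {0..<1}" by (auto simp: frac_lt_1)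
      show "frac \<in> borel_measurable (density M' (\<lambda>_. ennreal b))" using frac_b by simp
    qed
    have fin: "finite_circle_measure \<nu>"
      unfolding finite_circle_measure_def
    proof
      have "finite_measure (density M' (\<lambda>_. ennreal b))"
        by (rule finite_measureI) (simp add: emeasure_density M'.emeasure_space_1 ennreal_mult_eq_top_iff)
      then show "finite_measure \<nu>" unfolding \<nu>_def by (rule finite_measure.finite_measure_distr[OF _ frac_m])
    qed (simp add: \<nu>_def)
    have chi_frac: "chi k (frac t) = chi k t" for k t
    proof -
      have "chi k t = chi k (frac t) * cis (2 * pi * (- of_int (k * \<lfloor>t\<rfloor>)))"
        unfolding chi_def cis_mult frac_def by (simp add: algebra_simps)
      also have "cis (2 * pi * (- of_int (k * \<lfloor>t\<rfloor>))) = 1" by (rule cis_multiple_2pi) simp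
      finally show ?thesis by simp
    qed
    have "fourier_coeff \<nu> k = ?a k" for k
    proof -
      have "fourier_coeff \<nu> k = (LINT t|\<nu>. chi k t)" by (simp add: fourier_coeff_def chi_def)
      also have "\<dots> = (LINT t|density M' (\<lambda>_. ennreal b). chi k (frac t))"
        unfolding \<nu>_def by (rule integral_distr[OF frac_m]) (rule circle_measurable[OF refl chi_measurable])
      also have "\<dots> = (LINT t|M'. b *\<^sub>R chi k t)"
        unfolding chi_frac by (rule integral_density) (use b in auto)
      also have "\<dots> = ?a k" using lim[of k] b by (simp add: scaleR_conv_of_real)
      finally show ?thesis .
    qed
    with fin show ?thesis by blast
  qed
qed

text \<open>The spectral measure turns combinations of translates into trigonometric polynomials.\<close>

lemma spectral_isometry:
  assumes f: "f \<in> bm M" and \<nu>: "finite_circle_measure \<nu>"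
    and coeff: "\<And>n. fourier_coeff \<nu> n = (LINT x|M. f (s n x) * cnj (f x))"
  shows "(LINT x|M. (norm (\<Sum>k\<in>K. c k * f (s k x)))\<^sup>2) = (LINT t|\<nu>. (norm (\<Sum>k\<in>K. c k * chi k t))\<^sup>2)"
proof -
  have N: "finite_measure \<nu>" "sets \<nu> = sets (restrict_space borel {0..<1})"
    using \<nu> by (auto simp: finite_circle_measure_def)
  have coeff': "(LINT t|\<nu>. chi n t) = (LINT x|M. f (s n x) * cnj (f x))" for n
    using coeff[of n] by (simp add: fourier_coeff_def chi_def)
  have "complex_of_real (LINT t|\<nu>. (norm (\<Sum>k\<in>K. c k * chi k t))\<^sup>2)
      = (\<Sum>k\<in>K. \<Sum>j\<in>K. c k * cnj (c j) * (LINT x|M. f (s (k - j) x) * cnj (f x)))"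
    unfolding integral_norm_square_sum[OF N(1) chi_bm[OF N(2)]] by (simp add: chi_cnj chi_mult coeff')
  also have "\<dots> = complex_of_real (LINT x|M. (norm (\<Sum>k\<in>K. c k * f (s k x)))\<^sup>2)"
    unfolding integral_norm_square_sum[OF finite_measure_axioms bm_action[OF f]] integral_translates[OF f] ..
  finally show ?thesis by (simp only: of_real_eq_iff)
qed

end

section \<open>The actions of the given automorphisms\<close>

lemma commuting_actionsI:
  assumes s: "mp_action M s" and r: "mp_action M r"
    and comm: "\<And>x. x \<in> space M \<Longrightarrow> r 1 (s 1 x) = s 1 (r 1 x)"
  shows "commuting_actions M s r"
proof -
  interpret S: mp_action M s by fact
  interpret R: mp_action M r by fact
  have gen: "g (u k x) = u k (g x)"
    if u: "mp_action M u" and g: "\<And>x. x \<in> space M \<Longrightarrow> g x \<in> space M"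
      and one: "\<And>x. x \<in> space M \<Longrightarrow> g (u 1 x) = u 1 (g x)" and x: "x \<in> space M" for g u k x
  proof -
    interpret U: mp_action M u by fact
    have m1: "g (u (-1) x) = u (-1) (g x)" if x: "x \<in> space M" for x
    proof -
      have "u 1 (u (-1) x) = x" using U.action_add[OF x, of 1 "-1"] U.action_zero[OF x] by simp
      then have "g x = u 1 (g (u (-1) x))" using one[OF U.action_space[OF x]] by metis
      then have "u (-1) (g x) = u (-1) (u 1 (g (u (-1) x)))" by simp
      also have "\<dots> = g (u (-1) x)"
        using U.action_add[OF g[OF U.action_space[OF x]], of "-1" 1 "-1"] U.action_zero[OF g[OF U.action_space[OF x]]] by simp
      finally show ?thesis by simp
    qed
    show ?thesis using x
    proof (induction k arbitrary: x rule: int_induct[where k = 0])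
      case base
      then show ?case using U.action_zero g by simp
    next
      case (step1 i)
      have "g (u (i + 1) x) = g (u i (u 1 x))" using U.action_add[OF step1(3), of i 1] by simp
      also have "\<dots> = u i (u 1 (g x))" using step1(2)[OF U.action_space[OF step1(3)]] one[OF step1(3)] by simp
      also have "\<dots> = u (i + 1) (g x)" using U.action_add[OF g[OF step1(3)], of i 1] by simp
      finally show ?case .
    next
      case (step2 i)
      have "g (u (i - 1) x) = g (u i (u (-1) x))" using U.action_add[OF step2(3), of i "-1"] by simp
      also have "\<dots> = u i (u (-1) (g x))" using step2(2)[OF U.action_space[OF step2(3)]] m1[OF step2(3)] by simp
      also have "\<dots> = u (i - 1) (g x)" using U.action_add[OF g[OF step2(3)], of i "-1"] by simp
      finally show ?case .
    qed
  qed
  have 1: "r 1 (s k x) = s k (r 1 x)" if "x \<in> space M" for k x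
    using gen[of s "r 1" x k, OF s R.action_space comm that] .
  have "s k (r j x) = r j (s k x)" if "x \<in> space M" for j k x
    using gen[of r "s k" x j, OF r S.action_space _ that] 1 by simp
  then show ?thesis by unfold_locales simp
qed

text \<open>The correlation \<open>c k\<close> is symmetric in \<open>k\<close>, so the sum over the multiples \<open>a k\<close> with \<open>|k| \<le> H\<close> is
  at most twice a sum over multiples of \<open>\<alpha> = |a|\<close> up to \<open>\<alpha> H\<close>.  By the Cauchy--Schwarz inequality it
  is controlled by the mean square of \<open>c\<close> up to \<open>\<alpha> H\<close>.\<close>

lemma weakly_mixing_action_aut_pow:
  assumes M: "prob_space M" and S: "mp_automorphism M S" and wm: "weakly_mixing M S"
  shows "weakly_mixing_action M (aut_pow M S)"
  unfolding weakly_mixing_action_def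
proof (intro allI impI)
  fix G :: "'a \<Rightarrow> complex" and a :: int
  assume G: "G \<in> bm M" "(LINT x|M. G x) = 0" and a: "a \<noteq> 0"
  let ?s = "aut_pow M S"
  interpret mp_action M ?s by (rule mp_action_aut_pow[OF M S])
  define c where "c k = norm (LINT x|M. G (?s k x) * cnj (G x))" for k
  have c_minus: "c (- k) = c k" for k
  proof -
    have "(LINT x|M. G (?s (- k) x) * cnj (G x)) = (LINT x|M. G (?s 0 x) * cnj (G (?s k x)))"
      using integral_translates[OF G(1), of 0 k] by simp
    also have "\<dots> = (LINT x|M. cnj (G (?s k x) * cnj (G x)))"
      by (rule Bochner_Integration.integral_cong[OF refl]) (simp add: action_zero)
    also have "\<dots> = cnj (LINT x|M. G (?s k x) * cnj (G x))" by (rule Bochner_Integration.integral_cnj)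
    finally show ?thesis by (simp add: c_def)
  qed
  define u where "u N = (\<Sum>i<N. (c (int i))\<^sup>2) / N" for N
  have u: "u \<longlonglongrightarrow> 0"
    using weakly_mixing_correlation[OF M _ mp_automorphism_distr(1)[OF S] wm G] S
    unfolding u_def[abs_def] c_def mp_automorphism_def by (simp add: aut_pow_def)
  define \<alpha> where "\<alpha> = nat \<bar>a\<bar>"
  have \<alpha>: "1 \<le> \<alpha>" using a by (simp add: \<alpha>_def)
  have c_abs: "c (a * k) = c (int (\<alpha> * nat \<bar>k\<bar>))" for k
  proof -
    have "int (\<alpha> * nat \<bar>k\<bar>) = a * k \<or> int (\<alpha> * nat \<bar>k\<bar>) = - (a * k)"
      by (simp add: \<alpha>_def abs_mult[symmetric] abs_if)
    then show ?thesis using c_minus[of "a * k"] by metis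
  qed
  have c0: "0 \<le> c k" for k by (simp add: c_def)
  have bound: "(\<Sum>k\<in>{-int H..int H}. c (a * k)) / H \<le> sqrt (16 * \<alpha> * u (\<alpha> * H + 1))" if H: "1 \<le> H" for H :: nat
  proof -
    define P where "P = (\<Sum>k\<le>H. c (int (\<alpha> * k)))"
    have P0: "0 \<le> P" unfolding P_def by (intro sum_nonneg c0)
    have sub: "{-int H..int H} \<subseteq> int ` {..H} \<union> (\<lambda>k. - int k) ` {..H}"
    proof
      fix k assume k: "k \<in> {-int H..int H}"
      show "k \<in> int ` {..H} \<union> (\<lambda>k. - int k) ` {..H}"
      proof (cases "0 \<le> k")
        case True
        then have "k = int (nat k)" "nat k \<in> {..H}" using k by auto
        then show ?thesis by blast
      next
        case False
        then have "k = - int (nat (- k))" "nat (- k) \<in> {..H}" using k by auto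
        then show ?thesis by blast
      qed
    qed
    have "(\<Sum>k\<in>{-int H..int H}. c (a * k)) \<le> (\<Sum>k\<in>int ` {..H} \<union> (\<lambda>k. - int k) ` {..H}. c (a * k))"
      by (rule sum_mono2[OF _ sub]) (auto simp: c0)
    also have "\<dots> \<le> (\<Sum>k\<in>int ` {..H}. c (a * k)) + (\<Sum>k\<in>(\<lambda>k. - int k) ` {..H}. c (a * k))"
      by (subst sum.union_inter[symmetric]) (auto simp: c0 intro!: sum_nonneg)
    also have "(\<Sum>k\<in>int ` {..H}. c (a * k)) = P"
      unfolding P_def by (subst sum.reindex) (auto simp: c_abs)
    also have "(\<Sum>k\<in>(\<lambda>k. - int k) ` {..H}. c (a * k)) = P"
      unfolding P_def by (subst sum.reindex) (auto simp: c_abs inj_on_def)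
    finally have sum_le: "(\<Sum>k\<in>{-int H..int H}. c (a * k)) \<le> 2 * P" by simp
    have "P\<^sup>2 \<le> (\<Sum>k\<le>H. (c (int (\<alpha> * k)))\<^sup>2) * (H + 1)"
      unfolding P_def using sum_squared_le_sum_of_squares[of "\<lambda>k. c (int (\<alpha> * k))" "{..H}"] by simp
    also have "(\<Sum>k\<le>H. (c (int (\<alpha> * k)))\<^sup>2) = (\<Sum>i\<in>(\<lambda>k. \<alpha> * k) ` {..H}. (c (int i))\<^sup>2)"
      using \<alpha> by (subst sum.reindex) (auto simp: inj_on_def)
    also have "\<dots> \<le> (\<Sum>i<\<alpha> * H + 1. (c (int i))\<^sup>2)"
      by (rule sum_mono2) (auto simp: less_Suc_eq_le)
    also have "\<dots> = (\<alpha> * H + 1) * u (\<alpha> * H + 1)"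
      unfolding u_def by (simp del: of_nat_Suc of_nat_add)
    finally have P2: "P\<^sup>2 \<le> real (\<alpha> * H + 1) * u (\<alpha> * H + 1) * real (H + 1)"
      by (simp add: mult_right_mono)
    have u0: "0 \<le> u N" for N unfolding u_def by (intro divide_nonneg_nonneg sum_nonneg) auto
    have "real (\<alpha> * H + 1) * real (H + 1) \<le> (2 * real \<alpha> * real H) * (2 * real H)"
    proof (intro mult_mono)
      have "1 \<le> \<alpha> * H" using \<alpha> H by simp
      then have "real 1 \<le> real (\<alpha> * H)" by (rule of_nat_mono)
      then show "real (\<alpha> * H + 1) \<le> 2 * real \<alpha> * real H"
        unfolding of_nat_add mult.assoc of_nat_mult[symmetric] by linarith
      show "real (H + 1) \<le> 2 * real H" using H by simp
    qed auto
    then have "real (\<alpha> * H + 1) * real (H + 1) * u (\<alpha> * H + 1) \<le> (2 * real \<alpha> * real H) * (2 * real H) * u (\<alpha> * H + 1)"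
      by (rule mult_right_mono) (rule u0)
    with P2 have "P\<^sup>2 \<le> 4 * \<alpha> * u (\<alpha> * H + 1) * (real H)\<^sup>2"
      by (simp add: power2_eq_square mult_ac)
    then have "(2 * P)\<^sup>2 \<le> 16 * \<alpha> * u (\<alpha> * H + 1) * (real H)\<^sup>2"
      by (simp add: power_mult_distrib)
    then have "(2 * P / H)\<^sup>2 \<le> 16 * \<alpha> * u (\<alpha> * H + 1)"
      using H by (simp add: power_divide pos_divide_le_eq)
    then have "2 * P / H \<le> sqrt (16 * \<alpha> * u (\<alpha> * H + 1))" by (rule real_le_rsqrt)
    moreover have "(\<Sum>k\<in>{-int H..int H}. c (a * k)) / H \<le> 2 * P / H"
      using sum_le by (intro divide_right_mono) auto
    ultimately show ?thesis by linarith
  qed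
  have "strict_mono (\<lambda>H::nat. \<alpha> * H + 1)" using \<alpha> by (intro strict_monoI) simp
  from LIMSEQ_subseq_LIMSEQ[OF u this] have "(\<lambda>H. u (\<alpha> * H + 1)) \<longlonglongrightarrow> 0" by (simp add: comp_def)
  then have "(\<lambda>H. 16 * \<alpha> * u (\<alpha> * H + 1)) \<longlonglongrightarrow> 0"
    by (rule tendsto_mult_right_zero)
  from tendsto_real_sqrt[OF this]
  have lim: "(\<lambda>H. sqrt (16 * \<alpha> * u (\<alpha> * H + 1))) \<longlonglongrightarrow> 0" by simp
  have "(\<lambda>H. (\<Sum>k\<in>{-int H..int H}. c (a * k)) / H) \<longlonglongrightarrow> 0"
  proof (rule tendsto_sandwich[OF _ _ tendsto_const lim])
    show "\<forall>\<^sub>F H in sequentially. 0 \<le> (\<Sum>k\<in>{-int H..int H}. c (a * k)) / H"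
      by (intro always_eventually allI divide_nonneg_nonneg sum_nonneg c0) auto
    show "\<forall>\<^sub>F H in sequentially. (\<Sum>k\<in>{-int H..int H}. c (a * k)) / H \<le> sqrt (16 * \<alpha> * u (\<alpha> * H + 1))"
      using eventually_ge_at_top[of 1] by eventually_elim (rule bound)
  qed
  then show "(\<lambda>H. (\<Sum>k\<in>{-int H..int H}. norm (LINT x|M. G (?s (a * k) x) * cnj (G x))) / H) \<longlonglongrightarrow> 0"
    by (simp only: c_def)
qed

text \<open>If \<open>T\<close> has singular spectrum, every bounded function with integral zero is close to a
  combination of its translates with small coefficients.\<close>

lemma singular_spectrum_approximation:
  assumes M: "prob_space M" and T: "mp_automorphism M T" and sing: "singular_spectrum M T"
    and f: "f \<in> bm M" "(LINT x|M. f x) = 0" and e: "0 < e"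
  shows "\<exists>K c. finite K \<and> (\<Sum>k\<in>K. (norm (c k))\<^sup>2) < e \<and>
    (LINT x|M. (norm (f x - (\<Sum>k\<in>K. c k * f (aut_pow M T k x))))\<^sup>2) < e"
proof -
  let ?t = "aut_pow M T"
  interpret mp_action M ?t by (rule mp_action_aut_pow[OF M T])
  obtain \<nu> where \<nu>: "finite_circle_measure \<nu>" "\<And>n. fourier_coeff \<nu> n = (LINT x|M. f (?t n x) * cnj (f x))"
    using ex_spectral_measure[OF f(1)] by blast
  then have "is_spectral_measure M T f \<nu>"
    by (simp add: is_spectral_measure_def L2_inner_def koopman_def)
  moreover have "in_L2_0 M f"
    using f bm_integrable_norm_power[OF f(1), of 2] bm_measurable[OF f(1)] by (simp add: in_L2_0_def in_L2_def)
  moreover obtain \<sigma> where \<sigma>: "is_maximal_spectral_type M T \<sigma>" "mutually_singular \<sigma> circle_lebesgue"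
    using sing unfolding singular_spectrum_def by blast
  ultimately have ac: "absolutely_continuous \<sigma> \<nu>"
    unfolding is_maximal_spectral_type_def dominates_spectral_measures_def by blast
  obtain A where A: "A \<in> sets \<sigma>" "A \<in> sets circle_lebesgue" "emeasure \<sigma> A = 0"
    "emeasure circle_lebesgue (space circle_lebesgue - A) = 0"
    using \<sigma>(2) unfolding mutually_singular_def by blast
  have "A \<in> null_sets \<sigma>" using A by (intro null_setsI)
  then have "A \<in> null_sets \<nu>" using ac unfolding absolutely_continuous_def by blast
  then have \<nu>A: "emeasure \<nu> A = 0" "A \<in> sets \<nu>" by auto
  have sets_\<nu>: "sets \<nu> = sets circle_lebesgue" using \<nu>(1) by (simp add: finite_circle_measure_def sets_circle)
  have space_\<nu>: "space \<nu> = space circle_lebesgue" by (rule sets_eq_imp_space_eq[OF sets_\<nu>])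
  have "space \<nu> - (space \<nu> - A) = A" using sets.sets_into_space[OF \<nu>A(2)] by blast
  then obtain g where g: "g \<in> trig_poly" "(LINT t|\<nu>. (norm (1 - g t))\<^sup>2) < e" "(LINT t|circle_lebesgue. (norm (g t))\<^sup>2) < e"
    using singular_trig_poly[OF \<nu>(1) sets.compl_sets[OF \<nu>A(2)] _ _ e] A(4) \<nu>A(1) space_\<nu> by auto
  obtain K c where K: "finite K" and g_eq: "g = (\<lambda>t. \<Sum>k\<in>K. c k * chi k t)"
    using g(1) unfolding trig_poly_def by blast
  define d where "d k = (if k = 0 then 1 else 0) - (if k \<in> K then c k else 0)" for k
  have d: "(\<Sum>k\<in>insert 0 K. d k * y k) = y 0 - (\<Sum>k\<in>K. c k * y k)" for y :: "int \<Rightarrow> complex"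
  proof -
    have "(\<Sum>k\<in>insert 0 K. d k * y k) = (\<Sum>k\<in>insert 0 K. if k = 0 then y k else 0) - (\<Sum>k\<in>insert 0 K. if k \<in> K then c k * y k else 0)"
      unfolding sum_subtractf[symmetric] by (rule sum.cong[OF refl]) (simp add: d_def left_diff_distrib)
    also have "(\<Sum>k\<in>insert 0 K. if k = 0 then y k else 0) = y 0"
      using K by (subst sum.delta) auto
    also have "(\<Sum>k\<in>insert 0 K. if k \<in> K then c k * y k else 0) = (\<Sum>k\<in>insert 0 K \<inter> K. c k * y k)"
      using K by (subst sum.inter_restrict) auto
    also have "insert 0 K \<inter> K = K" by blast
    finally show ?thesis .
  qed
  have "(LINT x|M. (norm (f x - (\<Sum>k\<in>K. c k * f (?t k x))))\<^sup>2) = (LINT x|M. (norm (\<Sum>k\<in>insert 0 K. d k * f (?t k x)))\<^sup>2)"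
    by (rule Bochner_Integration.integral_cong[OF refl]) (simp only: d[of "\<lambda>k. f (?t k _)"] action_zero)
  also have "\<dots> = (LINT t|\<nu>. (norm (\<Sum>k\<in>insert 0 K. d k * chi k t))\<^sup>2)"
    by (rule spectral_isometry[OF f(1) \<nu>])
  also have "\<dots> = (LINT t|\<nu>. (norm (1 - g t))\<^sup>2)"
    unfolding d[of "\<lambda>k. chi k _"] g_eq by simp
  finally have "(LINT x|M. (norm (f x - (\<Sum>k\<in>K. c k * f (?t k x))))\<^sup>2) < e" using g(2) by simp
  moreover have "(\<Sum>k\<in>K. (norm (c k))\<^sup>2) < e" using g(3) parseval[OF K, of c] by (simp add: g_eq)
  ultimately show ?thesis using K by blast
qed

section \<open>Singular spectrum against vanishing correlations\<close>

text \<open>A function with the property of \<open>singular_spectrum_approximation\<close> is orthogonal in mean to every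
  sequence that is uncorrelated in mean with its translates.\<close>

lemma (in mp_action) singular_orthogonality_L1:
  fixes v :: "int \<Rightarrow> 'a \<Rightarrow> complex"
  assumes v: "\<And>n. v n \<in> bm M" and B: "\<And>n x. norm (v n x) \<le> B"
    and \<gamma>: "\<And>k. avg (\<lambda>n. LINT x|M. v (n + k) x * cnj (v n x)) \<longlonglongrightarrow> \<gamma> k" "\<And>k. k \<noteq> 0 \<Longrightarrow> \<gamma> k = 0"
    and f: "f \<in> bm M"
    and approx: "\<And>e. 0 < e \<Longrightarrow> \<exists>K c. finite K \<and> (\<Sum>k\<in>K. (norm (c k))\<^sup>2) < e \<and>
      (LINT x|M. (norm (f x - (\<Sum>k\<in>K. c k * f (s k x))))\<^sup>2) < e"
  shows "(\<lambda>N. LINT x|M. norm (avg (\<lambda>n. f (s n x) * v n x) N)) \<longlonglongrightarrow> 0"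
proof (rule LIMSEQ_I)
  fix e :: real assume e: "0 < e"
  have B0: "0 \<le> B" using B[of 0 undefined] norm_ge_zero order_trans by blast
  obtain F where F: "0 \<le> F" "\<And>x. norm (f x) \<le> F" using bm_bound[OF f] by metis
  define q where "q = e / (4 * (B + 1) * (F + 1))"
  have q: "0 < q" unfolding q_def using e B0 F by (intro divide_pos_pos mult_pos_pos) linarith+
  have "0 < (B + 1) * (F + 1)" using B0 F by (intro mult_pos_pos) linarith+
  moreover have "q = e / (4 * ((B + 1) * (F + 1)))" unfolding q_def by (simp only: mult.assoc)
  moreover have "e / (4 * y) * y = e / 4" if "0 < y" for y using that by simp
  ultimately have qBF: "q * ((B + 1) * (F + 1)) = e / 4" by (simp only:)
  have q_B: "B * q \<le> e / 4"
  proof -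
    have "q * (B * 1) \<le> q * ((B + 1) * (F + 1))"
      using q B0 F by (intro mult_left_mono mult_mono) linarith+
    then show ?thesis using qBF by (simp add: mult.commute)
  qed
  have q_FB: "F * ((B + 1) * q) \<le> e / 4"
  proof -
    have "q * ((B + 1) * F) \<le> q * ((B + 1) * (F + 1))"
      using q B0 F by (intro mult_left_mono) linarith+
    then show ?thesis using qBF by (simp add: mult_ac)
  qed
  obtain K c where K: "finite K" and c: "(\<Sum>k\<in>K. (norm (c k))\<^sup>2) < q\<^sup>2"
    and close: "(LINT x|M. (norm (f x - (\<Sum>k\<in>K. c k * f (s k x))))\<^sup>2) < q\<^sup>2"
    using approx[of "q\<^sup>2"] q by auto
  define d where "d x = f x - (\<Sum>k\<in>K. c k * f (s k x))" for x
  have d: "d \<in> bm M" unfolding d_def[abs_def] by (intro bm_diff bm_sum bm_mult bm_const bm_action f)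
  define w where "w n x = (\<Sum>k\<in>K. c k * v (n - k) x)" for n x
  have w: "w n \<in> bm M" for n unfolding w_def by (intro bm_sum bm_mult bm_const v)
  define C where "C = (\<Sum>k\<in>K. norm (c k) * (2 * \<bar>real_of_int k\<bar> * (F * B)))"
  \<comment> \<open>\<open>E1\<close> is the error of replacing \<open>f\<close> by the combination of its translates, \<open>E3\<close> is the main term
    after the shift of the summation index, and \<open>C / N\<close> bounds the boundary terms of this shift.\<close>
  define E1 where "E1 N x = avg (\<lambda>n. d (s n x) * v n x) N" for N x
  define E3 where "E3 N x = avg (\<lambda>n. f (s n x) * w n x) N" for N x
  have decomp: "norm (avg (\<lambda>n. f (s n x) * v n x) N) \<le> norm (E1 N x) + C / N + norm (E3 N x)"
    if x: "x \<in> space M" for x N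
  proof -
    let ?a = "\<lambda>k. avg (\<lambda>n. f (s (n + k) x) * v (n + k - k) x) N"
    have "f (s n x) = d (s n x) + (\<Sum>k\<in>K. c k * f (s (n + k) x))" for n
      unfolding d_def using action_add[OF x] by (simp add: add.commute)
    then have "f (s n x) * v n x = d (s n x) * v n x + (\<Sum>k\<in>K. c k * (f (s (n + k) x) * v (n + k - k) x))" for n
      by (metis (no_types, lifting) add_diff_cancel_right' distrib_right mult.assoc sum.cong sum_distrib_right)
    then have 1: "avg (\<lambda>n. f (s n x) * v n x) N
        = E1 N x + (\<Sum>k\<in>K. c k * ?a k)"
      unfolding E1_def by (simp only: avg_add avg_sum avg_mult_left)
    have 3: "E3 N x = (\<Sum>k\<in>K. c k * avg (\<lambda>n. f (s n x) * v (n - k) x) N)"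
    proof -
      have "f (s n x) * w n x = (\<Sum>k\<in>K. c k * (f (s n x) * v (n - k) x))" for n
        unfolding w_def sum_distrib_left by (rule sum.cong[OF refl]) (simp only: mult.left_commute)
      then show ?thesis unfolding E3_def by (simp only: avg_sum avg_mult_left)
    qed
    have "norm ((\<Sum>k\<in>K. c k * ?a k) - E3 N x) \<le> (\<Sum>k\<in>K. norm (c k) * (2 * \<bar>real_of_int k\<bar> * (F * B) / N))"
      unfolding 3 sum_subtractf[symmetric] right_diff_distrib[symmetric]
    proof (rule sum_norm_le)
      fix k
      have "norm (?a k - avg (\<lambda>n. f (s n x) * v (n - k) x) N) \<le> 2 * \<bar>real_of_int k\<bar> * (F * B) / N"
        by (rule norm_avg_shift_le[of "\<lambda>n. f (s n x) * v (n - k) x" "F * B" k])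
          (unfold norm_mult, intro mult_mono F B norm_ge_zero)
      then show "norm (c k * (?a k - avg (\<lambda>n. f (s n x) * v (n - k) x) N)) \<le> norm (c k) * (2 * \<bar>real_of_int k\<bar> * (F * B) / N)"
        unfolding norm_mult by (intro mult_left_mono) auto
    qed
    also have "\<dots> = C / N" unfolding C_def sum_divide_distrib by simp
    finally have 2: "norm ((\<Sum>k\<in>K. c k * ?a k) - E3 N x) \<le> C / N" .
    show ?thesis
      unfolding 1
      using 2 norm_triangle_ineq[of "E1 N x" "\<Sum>k\<in>K. c k * ?a k"]
        norm_triangle_sub[of "\<Sum>k\<in>K. c k * ?a k" "E3 N x"]
      by linarith
  qed
  have E1: "(LINT x|M. norm (E1 N x)) \<le> e / 4" for N
  proof -
    have i: "integrable M (\<lambda>x. norm (d (s n x)))" for n by (intro bm_integrable_norm bm_action d)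
    have "(LINT x|M. norm (E1 N x)) \<le> (LINT x|M. B * avg (\<lambda>n. norm (d (s n x))) N)"
    proof (rule integral_mono)
      show "integrable M (\<lambda>x. norm (E1 N x))"
        unfolding E1_def by (intro bm_integrable_norm bm_avg bm_mult bm_action d v)
      show "integrable M (\<lambda>x. B * avg (\<lambda>n. norm (d (s n x))) N)" unfolding avg_def using i by simp
      fix x
      have "norm (E1 N x) \<le> avg (\<lambda>n. norm (d (s n x) * v n x)) N" unfolding E1_def by (rule norm_avg_le)
      also have "\<dots> \<le> avg (\<lambda>n. B * norm (d (s n x))) N"
        by (rule avg_mono) (unfold norm_mult, subst mult.commute, intro mult_right_mono B norm_ge_zero)
      finally show "norm (E1 N x) \<le> B * avg (\<lambda>n. norm (d (s n x))) N" by (simp only: avg_mult_left)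
    qed
    also have "\<dots> = B * avg (\<lambda>n. LINT x|M. norm (d (s n x))) N"
      using integral_avg[of "\<lambda>n x. norm (d (s n x))", OF i] by simp
    also have "\<dots> = B * avg (\<lambda>n. LINT x|M. norm (d x)) N"
      using integral_action[of "\<lambda>x. norm (d x)"] bm_measurable[OF d] by simp
    also have "\<dots> \<le> B * q"
    proof (intro mult_left_mono avg_le_const B0)
      show "(LINT x|M. norm (d x)) \<le> q"
      proof (rule power2_le_imp_le)
        show "(LINT x|M. norm (d x))\<^sup>2 \<le> q\<^sup>2"
          using integral_norm_square_le[OF d] close unfolding d_def by linarith
      qed (use q in simp)
    qed (use q in simp)
    finally show ?thesis using q_B by linarith
  qed
  define Q where "Q N = avg (\<lambda>n. LINT x|M. (norm (w n x))\<^sup>2) N" for N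
  have E3: "(LINT x|M. norm (E3 N x)) \<le> F * sqrt (Q N)" for N
  proof -
    have i: "integrable M (\<lambda>x. norm (w n x))" for n by (intro bm_integrable_norm w)
    have "(LINT x|M. norm (E3 N x)) \<le> (LINT x|M. F * avg (\<lambda>n. norm (w n x)) N)"
    proof (rule integral_mono)
      show "integrable M (\<lambda>x. norm (E3 N x))"
        unfolding E3_def by (intro bm_integrable_norm bm_avg bm_mult bm_action f w)
      show "integrable M (\<lambda>x. F * avg (\<lambda>n. norm (w n x)) N)" unfolding avg_def using i by simp
      fix x
      have "norm (E3 N x) \<le> avg (\<lambda>n. norm (f (s n x) * w n x)) N" unfolding E3_def by (rule norm_avg_le)
      also have "\<dots> \<le> avg (\<lambda>n. F * norm (w n x)) N"
        by (rule avg_mono) (unfold norm_mult, intro mult_right_mono F norm_ge_zero)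
      finally show "norm (E3 N x) \<le> F * avg (\<lambda>n. norm (w n x)) N" by (simp only: avg_mult_left)
    qed
    also have "\<dots> = F * avg (\<lambda>n. LINT x|M. norm (w n x)) N"
      using integral_avg[of "\<lambda>n x. norm (w n x)", OF i] by simp
    also have "\<dots> \<le> F * sqrt (Q N)"
    proof (intro mult_left_mono real_le_rsqrt F)
      have "(avg (\<lambda>n. LINT x|M. norm (w n x)) N)\<^sup>2 \<le> avg (\<lambda>n. (LINT x|M. norm (w n x))\<^sup>2) N"
        using norm_avg_square_le[of "\<lambda>n. LINT x|M. norm (w n x)" N] by simp
      also have "\<dots> \<le> Q N" unfolding Q_def by (intro avg_mono integral_norm_square_le w)
      finally show "(avg (\<lambda>n. LINT x|M. norm (w n x)) N)\<^sup>2 \<le> Q N" .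
    qed
    finally show ?thesis .
  qed
  have \<gamma>0: "norm (\<gamma> 0) \<le> B\<^sup>2"
  proof (rule LIMSEQ_le_const2[OF tendsto_norm[OF \<gamma>(1)[of 0]]], intro exI allI impI)
    fix N
    show "norm (avg (\<lambda>n. LINT x|M. v (n + 0) x * cnj (v n x)) N) \<le> B\<^sup>2"
      unfolding power2_eq_square
    proof (intro norm_avg_le_const norm_integral_le mult_nonneg_nonneg B0)
      show "norm (v (n + 0) x * cnj (v n x)) \<le> B * B" for n x
        unfolding norm_mult complex_mod_cnj by (intro mult_mono B B0 norm_ge_zero)
    qed
  qed
  let ?K = "uminus ` K"
  let ?c = "\<lambda>k. c (- k)"
  let ?L = "\<Sum>k\<in>?K. \<Sum>j\<in>?K. ?c k * cnj (?c j) * \<gamma> (k - j)"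
  have w_eq: "w n x = (\<Sum>k\<in>?K. ?c k * v (n + k) x)" for n x
    unfolding w_def by (subst sum.reindex) (auto simp: inj_on_def)
  have Q_lim: "(\<lambda>N. complex_of_real (Q N)) \<longlonglongrightarrow> ?L"
    unfolding Q_def w_eq by (rule avg_norm_square_combination[OF v B \<gamma>(1)])
  have "?L = (\<Sum>k\<in>?K. \<Sum>j\<in>?K. if j = k then ?c k * cnj (?c k) * \<gamma> 0 else 0)"
    using \<gamma>(2) by (intro sum.cong refl) auto
  also have "\<dots> = (\<Sum>k\<in>?K. ?c k * cnj (?c k) * \<gamma> 0)"
    using K by (intro sum.cong refl) (simp add: sum.delta)
  also have "\<dots> = (\<Sum>k\<in>K. c k * cnj (c k) * \<gamma> 0)"
    by (subst sum.reindex) (auto simp: inj_on_def)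
  also have "\<dots> = complex_of_real (\<Sum>k\<in>K. (norm (c k))\<^sup>2) * \<gamma> 0"
    by (simp only: complex_norm_square[symmetric] sum_distrib_right[symmetric] of_real_sum)
  finally have L_eq: "?L = complex_of_real (\<Sum>k\<in>K. (norm (c k))\<^sup>2) * \<gamma> 0" .
  have "norm ?L = (\<Sum>k\<in>K. (norm (c k))\<^sup>2) * norm (\<gamma> 0)"
    unfolding L_eq norm_mult norm_of_real by (simp only: abs_of_nonneg sum_nonneg zero_le_power2)
  also have "\<dots> \<le> q\<^sup>2 * B\<^sup>2" using c \<gamma>0 by (intro mult_mono) (auto simp: sum_nonneg)
  also have "\<dots> < ((B + 1) * q)\<^sup>2"
  proof -
    have "B\<^sup>2 < (B + 1)\<^sup>2" using B0 by (intro power_strict_mono) auto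
    then show ?thesis using q by (simp add: power_mult_distrib mult.commute)
  qed
  finally have L: "norm ?L < ((B + 1) * q)\<^sup>2" .
  have "\<forall>\<^sub>F N in sequentially. norm (complex_of_real (Q N)) < ((B + 1) * q)\<^sup>2"
    by (rule order_tendstoD(2)[OF tendsto_norm[OF Q_lim] L])
  moreover have "\<forall>\<^sub>F N in sequentially. C / N < e / 4"
    by (rule order_tendstoD(2)[OF lim_const_over_n]) (use e in simp)
  ultimately have "\<forall>\<^sub>F N in sequentially. norm ((LINT x|M. norm (avg (\<lambda>n. f (s n x) * v n x) N)) - 0) < e"
  proof eventually_elim
    case (elim N)
    have "sqrt (Q N) \<le> sqrt (((B + 1) * q)\<^sup>2)" using elim(1) by (intro real_sqrt_le_mono) (simp add: abs_less_iff)
    also have "\<dots> = (B + 1) * q" using B0 q by (simp add: real_sqrt_abs)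
    finally have "F * sqrt (Q N) \<le> F * ((B + 1) * q)" using F by (intro mult_left_mono) auto
    then have E3': "(LINT x|M. norm (E3 N x)) \<le> e / 4" using E3[of N] q_FB by linarith
    have i1: "integrable M (\<lambda>x. norm (E1 N x))"
      unfolding E1_def by (intro bm_integrable_norm bm_avg bm_mult bm_action d v)
    have i3: "integrable M (\<lambda>x. norm (E3 N x))"
      unfolding E3_def by (intro bm_integrable_norm bm_avg bm_mult bm_action f w)
    have "(LINT x|M. norm (avg (\<lambda>n. f (s n x) * v n x) N)) \<le> (LINT x|M. norm (E1 N x) + C / N + norm (E3 N x))"
    proof (rule integral_mono)
      show "integrable M (\<lambda>x. norm (avg (\<lambda>n. f (s n x) * v n x) N))"
        by (intro bm_integrable_norm bm_avg bm_mult bm_action f v)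
      show "integrable M (\<lambda>x. norm (E1 N x) + C / N + norm (E3 N x))" using i1 i3 by simp
    qed (rule decomp)
    also have "\<dots> = (LINT x|M. norm (E1 N x)) + C / N + (LINT x|M. norm (E3 N x))"
      using i1 i3 by (simp add: prob_space)
    also have "\<dots> < e" using E1[of N] E3' elim(2) e by linarith
    finally show ?case by (simp add: integral_nonneg_AE)
  qed
  then show "\<exists>no. \<forall>N\<ge>no. norm ((LINT x|M. norm (avg (\<lambda>n. f (s n x) * v n x) N)) - 0) < e"
    unfolding eventually_sequentially .
qed

text \<open>Sequences of functions whose averages tend to 0 in \<open>L^2\<close>.\<close>

definition L2_null :: "'a measure \<Rightarrow> (int \<Rightarrow> 'a \<Rightarrow> complex) \<Rightarrow> bool" where
  "L2_null M F \<longleftrightarrow> (\<lambda>N. LINT x|M. (norm (avg (\<lambda>n. F n x) N))\<^sup>2) \<longlonglongrightarrow> 0"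

context prob_space
begin

lemma L2_null_add:
  assumes F: "\<And>n. F n \<in> bm M" and G: "\<And>n. G n \<in> bm M" and "L2_null M F" "L2_null M G"
  shows "L2_null M (\<lambda>n x. F n x + G n x)"
  unfolding L2_null_def
proof (rule tendsto_sandwich[OF _ _ tendsto_const])
  let ?I = "\<lambda>F N. LINT x|M. (norm (avg (\<lambda>n. F n x) N))\<^sup>2"
  have "(\<lambda>N. 2 * ?I F N + 2 * ?I G N) \<longlonglongrightarrow> 2 * 0 + 2 * 0"
    by (intro tendsto_intros assms(3,4)[unfolded L2_null_def])
  then show "(\<lambda>N. 2 * ?I F N + 2 * ?I G N) \<longlonglongrightarrow> 0" by simp
  show "\<forall>\<^sub>F N in sequentially. 0 \<le> ?I (\<lambda>n x. F n x + G n x) N" by simp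
  have "?I (\<lambda>n x. F n x + G n x) N \<le> 2 * ?I F N + 2 * ?I G N" for N
  proof -
    have iF: "integrable M (\<lambda>x. (norm (avg (\<lambda>n. F n x) N))\<^sup>2)" and iG: "integrable M (\<lambda>x. (norm (avg (\<lambda>n. G n x) N))\<^sup>2)"
      by (intro bm_integrable_norm_power bm_avg F G)+
    have "?I (\<lambda>n x. F n x + G n x) N \<le> (LINT x|M. 2 * (norm (avg (\<lambda>n. F n x) N))\<^sup>2 + 2 * (norm (avg (\<lambda>n. G n x) N))\<^sup>2)"
    proof (rule integral_mono)
      show "integrable M (\<lambda>x. (norm (avg (\<lambda>n. F n x + G n x) N))\<^sup>2)"
        by (intro bm_integrable_norm_power bm_avg bm_add F G)
      show "integrable M (\<lambda>x. 2 * (norm (avg (\<lambda>n. F n x) N))\<^sup>2 + 2 * (norm (avg (\<lambda>n. G n x) N))\<^sup>2)"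
        using iF iG by simp
      fix x
      let ?y = "avg (\<lambda>n. F n x) N" and ?z = "avg (\<lambda>n. G n x) N"
      have "(norm (?y + ?z))\<^sup>2 \<le> (norm ?y + norm ?z)\<^sup>2" by (intro power_mono norm_triangle_ineq norm_ge_zero)
      also have "\<dots> \<le> 2 * (norm ?y)\<^sup>2 + 2 * (norm ?z)\<^sup>2"
        using sum_squares_bound[of "norm ?y" "norm ?z"] by (simp add: power2_sum)
      finally show "(norm (avg (\<lambda>n. F n x + G n x) N))\<^sup>2 \<le> 2 * (norm ?y)\<^sup>2 + 2 * (norm ?z)\<^sup>2"
        unfolding avg_add .
    qed
    then show ?thesis using iF iG by simp
  qed
  then show "\<forall>\<^sub>F N in sequentially. ?I (\<lambda>n x. F n x + G n x) N \<le> 2 * ?I F N + 2 * ?I G N"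
    by (intro always_eventually allI)
qed

lemma L2_null_cmult:
  assumes "L2_null M F" shows "L2_null M (\<lambda>n x. c * F n x)"
proof -
  have "(\<lambda>N. (norm c)\<^sup>2 * (LINT x|M. (norm (avg (\<lambda>n. F n x) N))\<^sup>2)) \<longlonglongrightarrow> (norm c)\<^sup>2 * 0"
    by (intro tendsto_mult tendsto_const assms[unfolded L2_null_def])
  then show ?thesis
    unfolding L2_null_def avg_mult_left norm_mult power_mult_distrib by simp
qed

lemma L2_null_of_L1:
  assumes F: "\<And>n. F n \<in> bm M" and C: "\<And>n x. norm (F n x) \<le> C"
    and L1: "(\<lambda>N. LINT x|M. norm (avg (\<lambda>n. F n x) N)) \<longlonglongrightarrow> 0"
  shows "L2_null M F"
  unfolding L2_null_def
proof (rule tendsto_sandwich[OF _ _ tendsto_const])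
  have C0: "0 \<le> C" using C[of 0 undefined] norm_ge_zero order_trans by blast
  have "(\<lambda>N. C * (LINT x|M. norm (avg (\<lambda>n. F n x) N))) \<longlonglongrightarrow> C * 0"
    by (intro tendsto_mult tendsto_const L1)
  then show "(\<lambda>N. C * (LINT x|M. norm (avg (\<lambda>n. F n x) N))) \<longlonglongrightarrow> 0" by simp
  show "\<forall>\<^sub>F N in sequentially. 0 \<le> (LINT x|M. (norm (avg (\<lambda>n. F n x) N))\<^sup>2)" by simp
  have "(LINT x|M. (norm (avg (\<lambda>n. F n x) N))\<^sup>2) \<le> C * (LINT x|M. norm (avg (\<lambda>n. F n x) N))" for N
  proof -
    have "(LINT x|M. (norm (avg (\<lambda>n. F n x) N))\<^sup>2) \<le> (LINT x|M. C * norm (avg (\<lambda>n. F n x) N))"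
    proof (rule integral_mono)
      show "integrable M (\<lambda>x. (norm (avg (\<lambda>n. F n x) N))\<^sup>2)"
        by (intro bm_integrable_norm_power bm_avg F)
      have "integrable M (\<lambda>x. norm (avg (\<lambda>n. F n x) N))" by (intro bm_integrable_norm bm_avg F)
      then show "integrable M (\<lambda>x. C * norm (avg (\<lambda>n. F n x) N))" by simp
      show "(norm (avg (\<lambda>n. F n x) N))\<^sup>2 \<le> C * norm (avg (\<lambda>n. F n x) N)" for x
        unfolding power2_eq_square by (intro mult_right_mono norm_avg_le_const C C0 norm_ge_zero)
    qed
    then show ?thesis by simp
  qed
  then show "\<forall>\<^sub>F N in sequentially. (LINT x|M. (norm (avg (\<lambda>n. F n x) N))\<^sup>2) \<le> C * (LINT x|M. norm (avg (\<lambda>n. F n x) N))"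
    by (intro always_eventually allI)
qed

end

section \<open>The averages\<close>

lemma averages_null_mean_zero:
  assumes M: "prob_space M" and T: "mp_automorphism M T" "singular_spectrum M T"
    and comm: "commuting_actions M s r" and wm: "weakly_mixing_action M s"
    and Q: "finite Q" "Q \<subseteq> Z0" "\<And>p. p \<in> Q \<Longrightarrow> 2 \<le> degree p" "Q \<noteq> {}"
    and f: "f \<in> bm M" and h: "h \<in> bm M" and G: "\<And>p. G p \<in> bm M" "\<And>p. p \<in> Q \<Longrightarrow> (LINT x|M. G p x) = 0"
  shows "L2_null M (\<lambda>n x. f (aut_pow M T n x) * (h (r n x) * (\<Prod>p\<in>Q. G p (s (ipoly_value p n) x))))"
proof -
  let ?t = "aut_pow M T"
  interpret C: commuting_actions M s r by fact
  interpret A: mp_action M ?t by (rule mp_action_aut_pow[OF M T(1)])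
  define v where "v n x = h (r n x) * (\<Prod>p\<in>Q. G p (s (ipoly_value p n) x))" for n x
  have v: "v n \<in> bm M" for n unfolding v_def by (rule C.poly_corr_integrand_bm[OF h G(1)])
  obtain b where b: "0 \<le> b" "\<And>x. norm (h x) \<le> b" using bm_bound[OF h] by metis
  have "\<forall>p. \<exists>c. 0 \<le> c \<and> (\<forall>x. norm (G p x) \<le> c)" using bm_bound[OF G(1)] by metis
  then obtain c where c: "\<And>p. 0 \<le> c p" "\<And>p x. norm (G p x) \<le> c p" by metis
  have vB: "norm (v n x) \<le> b * (\<Prod>p\<in>Q. c p)" for n x
    unfolding v_def norm_mult prod_norm[symmetric]
    by (intro mult_mono prod_mono prod_nonneg conjI norm_ge_zero b c)
  have "\<exists>\<gamma>. (\<forall>k. avg (\<lambda>n. LINT x|M. v (n + k) x * cnj (v n x)) \<longlonglongrightarrow> \<gamma> k) \<and> (\<forall>k. k \<noteq> 0 \<longrightarrow> \<gamma> k = 0)"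
    unfolding v_def by (rule C.nonlinear_self_correlation[OF wm Q h]) (use G in auto)
  then obtain \<gamma> where \<gamma>: "\<And>k. avg (\<lambda>n. LINT x|M. v (n + k) x * cnj (v n x)) \<longlonglongrightarrow> \<gamma> k" "\<And>k. k \<noteq> 0 \<Longrightarrow> \<gamma> k = 0"
    by blast
  let ?c = "LINT x|M. f x"
  define f0 where "f0 x = f x - ?c" for x
  have f0: "f0 \<in> bm M" unfolding f0_def by (intro bm_diff bm_const f)
  have f0_int: "(LINT x|M. f0 x) = 0"
    unfolding f0_def using C.bm_integrable[OF f] by (simp add: C.prob_space)
  obtain F where F: "0 \<le> F" "\<And>x. norm (f0 x) \<le> F" using bm_bound[OF f0] by metis
  have f0v: "(\<lambda>x. f0 (?t n x) * v n x) \<in> bm M" for n by (intro bm_mult A.bm_action f0 v)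
  have "(\<lambda>N. LINT x|M. norm (avg (\<lambda>n. f0 (?t n x) * v n x) N)) \<longlonglongrightarrow> 0"
    by (rule A.singular_orthogonality_L1[OF v vB \<gamma> f0 singular_spectrum_approximation[OF M T f0 f0_int]])
  then have 1: "L2_null M (\<lambda>n x. f0 (?t n x) * v n x)"
    by (rule C.L2_null_of_L1[OF f0v, rotated]) (unfold norm_mult, rule mult_mono[OF F(2) vB F(1) norm_ge_zero])
  have "(\<Sum>k\<in>{-int H..int H}. norm (\<gamma> k)) = norm (\<gamma> 0)" for H
  proof -
    have "(\<Sum>k\<in>{-int H..int H}. norm (\<gamma> k)) = (\<Sum>k\<in>{0}. norm (\<gamma> k))"
      by (rule sum.mono_neutral_right) (use \<gamma>(2) in auto)
    then show ?thesis by simp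
  qed
  then have "(\<lambda>H. (\<Sum>k\<in>{-int H..int H}. norm (\<gamma> k)) / H) \<longlonglongrightarrow> 0" by (simp add: lim_const_over_n)
  then have "L2_null M v"
    unfolding L2_null_def by (rule C.van_der_Corput[OF v vB \<gamma>(1)])
  then have 2: "L2_null M (\<lambda>n x. ?c * v n x)" by (rule C.L2_null_cmult)
  have "L2_null M (\<lambda>n x. f0 (?t n x) * v n x + ?c * v n x)"
    by (rule C.L2_null_add[OF f0v bm_mult[OF bm_const v] 1 2])
  moreover have "f0 (?t n x) * v n x + ?c * v n x = f (?t n x) * v n x" for n x
    by (simp add: f0_def algebra_simps)
  ultimately show ?thesis by (simp only: v_def)
qed

text \<open>It suffices that one of the functions has integral zero: the functions of \<open>A\<close> are split into
  their integrals and functions with integral zero, one after the other.\<close>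

lemma averages_null:
  assumes M: "prob_space M" and T: "mp_automorphism M T" "singular_spectrum M T"
    and comm: "commuting_actions M s r" and wm: "weakly_mixing_action M s"
    and f: "f \<in> bm M" and h: "h \<in> bm M"
    and "finite A" "finite B" "B \<noteq> {}" "A \<inter> B = {}" "A \<union> B \<subseteq> Z0" "\<And>p. p \<in> A \<union> B \<Longrightarrow> 2 \<le> degree p"
    and "\<And>p. G p \<in> bm M" "\<And>p. p \<in> B \<Longrightarrow> (LINT x|M. G p x) = 0"
  shows "L2_null M (\<lambda>n x. f (aut_pow M T n x) * (h (r n x) * (\<Prod>p\<in>A \<union> B. G p (s (ipoly_value p n) x))))"
  using assms(8-)
proof (induction A arbitrary: B G rule: finite_induct)
  case empty
  show ?case
    using averages_null_mean_zero[OF M T comm wm, of B f h G] empty f h by simp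
next
  case (insert a A)
  let ?t = "aut_pow M T"
  interpret C: commuting_actions M s r by fact
  interpret A: mp_action M ?t by (rule mp_action_aut_pow[OF M T(1)])
  let ?F = "\<lambda>P G n x. f (?t n x) * (h (r n x) * (\<Prod>p\<in>P. G p (s (ipoly_value p n) x)))"
  let ?c = "LINT x|M. G a x"
  define G0 where "G0 = G(a := \<lambda>x. G a x - ?c)"
  have G: "G p \<in> bm M" for p using insert.prems by blast
  have G0: "G0 p \<in> bm M" for p unfolding G0_def using G by (auto intro: bm_diff)
  have a: "a \<notin> A \<union> B" using insert by blast
  have finAB: "finite (A \<union> B)" using insert by blast
  have F: "?F P G' n \<in> bm M" if "\<And>p. G' p \<in> bm M" for P n and G' :: "rat poly \<Rightarrow> 'a \<Rightarrow> complex"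
    by (intro bm_mult[OF A.bm_action[OF f] C.poly_corr_integrand_bm[OF h that]])
  have 1: "L2_null M (?F (A \<union> B) G)"
    by (rule insert.IH) (use insert.prems in auto)
  have 2: "L2_null M (?F (A \<union> insert a B) G0)"
  proof (rule insert.IH)
    show "finite (insert a B)" "insert a B \<noteq> {}" "A \<inter> insert a B = {}" "A \<union> insert a B \<subseteq> Z0"
      using insert.prems a by auto
    show "2 \<le> degree p" if "p \<in> A \<union> insert a B" for p using that insert.prems(5) by blast
    show "G0 p \<in> bm M" for p by (rule G0)
    show "(LINT x|M. G0 p x) = 0" if p: "p \<in> insert a B" for p
    proof (cases "p = a")
      case True
      then show ?thesis unfolding G0_def using C.bm_integrable[OF G[of a]] by (simp add: C.prob_space)
    next
      case False
      then show ?thesis using p insert.prems(7) by (simp add: G0_def)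
    qed
  qed
  have set_eq: "insert a A \<union> B = insert a (A \<union> B)" "A \<union> insert a B = insert a (A \<union> B)" by auto
  have prodG0: "(\<Prod>p\<in>A \<union> B. G0 p (y p)) = (\<Prod>p\<in>A \<union> B. G p (y p))" for y
    using a by (intro prod.cong refl) (auto simp: G0_def)
  have "?F (insert a A \<union> B) G n x = ?c * ?F (A \<union> B) G n x + ?F (A \<union> insert a B) G0 n x" for n x
    unfolding set_eq prod.insert[OF finAB a] prodG0 by (simp add: G0_def algebra_simps)
  moreover have "L2_null M (\<lambda>n x. ?c * ?F (A \<union> B) G n x + ?F (A \<union> insert a B) G0 n x)"
    by (rule C.L2_null_add[OF bm_mult[OF bm_const F[OF G]] F[OF G0] C.L2_null_cmult[OF 1] 2])
  ultimately show ?case by presburger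
qed

lemma in_Linf_bm_representative:
  assumes "in_Linf M f"
  obtains f' where "f' \<in> bm M" "AE x in M. f x = f' x"
proof -
  obtain C where [measurable]: "f \<in> borel_measurable M" and C: "AE x in M. norm (f x) \<le> C"
    using assms unfolding in_Linf_def by blast
  let ?f = "\<lambda>x. if norm (f x) \<le> C then f x else 0"
  have "?f \<in> bm M"
    by (rule bmI[of _ _ "max C 0"]) auto
  moreover have "AE x in M. f x = ?f x" using C by eventually_elim simp
  ultimately show ?thesis using that by blast
qed

theorem theorem1p14:
  fixes M :: "'a measure" and T R S :: "'a \<Rightarrow> 'a"
    and l :: nat and p :: "nat \<Rightarrow> rat poly"
    and f h :: "'a \<Rightarrow> complex" and g :: "nat \<Rightarrow> 'a \<Rightarrow> complex"
  assumes "prob_space M"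
    and "mp_automorphism M T" and "mp_automorphism M R" and "mp_automorphism M S"
    and "singular_spectrum M T"
    and "\<And>x. x \<in> space M \<Longrightarrow> R (S x) = S (R x)"
    and "weakly_mixing M S"
    and "l \<ge> 1"
    and "\<And>j. j \<in> {1..l} \<Longrightarrow> integer_poly (p j)"
    and "\<And>j. j \<in> {1..l} \<Longrightarrow> degree (p j) \<ge> 2"
    and "\<And>i j. i \<in> {1..l} \<Longrightarrow> j \<in> {1..l} \<Longrightarrow> i \<noteq> j \<Longrightarrow> essentially_distinct (p i) (p j)"
    and "in_Linf M f" and "in_Linf M h"
    and "\<And>j. j \<in> {1..l} \<Longrightarrow> in_Linf M (g j)"
    and "\<exists>j\<in>{1..l}. (LINT x|M. g j x) = 0"
  shows "L2_tendsto M
           (\<lambda>N x. (1 / of_nat N) *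
              (\<Sum>n=1..N. koopman M T (int n) f x * koopman M R (int n) h x *
                 (\<Prod>j=1..l. koopman M S (ipoly_value (p j) (int n)) (g j) x)))
           (\<lambda>x. 0)"
proof -
  note int_poly = assms(9) and deg = assms(10) and distinct = assms(11)
  let ?t = "aut_pow M T" and ?r = "aut_pow M R" and ?s = "aut_pow M S"
  interpret T: mp_action M ?t by (rule mp_action_aut_pow[OF assms(1,2)])
  interpret C: commuting_actions M ?s ?r
    by (rule commuting_actionsI[OF mp_action_aut_pow[OF assms(1,4)] mp_action_aut_pow[OF assms(1,3)]])
      (simp add: aut_pow_def assms(6))
  have wm: "weakly_mixing_action M ?s" by (rule weakly_mixing_action_aut_pow[OF assms(1,4,7)])
  obtain f' where f': "f' \<in> bm M" "AE x in M. f x = f' x" using in_Linf_bm_representative[OF assms(12)] .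
  obtain h' where h': "h' \<in> bm M" "AE x in M. h x = h' x" using in_Linf_bm_representative[OF assms(13)] .
  have "\<forall>j. \<exists>u. u \<in> bm M \<and> (j \<in> {1..l} \<longrightarrow> (AE x in M. g j x = u x))"
    using in_Linf_bm_representative[OF assms(14)] bm_const by metis
  then obtain g' where g': "\<And>j. g' j \<in> bm M" "\<And>j. j \<in> {1..l} \<Longrightarrow> AE x in M. g j x = g' j x" by metis
  \<comment> \<open>The constant terms of the polynomials are moved into the functions.\<close>
  let ?\<phi> = "\<lambda>j. drop_const (p j)"
  define P where "P = ?\<phi> ` {1..l}"
  define idx where "idx = the_inv_into {1..l} ?\<phi>"
  define G where "G q x = g' (idx q) (?s (ipoly_value (p (idx q)) 0) x)" for q x
  have inj: "inj_on ?\<phi> {1..l}"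
  proof (rule inj_onI, rule ccontr)
    fix i j assume ij: "i \<in> {1..l}" "j \<in> {1..l}" "?\<phi> i = ?\<phi> j" "i \<noteq> j"
    then show False
      using distinct[OF ij(1,2,4)] drop_const_eq_imp_diff_const[OF ij(3)] unfolding essentially_distinct_def by blast
  qed
  have idx: "idx (?\<phi> j) = j" if "j \<in> {1..l}" for j
    unfolding idx_def by (rule the_inv_into_f_f[OF inj that])
  have G: "G q \<in> bm M" for q unfolding G_def by (rule C.bm_action[OF g'(1)])
  have P: "finite P" "P \<subseteq> Z0" "\<And>q. q \<in> P \<Longrightarrow> 2 \<le> degree q"
    unfolding P_def using int_poly deg by (auto simp: degree_drop_const intro!: drop_const_Z0)
  obtain i where i: "i \<in> {1..l}" "(LINT x|M. g i x) = 0" using assms(15) by blast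
  let ?q = "?\<phi> i"
  have q: "?q \<in> P" using i by (simp add: P_def)
  have "(LINT x|M. G ?q x) = (LINT x|M. g' i x)"
    unfolding G_def idx[OF i(1)] by (rule C.integral_action[OF bm_measurable[OF g'(1)]])
  also have "\<dots> = (LINT x|M. g i x)"
    using g'(2)[OF i(1)] assms(14)[OF i(1)] bm_measurable[OF g'(1)[of i]]
    by (intro integral_cong_AE) (auto simp: in_Linf_def)
  finally have Gq: "(LINT x|M. G ?q x) = 0" using i by simp
  define F where "F n x = f' (?t n x) * (h' (?r n x) * (\<Prod>q\<in>P. G q (?s (ipoly_value q n) x)))" for n x
  have F: "F n \<in> bm M" for n
    unfolding F_def by (intro bm_mult[OF T.bm_action[OF f'(1)] C.poly_corr_integrand_bm[OF h'(1) G]])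
  have "P - {?q} \<union> {?q} = P" using q by blast
  then have null: "L2_null M F"
    using averages_null[OF assms(1,2,5) C.commuting_actions_axioms wm f'(1) h'(1), of "P - {?q}" "{?q}" G] P G Gq q
    unfolding F_def[abs_def] by simp
  let ?H = "\<lambda>N x. (1 / of_nat N) * (\<Sum>n=1..N. koopman M T (int n) f x * koopman M R (int n) h x *
                 (\<Prod>j=1..l. koopman M S (ipoly_value (p j) (int n)) (g j) x))"
  have AE_f: "AE x in M. \<forall>n. f (?t n x) = f' (?t n x)"
    unfolding AE_all_countable using T.AE_action[OF f'(2)] by blast
  have AE_h: "AE x in M. \<forall>n. h (?r n x) = h' (?r n x)"
    unfolding AE_all_countable using C.R.AE_action[OF h'(2)] by blast
  have AE_g: "AE x in M. \<forall>j\<in>{1..l}. \<forall>n. g j (?s n x) = g' j (?s n x)"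
  proof (rule AE_finite_allI)
    fix j assume "j \<in> {1..l}"
    then show "AE x in M. \<forall>n. g j (?s n x) = g' j (?s n x)"
      unfolding AE_all_countable using C.AE_action[OF g'(2)] by blast
  qed simp
  have eq: "AE x in M. \<forall>N. ?H N x = avg (\<lambda>n. F n x) N"
    using AE_f AE_h AE_g AE_space
  proof eventually_elim
    case (elim x)
    have prod_eq: "(\<Prod>j=1..l. g j (?s (ipoly_value (p j) n) x)) = (\<Prod>q\<in>P. G q (?s (ipoly_value q n) x))" for n
    proof -
      have "(\<Prod>q\<in>P. G q (?s (ipoly_value q n) x)) = (\<Prod>j=1..l. G (?\<phi> j) (?s (ipoly_value (?\<phi> j) n) x))"
        unfolding P_def by (subst prod.reindex[OF inj]) (simp only: comp_def)
      also have "\<dots> = (\<Prod>j=1..l. g j (?s (ipoly_value (p j) n) x))"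
      proof (rule prod.cong[OF refl])
        fix j assume j: "j \<in> {1..l}"
        have "ipoly_value (p j) n = ipoly_value (p j) 0 + ipoly_value (?\<phi> j) n"
          using ipoly_value_drop_const[OF int_poly[OF j], of n] by linarith
        then have "?s (ipoly_value (p j) n) x = ?s (ipoly_value (p j) 0) (?s (ipoly_value (?\<phi> j) n) x)"
          using C.action_add[OF elim(4)] by simp
        moreover have "g j (?s (ipoly_value (p j) n) x) = g' j (?s (ipoly_value (p j) n) x)"
          using elim(3) j by blast
        ultimately show "G (?\<phi> j) (?s (ipoly_value (?\<phi> j) n) x) = g j (?s (ipoly_value (p j) n) x)"
          by (simp only: G_def idx[OF j])
      qed
      finally show ?thesis ..
    qed
    show ?case
    proof
      fix N
      have "?H N x = (1 / of_nat N) * (\<Sum>n=1..N. F (int n) x)"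
        unfolding koopman_def comp_def F_def prod_eq using elim(1,2) by (simp add: mult.assoc)
      also have "(\<Sum>n=1..N. F (int n) x) = (\<Sum>n\<in>int ` {1..N}. F n x)"
        by (subst sum.reindex) (simp_all add: comp_def)
      also have "int ` {1..N} = {1..int N}"
        using image_int_atLeastAtMost[of 1 N] by simp
      finally show "?H N x = avg (\<lambda>n. F n x) N"
        by (simp add: avg_def scaleR_conv_of_real divide_inverse)
    qed
  qed
  have meas: "?H N \<in> borel_measurable M" for N
  proof -
    have [measurable]: "f \<in> borel_measurable M" "h \<in> borel_measurable M"
      using assms(12,13) by (simp_all add: in_Linf_def)
    have g_meas: "g j \<in> borel_measurable M" if "j \<in> {1..l}" for j
      using assms(14)[OF that] by (simp add: in_Linf_def)
    have m1: "(\<lambda>x. \<Prod>j=1..l. koopman M S (ipoly_value (p j) (int n)) (g j) x) \<in> borel_measurable M" for n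
      unfolding koopman_def comp_def
      by (intro borel_measurable_prod measurable_compose[OF C.action_measurable g_meas])
    have m2: "(\<lambda>x. koopman M T (int n) f x * koopman M R (int n) h x) \<in> borel_measurable M" for n
      unfolding koopman_def comp_def
      by (intro borel_measurable_times measurable_compose[OF T.action_measurable] measurable_compose[OF C.R.action_measurable]) simp_all
    show ?thesis
      by (intro borel_measurable_times[OF borel_measurable_const] borel_measurable_sum borel_measurable_times[OF m2 m1])
  qed
  have sq_meas: "(\<lambda>x. (norm (?H N x))\<^sup>2) \<in> borel_measurable M" for N
    by (intro borel_measurable_power measurable_compose[OF meas borel_measurable_norm])
  have avg_bm: "(\<lambda>x. avg (\<lambda>n. F n x) N) \<in> bm M" for N by (rule bm_avg[OF F])
  have sq_AE: "AE x in M. (norm (?H N x))\<^sup>2 = (norm (avg (\<lambda>n. F n x) N))\<^sup>2" for N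
    using eq by eventually_elim simp
  have sq_avg_meas: "(\<lambda>x. (norm (avg (\<lambda>n. F n x) N))\<^sup>2) \<in> borel_measurable M" for N
    by (intro borel_measurable_power measurable_compose[OF bm_measurable[OF avg_bm] borel_measurable_norm])
  have "integrable M (\<lambda>x. (norm (?H N x))\<^sup>2)" for N
    using integrable_cong_AE[OF sq_meas sq_avg_meas sq_AE] T.bm_integrable_norm_power[OF avg_bm] by blast
  then have "in_L2 M (?H N)" for N unfolding in_L2_def using meas by blast
  moreover have "in_L2 M (\<lambda>x. 0)" by (simp add: in_L2_def)
  moreover have "(\<lambda>N. L2_norm M (\<lambda>x. ?H N x - 0)) \<longlonglongrightarrow> 0"
  proof -
    have "L2_norm M (\<lambda>x. ?H N x - 0) = sqrt (LINT x|M. (norm (avg (\<lambda>n. F n x) N))\<^sup>2)" for N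
      unfolding L2_norm_def diff_0_right
      by (rule arg_cong[of _ _ sqrt]) (rule integral_cong_AE[OF sq_meas sq_avg_meas sq_AE])
    moreover have "(\<lambda>N. sqrt (LINT x|M. (norm (avg (\<lambda>n. F n x) N))\<^sup>2)) \<longlonglongrightarrow> sqrt 0"
      by (rule tendsto_real_sqrt) (use null in \<open>simp only: L2_null_def\<close>)
    ultimately show ?thesis by simp
  qed
  ultimately show ?thesis unfolding L2_tendsto_def by blast
qed

end
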